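(* Let $\beta>0$, $\beta'=\beta/2$, and let $(a_n)_n,(b_n)_n$ be positive parameters with $$\frac{\beta' n}{a_n}\xrightarrow[n\to\infty]{}\tau\in(0,1],\qquad \frac{b_n}{n}\xrightarrow[n\to\infty]{}\infty .$$ For each $n$ let $(\lambda_1,\dots,\lambda_n;w_1,\dots,w_n)\sim\mathcal{J}\beta\mathcal{E}(a_n,b_n)$ (all on one probability space). Then the spectral measure $\sum_i w_i\delta_{(b_n/a_n)\lambda_i}$ and the empirical measure $\frac1n\sum_i\delta_{(b_n/a_n)\lambda_i}$ of the rescaled eigenvalues $\frac{b_n}{a_n}\lambda_i$ converge weakly, almost surely, to the Marchenko–Pastur law $\mathrm{MP}(\tau)$.
   Context: Jacobi ensemble $\mathcal{J}\beta\mathcal{E}(a,b)$ in dimension $n$ (with $\beta>0$, $\beta'=\beta/2$, parameters $a,b>\beta'(n-1)$): the joint law of a random eigenvalue vector $(\lambda_1,\dots,\lambda_n)$ with Lebesgue density $$c_{a,b,\beta}\prod_{i<j}|\lambda_i-\lambda_j|^\beta\prod_{i=1}^n\lambda_i^{a-e_\beta}(1-\lambda_i)^{b-e_\beta}\mathbb{1}_{\{0<\lambda_i<1\}},\qquad e_\beta=\tfrac{\beta}{2}(n-1)+1,$$ ($c_{a,b,\beta}$ the normalising constant), together with an independent weight vector $(w_1,\dots,w_n)$ having the Dirichlet distribution with all $n$ parameters equal to $\beta'$. The spectral measure is $\mu_n=\sum_i w_i\delta_{\lambda_i}$; when eigenvalues are rescaled the weights are kept. The Marchenko–Pastur law $\mathrm{MP}(\tau)$,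 $\tau\in(0,1]$, has density $\frac{1}{2\pi\tau x}\sqrt{(x-\tau^-)(\tau^+-x)}\,\mathbb{1}_{\{\tau^-<x<\tau^+\}}$ with $\tau^\pm=(\sqrt\tau\pm1)^2$. *)

theory Defs
  imports "HOL-Probability.Probability"
begin

definition jacobi_unnorm :: "nat \<Rightarrow> real \<Rightarrow> real \<Rightarrow> real \<Rightarrow> (nat \<Rightarrow> real) \<Rightarrow> real" where
  "jacobi_unnorm n \<beta> a b x =
     (if (\<forall>i<n. 0 < x i \<and> x i < 1) then
        (\<Prod>j<n. \<Prod>i<j. \<bar>x i - x j\<bar> powr \<beta>) *
        (\<Prod>i<n. x i powr (a - (\<beta> / 2 * (real n - 1) + 1)) *
                 (1 - x i) powr (b - (\<beta> / 2 * (real n - 1) + 1)))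
      else 0)"

definition jacobi_ensemble :: "nat \<Rightarrow> real \<Rightarrow> real \<Rightarrow> real \<Rightarrow> (nat \<Rightarrow> real) measure" where
  "jacobi_ensemble n \<beta> a b =
     density (PiM {..<n} (\<lambda>_. lborel))
       (\<lambda>x. ennreal (jacobi_unnorm n \<beta> a b x) /
            (\<integral>\<^sup>+ y. ennreal (jacobi_unnorm n \<beta> a b y) \<partial>PiM {..<n} (\<lambda>_. lborel)))"

text \<open>Symmetric Dirichlet distribution Dir(k,...,k) on the (n-1)-simplex in R^n:
  the first n-1 coordinates have the standard Dirichlet density,
  the last coordinate is 1 minus their sum.\<close>
definition dirichlet_sym_density :: "nat \<Rightarrow> real \<Rightarrow> (nat \<Rightarrow> real) \<Rightarrow> real" where
  "dirichlet_sym_density n k y =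
     (if (\<forall>i<n-1. 0 < y i) \<and> (\<Sum>i<n-1. y i) < 1 then
        Gamma (real n * k) / Gamma k ^ n *
        (\<Prod>i<n-1. y i powr (k - 1)) * (1 - (\<Sum>i<n-1. y i)) powr (k - 1)
      else 0)"

definition dirichlet_sym :: "nat \<Rightarrow> real \<Rightarrow> (nat \<Rightarrow> real) measure" where
  "dirichlet_sym n k =
     distr (density (PiM {..<n-1} (\<lambda>_. lborel)) (\<lambda>y. ennreal (dirichlet_sym_density n k y)))
       (PiM {..<n} (\<lambda>_. lborel))
       (\<lambda>y. \<lambda>i\<in>{..<n}. if i < n - 1 then y i else 1 - (\<Sum>j<n-1. y j))"

definition spectral_meas :: "nat \<Rightarrow> real \<Rightarrow> (nat \<Rightarrow> real) \<Rightarrow> (nat \<Rightarrow> real) \<Rightarrow> real measure" where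
  "spectral_meas n c lam w =
     distr (density (count_space {..<n}) (\<lambda>i. ennreal (w i))) borel (\<lambda>i. c * lam i)"

definition mp_density :: "real \<Rightarrow> real \<Rightarrow> real" where
  "mp_density \<tau> x =
     (if (sqrt \<tau> - 1)\<^sup>2 < x \<and> x < (sqrt \<tau> + 1)\<^sup>2 then
        sqrt ((x - (sqrt \<tau> - 1)\<^sup>2) * ((sqrt \<tau> + 1)\<^sup>2 - x)) / (2 * pi * \<tau> * x)
      else 0)"

definition marchenko_pastur :: "real \<Rightarrow> real measure" where
  "marchenko_pastur \<tau> = density lborel (\<lambda>x. ennreal (mp_density \<tau> x))"

end

theory Submission
  imports Defs
begin

text \<open>
  Moving all eigenvalues simultaneously by \<open>\<phi>\<^sub>t(x) = x + t x\<^sup>k\<^sup>+\<^sup>1(1 - x)\<close> maps the cube to itself, so the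
  change-of-variables factor \<open>R\<^sub>t = 1 + tD + t\<^sup>2(D\<^sup>2 - V)/2 + O(t\<^sup>3)\<close> of the Jacobi density has mean 1 for all
  small \<open>t\<close>. Hence \<open>E D = 0\<close> and \<open>E D\<^sup>2 = E V\<close>; no singularity on the diagonals ever appears, whatever \<open>\<beta> > 0\<close>.
  Here \<open>D\<close> is a quadratic polynomial in the empirical moments \<open>m\<^sub>s\<close> of the rescaled eigenvalues. The first
  identity bounds \<open>E m\<^sub>s\<close> uniformly in \<open>n\<close>; the second then shows that the suitably scaled \<open>D\<close> has second
  moment \<open>O(1/n\<^sup>2)\<close>, so it tends to 0 almost surely. In the limit this reads
  \<open>m\<^sub>k\<^sub>+\<^sub>1 = (1 - \<tau>) m\<^sub>k + \<tau> \<Sum>\<^sub>s\<^sub>\<le>\<^sub>k m\<^sub>s m\<^sub>k\<^sub>-\<^sub>s\<close>, which are the Marchenko--Pastur moments, and the method of moments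
  applies. For the spectral measure, an integration by parts against the Dirichlet law bounds the fourth
  moment of \<open>\<Sum>\<^sub>i w\<^sub>i y\<^sub>i - (1/n)\<Sum>\<^sub>i y\<^sub>i\<close> by \<open>O(1/n\<^sup>2)\<close>, so both measures have the same limiting moments.
\<close>

section \<open>Essentially bounded functions and almost sure convergence\<close>

text \<open>The laws for different n may be coupled in any way, so almost sure convergence has to
  come from moment bounds that are summable in n. For \<open>loop_D\<close> a second moment is
  enough: up to powers of a/b both \<open>loop_D\<close> and \<open>loop_V\<close> have size n^2, so
  after normalisation the mean square is O(1/n^2). The weighted sums fluctuate at scale 1/sqrt n;
  their variance is only of order 1/n, which is why the Dirichlet estimate goes up to the fourth
  moment. The factor 1 - x in the flow is forced by the right edge of the cube and raises degrees by
  one. In the variables (b/a) x each extra degree costs a factor a/b, which tends to 0; among the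
  raised terms only the one with the exponent of 1 - x, itself of order b, survives in the limit.
  The limiting equation is a convolution, whereas integration by parts against the Marchenko-Pastur
  density yields a linear three-term recurrence. A generating function reconciles the two.\<close>

definition ess_bounded :: "'a measure \<Rightarrow> ('a \<Rightarrow> real) \<Rightarrow> bool" where
  "ess_bounded M f \<longleftrightarrow> f \<in> borel_measurable M \<and> (\<exists>B. AE x in M. \<bar>f x\<bar> \<le> B)"

lemma ess_boundedI:
  "f \<in> borel_measurable M \<Longrightarrow> AE x in M. \<bar>f x\<bar> \<le> B \<Longrightarrow> ess_bounded M f"
  unfolding ess_bounded_def by blast

lemma ess_bounded_measurable: "ess_bounded M f \<Longrightarrow> f \<in> borel_measurable M"
  unfolding ess_bounded_def by blast

lemma (in finite_measure) ess_bounded_integrable: "ess_bounded M f \<Longrightarrow> integrable M f"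
  unfolding ess_bounded_def using integrable_const_bound[of f] by auto

lemma ess_bounded_const: "ess_bounded M (\<lambda>_. c)"
  by (rule ess_boundedI[of _ _ "\<bar>c\<bar>"]) simp_all

lemma ess_bounded_add:
  assumes "ess_bounded M f" "ess_bounded M g"
  shows "ess_bounded M (\<lambda>x. f x + g x)"
proof -
  from assms obtain A B where "AE x in M. \<bar>f x\<bar> \<le> A" "AE x in M. \<bar>g x\<bar> \<le> B"
    by (auto simp: ess_bounded_def)
  then have "AE x in M. \<bar>f x + g x\<bar> \<le> A + B" by eventually_elim auto
  then show ?thesis using assms by (intro ess_boundedI) (auto simp: ess_bounded_def)
qed

lemma ess_bounded_mult:
  assumes "ess_bounded M f" "ess_bounded M g"
  shows "ess_bounded M (\<lambda>x. f x * g x)"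
proof -
  from assms obtain A B where "AE x in M. \<bar>f x\<bar> \<le> A" "AE x in M. \<bar>g x\<bar> \<le> B"
    by (auto simp: ess_bounded_def)
  then have "AE x in M. \<bar>f x * g x\<bar> \<le> A * B"
    by eventually_elim (auto simp: abs_mult intro!: mult_mono)
  then show ?thesis using assms by (intro ess_boundedI) (auto simp: ess_bounded_def)
qed

lemma ess_bounded_diff:
  assumes "ess_bounded M f" "ess_bounded M g"
  shows "ess_bounded M (\<lambda>x. f x - g x)"
  using ess_bounded_add[OF assms(1) ess_bounded_mult[OF ess_bounded_const[of M "-1"] assms(2)]] by simp

lemma ess_bounded_power: "ess_bounded M f \<Longrightarrow> ess_bounded M (\<lambda>x. f x ^ m)"
  by (induction m) (simp_all add: ess_bounded_mult ess_bounded_const)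

lemma ess_bounded_sum: "(\<And>j. j \<in> A \<Longrightarrow> ess_bounded M (f j)) \<Longrightarrow> ess_bounded M (\<lambda>x. \<Sum>j\<in>A. f j x)"
  by (induction A rule: infinite_finite_induct) (simp_all add: ess_bounded_add ess_bounded_const)

text \<open>On a probability space these closure rules make the integrability of every polynomial in
  bounded coordinates automatic. Boundedness is asked only almost everywhere, because the eigenvalue
  and weight laws live on the whole coordinate space and are merely concentrated on the cube or the
  simplex.\<close>

lemmas ess_bounded_intros = ess_bounded_diff ess_bounded_add ess_bounded_mult ess_bounded_power
  ess_bounded_const ess_bounded_sum

abbreviation coords :: "nat \<Rightarrow> (nat \<Rightarrow> real) measure" where
  "coords n \<equiv> PiM {..<n} (\<lambda>_. lborel)"

text \<open>Borel-Cantelli in integrated form: the expected sum of the p-th powers is finite, so the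
  sum is finite almost surely and its terms tend to 0. The bounds are available only from
  \<open>N\<close> on, hence the shifted index in \<open>g\<close>.\<close>

lemma (in prob_space) AE_tendsto_0_of_summable_moments:
  fixes f :: "nat \<Rightarrow> 'a \<Rightarrow> real"
  assumes meas: "\<And>n. n \<ge> N \<Longrightarrow> f n \<in> borel_measurable M"
    and bound: "\<And>n. n \<ge> N \<Longrightarrow> (\<integral>\<^sup>+ x. ennreal (\<bar>f n x\<bar> ^ p) \<partial>M) \<le> ennreal (C / (real n)\<^sup>2)"
    and p: "0 < p"
  shows "AE x in M. (\<lambda>n. f n x) \<longlonglongrightarrow> 0"
proof -
  define g where "g n x = ennreal (\<bar>f (n + N) x\<bar> ^ p)" for n x
  have [measurable]: "f (n + N) \<in> borel_measurable M" for n by (rule meas) simp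
  have gm: "g n \<in> borel_measurable M" for n unfolding g_def by measurable
  have "summable (\<lambda>n. \<bar>C\<bar> * (1 / (real n)\<^sup>2))"
    using inverse_power_summable[of 2, where 'a = real] by (intro summable_mult) (simp add: field_simps)
  then have sm: "summable (\<lambda>n. \<bar>C\<bar> * (1 / (real (n + N))\<^sup>2))"
    by (rule summable_ignore_initial_segment)
  have "(\<integral>\<^sup>+ x. (\<Sum>n. g n x) \<partial>M) = (\<Sum>n. \<integral>\<^sup>+ x. g n x \<partial>M)"
    by (rule nn_integral_suminf) (rule gm)
  also have "\<dots> \<le> (\<Sum>n. ennreal (\<bar>C\<bar> * (1 / (real (n + N))\<^sup>2)))"
  proof (intro suminf_le summableI)
    fix n
    have "(\<integral>\<^sup>+ x. g n x \<partial>M) \<le> ennreal (C / (real (n + N))\<^sup>2)"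
      unfolding g_def by (rule bound) simp
    also have "\<dots> \<le> ennreal (\<bar>C\<bar> * (1 / (real (n + N))\<^sup>2))"
      by (intro ennreal_leI) (simp add: divide_right_mono)
    finally show "(\<integral>\<^sup>+ x. g n x \<partial>M) \<le> ennreal (\<bar>C\<bar> * (1 / (real (n + N))\<^sup>2))" .
  qed
  also have "\<dots> < \<infinity>" by (subst suminf_ennreal2[OF _ sm]) simp_all
  finally have "(\<integral>\<^sup>+ x. (\<Sum>n. g n x) \<partial>M) \<noteq> \<infinity>" by simp
  moreover have "(\<lambda>x. \<Sum>n. g n x) \<in> borel_measurable M" using gm by measurable
  ultimately have "AE x in M. (\<Sum>n. g n x) \<noteq> \<infinity>"
    by (intro nn_integral_noteq_infinite)
  then show ?thesis
  proof eventually_elim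
    fix x assume "(\<Sum>n. g n x) \<noteq> \<infinity>"
    then have "summable (\<lambda>n. \<bar>f (n + N) x\<bar> ^ p)"
      unfolding g_def by (intro summable_suminf_not_top) simp_all
    then have "(\<lambda>n. \<bar>f (n + N) x\<bar> ^ p) \<longlonglongrightarrow> 0" by (rule summable_LIMSEQ_zero)
    then have "(\<lambda>n. root p (\<bar>f (n + N) x\<bar> ^ p)) \<longlonglongrightarrow> root p 0" by (rule tendsto_real_root)
    then have "(\<lambda>n. \<bar>f (n + N) x\<bar>) \<longlonglongrightarrow> 0" using p by (simp add: real_root_power_cancel)
    then show "(\<lambda>n. f n x) \<longlonglongrightarrow> 0"
      unfolding tendsto_rabs_zero_iff by (rule LIMSEQ_offset)
  qed
qed

section \<open>Marchenko--Pastur moments\<close>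

abbreviation mp_quad :: "real \<Rightarrow> real \<Rightarrow> real" where
  "mp_quad s x \<equiv> (x - (s - 1)\<^sup>2) * ((s + 1)\<^sup>2 - x)"

text \<open>Here s stands for sqrt \<tau>. The first form exhibits a half-circle of radius 2s
  centred at 1 + s^2. The third has the product of the edges, (1 - s^2)^2, as its constant term,
  which is what produces a 1/x after division by x.\<close>

lemma mp_edges:
  assumes "0 < s"
  shows "mp_quad s x = 4 * s\<^sup>2 - (x - 1 - s\<^sup>2)\<^sup>2"
    and "(s - 1)\<^sup>2 \<le> (s + 1 :: real)\<^sup>2"
    and "mp_quad s x = 2 * (1 + s\<^sup>2) * x - x\<^sup>2 - (1 - s\<^sup>2)\<^sup>2"
  using assms by (auto simp: power2_eq_square algebra_simps)

lemma mp_density_nonneg: "0 < \<tau> \<Longrightarrow> 0 \<le> mp_density \<tau> x"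
  unfolding mp_density_def
  using order_trans[OF zero_le_power2[of "sqrt \<tau> - 1"], of x]
  by (auto intro!: divide_nonneg_nonneg mult_nonneg_nonneg)

lemma mp_density_measurable [measurable]: "mp_density \<tau> \<in> borel_measurable borel"
  unfolding mp_density_def by measurable

text \<open>The primitives are built from \<open>sqrt\<close> and \<open>arcsin\<close>, whose
  derivatives are singular at the edges, and for \<tau> = 1 the density itself blows up at the left
  edge 0. So the closed support carries only a continuity requirement, and derivatives are taken in
  the interior.\<close>

lemma mp_has_integral_FTC:
  assumes \<tau>: "0 < \<tau>"
    and cont: "continuous_on {(sqrt \<tau> - 1)\<^sup>2..(sqrt \<tau> + 1)\<^sup>2} F"
    and deriv: "\<And>x. (sqrt \<tau> - 1)\<^sup>2 < x \<Longrightarrow> x < (sqrt \<tau> + 1)\<^sup>2 \<Longrightarrow>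
                  (F has_real_derivative mp_density \<tau> x * g x) (at x)"
  shows "((\<lambda>x. mp_density \<tau> x * g x) has_integral F ((sqrt \<tau> + 1)\<^sup>2) - F ((sqrt \<tau> - 1)\<^sup>2)) UNIV"
proof -
  have "((\<lambda>x. mp_density \<tau> x * g x) has_integral F ((sqrt \<tau> + 1)\<^sup>2) - F ((sqrt \<tau> - 1)\<^sup>2))
          {(sqrt \<tau> - 1)\<^sup>2..(sqrt \<tau> + 1)\<^sup>2}"
    using mp_edges(2)[of "sqrt \<tau>"] \<tau> deriv cont
    by (intro fundamental_theorem_of_calculus_interior)
       (auto simp: has_real_derivative_iff_has_vector_derivative)
  then show ?thesis
    by (rule has_integral_on_superset) (auto simp: mp_density_def)
qed

section \<open>Angle substitutions and primitives for the Marchenko-Pastur density\<close>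

lemma mp_density_interior:
  assumes "0 < s" "(s - 1)\<^sup>2 < x" "x < (s + 1)\<^sup>2"
  shows "mp_density (s\<^sup>2) x = sqrt (mp_quad s x) / (2 * pi * s\<^sup>2 * x)"
proof -
  have "sqrt (s\<^sup>2) = s" using assms by simp
  then show ?thesis using assms unfolding mp_density_def by (simp only: simp_thms if_True)
qed

lemma semicircle_angle:
  \<comment> \<open>The affine coordinate (x - 1 - s^2) / (2s) carries the support onto [-1, 1], so
    its \<open>arcsin\<close> is a primitive of 1 / sqrt q, where q is the quadratic
    \<open>mp_quad s x\<close>.\<close>
  fixes s x :: real
  assumes "0 < s"
  shows "1 - ((x - 1 - s\<^sup>2) / (2 * s))\<^sup>2 = mp_quad s x / (2 * s)\<^sup>2"
proof -
  have "(2 * s)\<^sup>2 \<noteq> 0" using assms by simp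
  then have "1 - (y / (2 * s))\<^sup>2 = (4 * s\<^sup>2 - y\<^sup>2) / (2 * s)\<^sup>2" for y
    by (simp add: power_divide diff_divide_distrib power_mult_distrib)
  then show ?thesis unfolding mp_edges(1)[OF assms] .
qed

lemma semicircle_angle_le:
  fixes s x :: real
  assumes "0 < s" "(s - 1)\<^sup>2 \<le> x" "x \<le> (s + 1)\<^sup>2"
  shows "\<bar>(x - 1 - s\<^sup>2) / (2 * s)\<bar> \<le> 1"
proof -
  have "0 \<le> mp_quad s x / (2 * s)\<^sup>2" using assms by simp
  then show ?thesis unfolding semicircle_angle[OF assms(1), symmetric] by (simp only: diff_ge_0_iff_ge abs_square_le_1)
qed

lemma semicircle_arcsin_continuous:
  fixes s :: real
  assumes "0 < s"
  shows "continuous_on {(s - 1)\<^sup>2..(s + 1)\<^sup>2} (\<lambda>x. arcsin ((x - 1 - s\<^sup>2) / (2 * s)))"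
proof (rule continuous_on_arcsin)
  show "continuous_on {(s - 1)\<^sup>2..(s + 1)\<^sup>2} (\<lambda>x. (x - 1 - s\<^sup>2) / (2 * s))"
    using assms by (intro continuous_intros) auto
  show "\<forall>x\<in>{(s - 1)\<^sup>2..(s + 1)\<^sup>2}. -1 \<le> (x - 1 - s\<^sup>2) / (2 * s) \<and> (x - 1 - s\<^sup>2) / (2 * s) \<le> 1"
  proof
    fix x assume "x \<in> {(s - 1)\<^sup>2..(s + 1)\<^sup>2}"
    then have "\<bar>(x - 1 - s\<^sup>2) / (2 * s)\<bar> \<le> 1" using semicircle_angle_le[OF assms, of x] by (simp only: atLeastAtMost_iff)
    then show "-1 \<le> (x - 1 - s\<^sup>2) / (2 * s) \<and> (x - 1 - s\<^sup>2) / (2 * s) \<le> 1" by linarith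
  qed
qed

lemma semicircle_arcsin_deriv:
  fixes s x :: real
  assumes s: "0 < s" and x: "(s - 1)\<^sup>2 < x" "x < (s + 1)\<^sup>2"
  shows "((\<lambda>x. arcsin ((x - 1 - s\<^sup>2) / (2 * s))) has_real_derivative
           1 / sqrt (mp_quad s x)) (at x)"
proof -
  let ?q = "mp_quad s x"
  have "0 < ?q / (2 * s)\<^sup>2" using x s by simp
  then have u1: "\<bar>(x - 1 - s\<^sup>2) / (2 * s)\<bar> < 1"
    unfolding semicircle_angle[OF s, symmetric] by (simp only: diff_gt_0_iff_gt abs_square_less_1)
  have "((\<lambda>x. (x - 1 - s\<^sup>2) / (2 * s)) has_real_derivative 1 / (2 * s)) (at x)"
    using s by (auto intro!: derivative_eq_intros)
  moreover have "-1 < (x - 1 - s\<^sup>2) / (2 * s)" "(x - 1 - s\<^sup>2) / (2 * s) < 1" using u1 by linarith+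
  ultimately have "((\<lambda>x. arcsin ((x - 1 - s\<^sup>2) / (2 * s))) has_real_derivative
      inverse (sqrt (1 - ((x - 1 - s\<^sup>2) / (2 * s))\<^sup>2)) * (1 / (2 * s))) (at x)"
    by (intro DERIV_chain2[OF DERIV_arcsin])
  also have "inverse (sqrt (1 - ((x - 1 - s\<^sup>2) / (2 * s))\<^sup>2)) * (1 / (2 * s)) = 1 / sqrt ?q"
    unfolding semicircle_angle[OF s] real_sqrt_divide real_sqrt_abs using s by simp
  finally show ?thesis .
qed

lemma semicircle_sqrt_deriv:
  fixes s x :: real
  assumes x: "(s - 1)\<^sup>2 < x" "x < (s + 1)\<^sup>2"
  shows "((\<lambda>x. sqrt (mp_quad s x)) has_real_derivative
           (1 + s\<^sup>2 - x) / sqrt (mp_quad s x)) (at x)"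
proof -
  have q: "0 < mp_quad s x" using x by simp
  have "((\<lambda>x. mp_quad s x) has_real_derivative 2 * (1 + s\<^sup>2 - x)) (at x)"
    by (auto intro!: derivative_eq_intros simp: power2_eq_square algebra_simps)
  from DERIV_chain2[OF DERIV_real_sqrt[OF q] this] show ?thesis
    by (rule DERIV_cong) (simp only: divide_inverse, simp)
qed

text \<open>The quotient is an affine function of 1/x; for s \<noteq> 1 it carries the two edges to
  -1 and 1. It comes from the inversion x -> 1/x, under which q / x^2 is again a quadratic. Its
  \<open>arcsin\<close> supplies the primitive of 1 / (x sqrt q), which the first angle cannot
  give.\<close>

lemma mp_angle:
  fixes s x :: real
  assumes "0 < s" "x \<noteq> 0"
  shows "1 - (((1 + s\<^sup>2) * x - (1 - s\<^sup>2)\<^sup>2) / (2 * s * x))\<^sup>2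
    = (1 - s\<^sup>2)\<^sup>2 * (mp_quad s x) / (2 * s * x)\<^sup>2" (is "1 - (?A / ?B)\<^sup>2 = ?C / ?B\<^sup>2")
proof -
  have *: "?B\<^sup>2 - ?A\<^sup>2 = ?C" unfolding mp_edges(3)[OF assms(1)] by algebra
  have "?B\<^sup>2 \<noteq> 0" using assms by simp
  then have "1 - X / ?B\<^sup>2 = (?B\<^sup>2 - X) / ?B\<^sup>2" for X by (simp only: diff_divide_distrib divide_self_if if_False)
  then show ?thesis unfolding *[symmetric] power_divide .
qed

lemma mp_angle_arcsin_deriv:
  fixes s x :: real
  assumes s: "0 < s" "s\<^sup>2 < 1" and x: "(s - 1)\<^sup>2 < x" "x < (s + 1)\<^sup>2"
  shows "((\<lambda>x. arcsin (((1 + s\<^sup>2) * x - (1 - s\<^sup>2)\<^sup>2) / (2 * s * x))) has_real_derivative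
           (1 - s\<^sup>2) / (x * sqrt (mp_quad s x))) (at x)"
proof -
  define q where "q = mp_quad s x"
  have q: "0 < q" using x by (simp add: q_def)
  define r where "r = 1 - s\<^sup>2"
  have r: "0 < r" using s by (simp add: r_def)
  have x0: "0 < x" using x(1) order_le_less_trans[OF zero_le_power2] by blast
  define v where "v x = ((1 + s\<^sup>2) * x - r\<^sup>2) / (2 * s * x)" for x
  have v2: "1 - (v x)\<^sup>2 = r\<^sup>2 * q / (2 * s * x)\<^sup>2"
    using mp_angle[OF s(1), of x] x0 by (simp add: v_def q_def r_def)
  have "0 < r\<^sup>2 * q / (2 * s * x)\<^sup>2" using q r s x0 by simp
  then have v1: "\<bar>v x\<bar> < 1" unfolding v2[symmetric] by (simp only: diff_gt_0_iff_gt abs_square_less_1)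
  have "(v has_real_derivative r\<^sup>2 / (2 * s * x\<^sup>2)) (at x)"
    unfolding v_def using s x0
    by (auto intro!: derivative_eq_intros simp: divide_simps) (simp add: algebra_simps power2_eq_square)
  moreover have "-1 < v x" "v x < 1" using v1 by linarith+
  ultimately have "((\<lambda>x. arcsin (v x)) has_real_derivative
      inverse (sqrt (1 - (v x)\<^sup>2)) * (r\<^sup>2 / (2 * s * x\<^sup>2))) (at x)"
    using DERIV_chain2[OF DERIV_arcsin] by blast
  also have "inverse (sqrt (1 - (v x)\<^sup>2)) * (r\<^sup>2 / (2 * s * x\<^sup>2)) = r / (x * sqrt q)"
    unfolding v2 using s x0 r q
    by (simp add: real_sqrt_divide real_sqrt_mult) (simp add: field_simps power2_eq_square)
  finally show ?thesis unfolding v_def q_def r_def .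
qed

lemma mp_angle_arcsin_continuous:
  fixes s :: real
  assumes s: "0 < s" "s \<noteq> 1"
  shows "continuous_on {(s - 1)\<^sup>2..(s + 1)\<^sup>2} (\<lambda>x. arcsin (((1 + s\<^sup>2) * x - (1 - s\<^sup>2)\<^sup>2) / (2 * s * x)))"
proof (rule continuous_on_arcsin)
  \<comment> \<open>For s = 1 the left edge would be 0, where the quotient has the default value 0
    instead of its limit 1.\<close>
  have ne: "x \<noteq> 0" if "x \<in> {(s - 1)\<^sup>2..(s + 1)\<^sup>2}" for x
  proof -
    have "0 < (s - 1)\<^sup>2" using s by simp
    then show ?thesis using that by (auto simp del: zero_less_power2)
  qed
  show "continuous_on {(s - 1)\<^sup>2..(s + 1)\<^sup>2} (\<lambda>x. ((1 + s\<^sup>2) * x - (1 - s\<^sup>2)\<^sup>2) / (2 * s * x))"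
    by (intro continuous_intros ballI) (use s ne in auto)
  show "\<forall>x\<in>{(s - 1)\<^sup>2..(s + 1)\<^sup>2}. -1 \<le> ((1 + s\<^sup>2) * x - (1 - s\<^sup>2)\<^sup>2) / (2 * s * x) \<and>
      ((1 + s\<^sup>2) * x - (1 - s\<^sup>2)\<^sup>2) / (2 * s * x) \<le> 1"
  proof
    fix x assume x: "x \<in> {(s - 1)\<^sup>2..(s + 1)\<^sup>2}"
    then have "0 \<le> (1 - s\<^sup>2)\<^sup>2 * (mp_quad s x) / (2 * s * x)\<^sup>2" by simp
    then have "\<bar>((1 + s\<^sup>2) * x - (1 - s\<^sup>2)\<^sup>2) / (2 * s * x)\<bar> \<le> 1"
      unfolding mp_angle[OF s(1) ne[OF x], symmetric] by (simp only: diff_ge_0_iff_ge abs_square_le_1)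
    then show "-1 \<le> ((1 + s\<^sup>2) * x - (1 - s\<^sup>2)\<^sup>2) / (2 * s * x) \<and>
      ((1 + s\<^sup>2) * x - (1 - s\<^sup>2)\<^sup>2) / (2 * s * x) \<le> 1" by linarith
  qed
qed

context
  fixes \<tau> :: real
  assumes \<tau>: "0 < \<tau>" "\<tau> \<le> 1"
begin

text \<open>Writing sqrt q / x as q / (x sqrt q) and expanding q splits the integrand into (1 + s^2
  - x) / sqrt q, (1 + s^2) / sqrt q and -(1 - s^2)^2 / (x sqrt q), with primitives from the root,
  the first and the second angle. The boundary values give pi (1 + s^2) - pi (1 - s^2) = 2 pi s^2.
  The sign of the second angle is where \<tau> \<le> 1 enters.\<close>

lemma mp_total_has_integral: "(mp_density \<tau> has_integral 1) UNIV"
proof -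
  define s where "s = sqrt \<tau>"
  have s: "0 < s" "s \<le> 1" and ts: "\<tau> = s\<^sup>2" using \<tau> by (auto simp: s_def)
  let ?\<alpha> = "(s - 1)\<^sup>2" and ?\<beta> = "(s + 1)\<^sup>2"
  let ?q = "\<lambda>x. (x - ?\<alpha>) * (?\<beta> - x)"
  define G1 where "G1 x = sqrt (?q x) + (1 + s\<^sup>2) * arcsin ((x - 1 - s\<^sup>2) / (2 * s))" for x
  define v where "v x = ((1 + s\<^sup>2) * x - (1 - s\<^sup>2)\<^sup>2) / (2 * s * x)" for x
  define G2 where "G2 x = (1 - s\<^sup>2) * arcsin (v x)" for x
  define F where "F x = (G1 x - G2 x) / (2 * pi * s\<^sup>2)" for x
  have cont1: "continuous_on {?\<alpha>..?\<beta>} G1"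
    unfolding G1_def by (intro continuous_on_add continuous_on_mult continuous_on_const
        semicircle_arcsin_continuous s continuous_on_real_sqrt continuous_on_diff continuous_on_id)
  have cont2: "continuous_on {?\<alpha>..?\<beta>} G2"
  \<comment> \<open>At s = 1 the prefactor 1 - s^2 removes the second angle, which is discontinuous
    there.\<close>
  proof (cases "s = 1")
    case False
    then show ?thesis unfolding G2_def v_def
      by (intro continuous_on_mult continuous_on_const mp_angle_arcsin_continuous s)
  qed (simp add: G2_def)
  have cont: "continuous_on {?\<alpha>..?\<beta>} F"
    unfolding F_def using s by (intro continuous_on_divide continuous_on_diff cont1 cont2 continuous_on_const) auto
  have d: "(F has_real_derivative mp_density \<tau> x * 1) (at x)" if x: "?\<alpha> < x" "x < ?\<beta>" for x
  proof -
    define q where "q = ?q x"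
    have q: "0 < q" using x by (simp add: q_def)
    have x0: "0 < x" using x(1) order_le_less_trans[OF zero_le_power2] by blast
    have "(G1 has_real_derivative (1 + s\<^sup>2 - x) / sqrt q + (1 + s\<^sup>2) * (1 / sqrt q)) (at x)"
      unfolding G1_def q_def
      by (intro DERIV_add DERIV_cmult semicircle_arcsin_deriv semicircle_sqrt_deriv s x)
    moreover have "(G2 has_real_derivative (1 - s\<^sup>2)\<^sup>2 / (x * sqrt q)) (at x)"
    proof (cases "s = 1")
      case True then show ?thesis by (simp add: G2_def[abs_def])
    next
      case False
      then have s1: "s\<^sup>2 < 1" using s by (simp add: abs_square_less_1)
      show ?thesis unfolding G2_def v_def q_def
        by (rule DERIV_cong[OF DERIV_cmult[OF mp_angle_arcsin_deriv[OF s(1) s1 x]]])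
           (simp add: power2_eq_square)
    qed
    ultimately have "(F has_real_derivative (((1 + s\<^sup>2 - x) / sqrt q + (1 + s\<^sup>2) * (1 / sqrt q))
        - (1 - s\<^sup>2)\<^sup>2 / (x * sqrt q)) / (2 * pi * s\<^sup>2)) (at x)"
      unfolding F_def by (intro DERIV_cdivide DERIV_diff)
    also have "((1 + s\<^sup>2 - x) / sqrt q + (1 + s\<^sup>2) * (1 / sqrt q))
        - (1 - s\<^sup>2)\<^sup>2 / (x * sqrt q) = q / (x * sqrt q)"
    proof -
      have qq: "q = 2 * (1 + s\<^sup>2) * x - x\<^sup>2 - (1 - s\<^sup>2)\<^sup>2"
        unfolding q_def by (rule mp_edges(3)[OF s(1)])
      define w where "w = sqrt q"
      have "w \<noteq> 0" using q by (simp add: w_def)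
      then show ?thesis unfolding w_def[symmetric] using x0 by (subst qq) (simp add: divide_simps, algebra)
    qed
    also have "q / (x * sqrt q) = sqrt q / x"
      using real_div_sqrt[of q] q by (metis divide_divide_eq_left mult.commute less_imp_le)
    also have "sqrt q / x / (2 * pi * s\<^sup>2) = mp_density \<tau> x * 1"
      unfolding ts mp_density_interior[OF s(1) x] q_def[symmetric] by (simp add: mult_ac)
    finally show ?thesis .
  qed
  have ends: "F ?\<beta> - F ?\<alpha> = 1"
  proof -
    have a: "(?\<beta> - 1 - s\<^sup>2) / (2 * s) = 1" "(?\<alpha> - 1 - s\<^sup>2) / (2 * s) = -1"
      using s by (auto simp: field_simps power2_eq_square)
    have b: "v ?\<beta> = 1"
    proof -
      have "(1 + s\<^sup>2) * ?\<beta> - (1 - s\<^sup>2)\<^sup>2 = 2 * s * ?\<beta>" by algebra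
      then show ?thesis using s unfolding v_def by simp
    qed
    have c: "v ?\<alpha> = -1" if "s \<noteq> 1"
    proof -
      have "(1 + s\<^sup>2) * ?\<alpha> - (1 - s\<^sup>2)\<^sup>2 = - (2 * s * ?\<alpha>)" by algebra
      then show ?thesis using s that unfolding v_def by simp
    qed
    have G1: "G1 ?\<beta> - G1 ?\<alpha> = (1 + s\<^sup>2) * pi" unfolding G1_def a by (simp add: arcsin_minus)
    have G2: "G2 ?\<beta> - G2 ?\<alpha> = (1 - s\<^sup>2) * pi"
      by (cases "s = 1") (use b c in \<open>auto simp: G2_def arcsin_minus algebra_simps\<close>)
    have "F ?\<beta> - F ?\<alpha> = ((G1 ?\<beta> - G1 ?\<alpha>) - (G2 ?\<beta> - G2 ?\<alpha>)) / (2 * pi * s\<^sup>2)"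
      by (simp add: F_def diff_divide_distrib)
    also have "\<dots> = 1" unfolding G1 G2 using s by (simp add: field_simps)
    finally show ?thesis .
  qed
  have "((\<lambda>x. mp_density \<tau> x * 1) has_integral F ?\<beta> - F ?\<alpha>) UNIV"
    using mp_has_integral_FTC[of \<tau> F "\<lambda>_. 1"] \<tau> cont d
    unfolding s_def[symmetric] by blast
  then show ?thesis unfolding ends by simp
qed

text \<open>The factor x cancels the 1/x of the density and leaves the area 2 pi s^2 of a half-disc
  of radius 2s.\<close>

lemma mp_mean_has_integral: "((\<lambda>x. mp_density \<tau> x * x) has_integral 1) UNIV"
proof -
  define s where "s = sqrt \<tau>"
  have s: "0 < s" "s \<le> 1" and ts: "\<tau> = s\<^sup>2" using \<tau> by (auto simp: s_def)
  let ?\<alpha> = "(s - 1)\<^sup>2" and ?\<beta> = "(s + 1)\<^sup>2"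
  let ?q = "\<lambda>x. (x - ?\<alpha>) * (?\<beta> - x)"
  define F where "F x = ((x - 1 - s\<^sup>2) * sqrt (?q x) / 2 + 2 * s\<^sup>2 * arcsin ((x - 1 - s\<^sup>2) / (2 * s))) / (2 * pi * s\<^sup>2)" for x
  have cont: "continuous_on {?\<alpha>..?\<beta>} F"
    unfolding F_def by (intro continuous_on_divide continuous_on_add continuous_on_mult continuous_on_const
        semicircle_arcsin_continuous s continuous_on_real_sqrt continuous_on_diff continuous_on_id) (use s in auto)
  have d: "(F has_real_derivative mp_density \<tau> x * x) (at x)" if x: "?\<alpha> < x" "x < ?\<beta>" for x
  proof -
    define q where "q = ?q x"
    have q: "0 < q" using x by (simp add: q_def)
    have x0: "0 < x" using x(1) order_le_less_trans[OF zero_le_power2] by blast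
    have "((\<lambda>x. x - 1 - s\<^sup>2) has_real_derivative 1) (at x)"
      by (auto intro!: derivative_eq_intros)
    then have "(F has_real_derivative ((1 * sqrt q + (1 + s\<^sup>2 - x) / sqrt q * (x - 1 - s\<^sup>2)) / 2
        + 2 * s\<^sup>2 * (1 / sqrt q)) / (2 * pi * s\<^sup>2)) (at x)"
      unfolding F_def q_def
      by (intro DERIV_cdivide DERIV_add DERIV_cmult DERIV_mult semicircle_arcsin_deriv semicircle_sqrt_deriv s x)
    also have "(1 * sqrt q + (1 + s\<^sup>2 - x) / sqrt q * (x - 1 - s\<^sup>2)) / 2 + 2 * s\<^sup>2 * (1 / sqrt q) = sqrt q"
    proof -
      have qq: "q = 4 * s\<^sup>2 - (x - 1 - s\<^sup>2)\<^sup>2"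
        unfolding q_def by (rule mp_edges(1)[OF s(1)])
      define w where "w = sqrt q"
      have w: "w \<noteq> 0" "w * w = q" using q by (auto simp: w_def)
      show ?thesis unfolding w_def[symmetric] using w qq by (simp add: divide_simps) algebra
    qed
    also have "sqrt q / (2 * pi * s\<^sup>2) = mp_density \<tau> x * x"
      using x0 unfolding ts mp_density_interior[OF s(1) x] q_def[symmetric] by (simp add: mult_ac)
    finally show ?thesis .
  qed
  have ends: "F ?\<beta> - F ?\<alpha> = 1"
  proof -
    have a: "(?\<beta> - 1 - s\<^sup>2) / (2 * s) = 1" "(?\<alpha> - 1 - s\<^sup>2) / (2 * s) = -1"
      using s by (auto simp: field_simps power2_eq_square)
    show ?thesis unfolding F_def a using s by (simp add: arcsin_minus)
  qed
  show ?thesis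
    using mp_has_integral_FTC[of \<tau> F "\<lambda>x. x"] \<tau> cont d ends
    unfolding s_def[symmetric] by simp
qed

text \<open>The integrand is the derivative of x^k q^(3/2) / (2 pi s^2). The exponent 3/2 makes this
  primitive vanish at both edges while its derivative stays a polynomial multiple of sqrt q.\<close>

lemma mp_recurrence_has_integral:
  "((\<lambda>x. mp_density \<tau> x * ((2 * real k + 3) * (1 + \<tau>) * x ^ (k + 1)
       - real k * (1 - \<tau>)\<^sup>2 * x ^ k - (real k + 3) * x ^ (k + 2))) has_integral 0) UNIV"
proof -
  define s where "s = sqrt \<tau>"
  have s: "0 < s" "s \<le> 1" and ts: "\<tau> = s\<^sup>2" using \<tau> by (auto simp: s_def)
  let ?\<alpha> = "(s - 1)\<^sup>2" and ?\<beta> = "(s + 1)\<^sup>2"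
  let ?q = "\<lambda>x. (x - ?\<alpha>) * (?\<beta> - x)"
  define F where "F x = x ^ k * (?q x * sqrt (?q x)) / (2 * pi * s\<^sup>2)" for x
  let ?g = "\<lambda>x. (2 * real k + 3) * (1 + \<tau>) * x ^ (k + 1)
       - real k * (1 - \<tau>)\<^sup>2 * x ^ k - (real k + 3) * x ^ (k + 2)"
  have cont: "continuous_on {?\<alpha>..?\<beta>} F"
    unfolding F_def using s by (intro continuous_intros) auto
  have d: "(F has_real_derivative mp_density \<tau> x * ?g x) (at x)" if x: "?\<alpha> < x" "x < ?\<beta>" for x
  proof -
    have q: "0 < ?q x" using x by simp
    have x0: "0 < x" using x(1) order_le_less_trans[OF zero_le_power2] by blast
    note sq = semicircle_sqrt_deriv[OF x]
    have qd: "(?q has_real_derivative 2 * (1 + s\<^sup>2 - x)) (at x)"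
      by (auto intro!: derivative_eq_intros simp: field_simps power2_eq_square)
    have "(F has_real_derivative (real k * x ^ (k - 1) * (?q x * sqrt (?q x)) +
        (2 * (1 + s\<^sup>2 - x) * sqrt (?q x) + (1 + s\<^sup>2 - x) / sqrt (?q x) * ?q x) * x ^ k) / (2 * pi * s\<^sup>2)) (at x)"
      unfolding F_def
      by (intro DERIV_cdivide DERIV_mult sq qd) (auto intro!: derivative_eq_intros)
    also have "(1 + s\<^sup>2 - x) / sqrt (?q x) * ?q x = (1 + s\<^sup>2 - x) * sqrt (?q x)"
      using q by (simp add: field_simps)
    also have "real k * x ^ (k - 1) * (?q x * sqrt (?q x)) +
        (2 * (1 + s\<^sup>2 - x) * sqrt (?q x) + (1 + s\<^sup>2 - x) * sqrt (?q x)) * x ^ k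
        = sqrt (?q x) * (real k * x ^ (k - 1) * ?q x + 3 * (1 + s\<^sup>2 - x) * x ^ k)"
      by (simp add: algebra_simps)
    also have "real k * x ^ (k - 1) * ?q x + 3 * (1 + s\<^sup>2 - x) * x ^ k = ?g x / x"
      unfolding mp_edges(3)[OF s(1)] ts using x0
      by (cases k) (auto simp: field_simps power2_eq_square)
    finally show ?thesis
      using x x0 by (simp add: mp_density_def ts s_def[symmetric] mult_ac)
         (use s in \<open>simp add: mult_ac\<close>)
  qed
  have ends: "F ?\<beta> - F ?\<alpha> = 0" by (simp add: F_def)
  show ?thesis
    using mp_has_integral_FTC[of \<tau> F ?g] \<tau> cont d ends
    unfolding s_def[symmetric] by simp
qed

end

text \<open>These are the Narayana polynomials in \<tau> (Catalan numbers at \<tau> = 1), presented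
  by the recursion that the limiting loop equation produces.\<close>

fun mp_moment :: "real \<Rightarrow> nat \<Rightarrow> real" where
  "mp_moment \<tau> 0 = 1"
| "mp_moment \<tau> (Suc k) = (1 - \<tau>) * mp_moment \<tau> k + \<tau> * (\<Sum>s\<le>k. mp_moment \<tau> s * mp_moment \<tau> (k - s))"

text \<open>The generating function \<open>M\<close> solves a quadratic equation, so \<open>A = 2\<tau>XM + (1-\<tau>)X - 1\<close>
  is a square root of a polynomial \<open>P\<close>; comparing coefficients in \<open>2PA' = P'A\<close> gives the linear recurrence.\<close>
lemma mp_moment_linear_recurrence:
  assumes "\<tau> \<noteq> 0"
  shows "(real k + 3) * mp_moment \<tau> (k + 2) =
    (2 * real k + 3) * (1 + \<tau>) * mp_moment \<tau> (k + 1) - real k * (1 - \<tau>)\<^sup>2 * mp_moment \<tau> k"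
proof -
  define M where "M = Abs_fps (mp_moment \<tau>)"
  let ?c = "fps_const :: real \<Rightarrow> real fps"
  have "M = 1 + ?c (1 - \<tau>) * (fps_X * M) + ?c \<tau> * (fps_X * (M * M))"
  proof (rule fps_ext)
    have MM: "fps_nth (M * M) n = (\<Sum>s\<le>n. mp_moment \<tau> s * mp_moment \<tau> (n - s))" for n
      by (simp add: M_def fps_mult_nth atLeast0AtMost)
    fix n show "fps_nth M n = fps_nth (1 + ?c (1 - \<tau>) * (fps_X * M) + ?c \<tau> * (fps_X * (M * M))) n"
      by (cases n) (auto simp: MM, auto simp: M_def)
  qed
  then have quad: "M = 1 + (1 - ?c \<tau>) * (fps_X * M) + ?c \<tau> * (fps_X * (M * M))"
    by (simp add: fps_const_sub[symmetric] del: fps_const_sub)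
  define A where "A = 2 * ?c \<tau> * fps_X * M + (1 - ?c \<tau>) * fps_X - 1"
  define P where "P = 1 - 2 * (1 + ?c \<tau>) * fps_X + (1 - ?c \<tau>)\<^sup>2 * fps_X\<^sup>2"
  have sq: "A\<^sup>2 = P"
    unfolding A_def P_def using quad by algebra
  have "fps_deriv (A\<^sup>2) = 2 * A * fps_deriv A"
    by (simp add: power2_eq_square algebra_simps)
  then have ode: "2 * P * fps_deriv A = fps_deriv P * A"
    unfolding sq[symmetric] by (simp add: power2_eq_square algebra_simps)
  have nth_A: "fps_nth A (Suc (Suc j)) = 2 * \<tau> * mp_moment \<tau> (Suc j)" for j
  proof -
    have "A = ?c (2 * \<tau>) * (fps_X * M) + ?c (1 - \<tau>) * fps_X - 1"
      by (simp add: A_def fps_numeral_fps_const algebra_simps)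
    then show ?thesis by (simp del: mp_moment.simps) (simp add: M_def)
  qed
  have "2 * P * fps_deriv A = 2 * fps_deriv A - 4 * (1 + ?c \<tau>) * (fps_X * fps_deriv A)
      + 2 * (1 - ?c \<tau>)\<^sup>2 * (fps_X * (fps_X * fps_deriv A))"
    by (simp add: P_def power2_eq_square algebra_simps)
  moreover have "fps_deriv P * A = - 2 * (1 + ?c \<tau>) * A + 2 * (1 - ?c \<tau>)\<^sup>2 * (fps_X * A)"
    by (simp add: P_def power2_eq_square algebra_simps)
  ultimately have ode': "?c 2 * fps_deriv A - ?c (4 * (1 + \<tau>)) * (fps_X * fps_deriv A)
      + ?c (2 * (1 - \<tau>)\<^sup>2) * (fps_X * (fps_X * fps_deriv A))
      = ?c (- 2 * (1 + \<tau>)) * A + ?c (2 * (1 - \<tau>)\<^sup>2) * (fps_X * A)"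
    using ode by (simp add: fps_numeral_fps_const power2_eq_square algebra_simps)
  have X: "fps_nth (fps_X * F) (Suc j) = fps_nth F j" for F :: "real fps" and j by simp
  have D: "fps_nth (fps_deriv A) j = real (Suc j) * fps_nth A (Suc j)" for j by simp
  \<comment> \<open>At index k + 2 the derivative contributes the coefficient k + 3 of
    \<open>A\<close>, which carries the moment k + 2.\<close>
  from arg_cong[OF ode', of "\<lambda>F. fps_nth F (Suc (Suc k))"]
  have eq: "2 * (real k + 3) * fps_nth A (Suc (Suc (Suc k))) - 4 * (1 + \<tau>) * (real k + 2) * fps_nth A (Suc (Suc k))
      + 2 * (1 - \<tau>)\<^sup>2 * (real k + 1) * fps_nth A (Suc k)
      = - 2 * (1 + \<tau>) * fps_nth A (Suc (Suc k)) + 2 * (1 - \<tau>)\<^sup>2 * fps_nth A (Suc k)"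
    by (simp only: fps_add_nth fps_sub_nth fps_mult_left_const_nth X D) (simp add: algebra_simps)
  \<comment> \<open>\<open>nth_A\<close> speaks only of indices from 2 on; the coefficient of
    \<open>A\<close> at index 1 is 1 + \<tau>, not a multiple of a moment. It meets the factor k =
    0, so the identity extends to that case.\<close>
  have k0: "real k * fps_nth A (Suc k) = real k * (2 * \<tau> * mp_moment \<tau> k)"
    by (cases k) (simp_all add: nth_A)
  have "4 * \<tau> * ((real k + 3) * mp_moment \<tau> (k + 2)) =
    4 * \<tau> * ((2 * real k + 3) * (1 + \<tau>) * mp_moment \<tau> (k + 1) - real k * (1 - \<tau>)\<^sup>2 * mp_moment \<tau> k)"
    using eq k0 unfolding nth_A add_2_eq_Suc' Suc_eq_plus1[symmetric] by algebra
  then show ?thesis using assms by (simp only: mult_cancel_left) simp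
qed

text \<open>One interval serves all \<tau> in (0, 1], as (1 + 1)^2 = 4. It is the source of the
  growth rate 4^k of the moments.\<close>

lemma mp_density_support: "x \<notin> {0..4} \<Longrightarrow> \<tau> \<in> {0<..1} \<Longrightarrow> mp_density \<tau> x = 0"
proof -
  assume "x \<notin> {0..4}" "\<tau> \<in> {0<..1}"
  then have "(sqrt \<tau> + 1)\<^sup>2 \<le> (1 + 1)\<^sup>2" by (intro power_mono) auto
  then show ?thesis using \<open>x \<notin> {0..4}\<close> order_le_less_trans[OF zero_le_power2[of "sqrt \<tau> - 1"], of x]
    by (auto simp: mp_density_def)
qed

context
  fixes \<tau> :: real
  assumes \<tau>: "0 < \<tau>" "\<tau> \<le> 1"
begin

lemma real_distribution_marchenko_pastur: "real_distribution (marchenko_pastur \<tau>)"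
proof -
  have "(\<integral>\<^sup>+ x. ennreal (mp_density \<tau> x) \<partial>lborel) = ennreal 1"
    by (rule nn_integral_has_integral_lborel)
       (use mp_total_has_integral[OF \<tau>] mp_density_nonneg[OF \<tau>(1)] in auto)
  then have "prob_space (marchenko_pastur \<tau>)"
    by (intro prob_spaceI) (simp add: marchenko_pastur_def emeasure_density)
  then show ?thesis
    by (simp add: real_distribution_def real_distribution_axioms_def marchenko_pastur_def)
qed

lemma AE_marchenko_pastur: "AE x in marchenko_pastur \<tau>. x \<in> {0..4}"
  unfolding marchenko_pastur_def
proof (subst AE_density)
  have "x \<in> {0..4}" if "0 < ennreal (mp_density \<tau> x)" for x
    using mp_density_support[of x \<tau>] \<tau> that by (cases "x \<in> {0..4}") auto
  then show "AE x in lborel. 0 < ennreal (mp_density \<tau> x) \<longrightarrow> x \<in> {0..4}" by auto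
qed simp

lemma marchenko_pastur_power_integrable: "integrable (marchenko_pastur \<tau>) (\<lambda>x. x ^ k)"
proof -
  interpret real_distribution "marchenko_pastur \<tau>" by (rule real_distribution_marchenko_pastur)
  show ?thesis
  proof (rule integrable_const_bound[where B = "4 ^ k"])
    show "AE x in marchenko_pastur \<tau>. norm (x ^ k) \<le> 4 ^ k"
      using AE_marchenko_pastur by eventually_elim (auto simp: norm_power intro!: power_mono)
  qed simp
qed

text \<open>Both sequences start with 1, 1 and obey the same linear recurrence, whose leading factor
  k + 3 never vanishes; hence an induction over two consecutive indices.\<close>

lemma marchenko_pastur_moment: "(\<integral>x. x ^ k \<partial>marchenko_pastur \<tau>) = mp_moment \<tau> k"
proof -
  define \<mu> where "\<mu> k = (\<integral>x. x ^ k \<partial>marchenko_pastur \<tau>)" for k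
  have int: "integrable lborel (\<lambda>x. mp_density \<tau> x * x ^ k)" for k
    using marchenko_pastur_power_integrable[of k] mp_density_nonneg[OF \<tau>(1)]
    unfolding marchenko_pastur_def by (subst (asm) integrable_density) auto
  have \<mu>: "\<mu> k = (\<integral>x. mp_density \<tau> x * x ^ k \<partial>lborel)" for k
    unfolding \<mu>_def marchenko_pastur_def
    by (subst integral_density) (use mp_density_nonneg[OF \<tau>(1)] in auto)
  have hi: "((\<lambda>x. mp_density \<tau> x * x ^ k) has_integral \<mu> k) UNIV" for k
    using has_integral_integral_lborel[OF int[of k]] unfolding \<mu> .
  have \<mu>0: "\<mu> 0 = 1" using has_integral_unique[OF hi[of 0]] mp_total_has_integral[OF \<tau>] by simp
  have \<mu>1: "\<mu> 1 = 1" using has_integral_unique[OF hi[of 1]] mp_mean_has_integral[OF \<tau>] by simp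
  have rec: "(real k + 3) * \<mu> (k + 2) = (2 * real k + 3) * (1 + \<tau>) * \<mu> (k + 1) - real k * (1 - \<tau>)\<^sup>2 * \<mu> k" for k
  proof -
    have "((\<lambda>x. (2 * real k + 3) * (1 + \<tau>) * (mp_density \<tau> x * x ^ (k + 1))
       - real k * (1 - \<tau>)\<^sup>2 * (mp_density \<tau> x * x ^ k) - (real k + 3) * (mp_density \<tau> x * x ^ (k + 2))) has_integral
       (2 * real k + 3) * (1 + \<tau>) * \<mu> (k + 1) - real k * (1 - \<tau>)\<^sup>2 * \<mu> k - (real k + 3) * \<mu> (k + 2)) UNIV"
      by (intro has_integral_diff has_integral_mult_right hi)
    also have "(\<lambda>x. (2 * real k + 3) * (1 + \<tau>) * (mp_density \<tau> x * x ^ (k + 1))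
       - real k * (1 - \<tau>)\<^sup>2 * (mp_density \<tau> x * x ^ k) - (real k + 3) * (mp_density \<tau> x * x ^ (k + 2))) =
       (\<lambda>x. mp_density \<tau> x * ((2 * real k + 3) * (1 + \<tau>) * x ^ (k + 1)
       - real k * (1 - \<tau>)\<^sup>2 * x ^ k - (real k + 3) * x ^ (k + 2)))"
      by (simp add: algebra_simps)
    finally show ?thesis
      using has_integral_unique[OF _ mp_recurrence_has_integral[OF \<tau>, of k]] by force
  qed
  have "\<mu> k = mp_moment \<tau> k \<and> \<mu> (Suc k) = mp_moment \<tau> (Suc k)" for k
  proof (induction k)
    case 0 then show ?case using \<mu>0 \<mu>1 by simp
  next
    case (Suc k)
    have "(real k + 3) * \<mu> (k + 2) = (real k + 3) * mp_moment \<tau> (k + 2)"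
      unfolding rec mp_moment_linear_recurrence[OF less_imp_neq[OF \<tau>(1), symmetric]] using Suc by simp
    then have "\<mu> (k + 2) = mp_moment \<tau> (k + 2)" by simp
    then show ?case using Suc by simp
  qed
  then show ?thesis by (simp add: \<mu>_def)
qed

lemma mp_moment_le: "mp_moment \<tau> k \<le> 4 ^ k"
proof -
  interpret real_distribution "marchenko_pastur \<tau>" by (rule real_distribution_marchenko_pastur)
  have "(\<integral>x. x ^ k \<partial>marchenko_pastur \<tau>) \<le> (\<integral>x. 4 ^ k \<partial>marchenko_pastur \<tau>)"
  proof (intro integral_mono_AE marchenko_pastur_power_integrable)
    show "AE x in marchenko_pastur \<tau>. x ^ k \<le> 4 ^ k"
      using AE_marchenko_pastur by eventually_elim (auto intro!: power_mono)
  qed simp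
  then show ?thesis
    by (simp add: marchenko_pastur_moment prob_space[simplified])
qed

end

section \<open>Method of moments\<close>

text \<open>Characteristic functions are compared through their Taylor polynomials. The growth B^k
  of the limiting moments is beaten by the factorial, so at fixed t the remainder is made small by
  the choice of the degree before n tends to infinity.\<close>

lemma method_of_moments:
  fixes M :: "nat \<Rightarrow> real measure" and M' :: "real measure"
  assumes distr: "\<And>n. real_distribution (M n)" "real_distribution M'"
    and int: "\<And>n k. integrable (M n) (\<lambda>x. x ^ k)" "\<And>k. integrable M' (\<lambda>x. x ^ k)"
    and conv: "\<And>k. (\<lambda>n. \<integral>x. x ^ k \<partial>M n) \<longlonglongrightarrow> (\<integral>x. x ^ k \<partial>M')"
    and growth: "\<And>k. (\<integral>x. x ^ k \<partial>M') \<le> B ^ k"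
  shows "weak_conv_m M M'"
proof (rule levy_continuity[OF distr])
  fix t :: real
  define m where "m n k = (\<integral>x. x ^ k \<partial>M n)" for n k
  define m' where "m' k = (\<integral>x. x ^ k \<partial>M')" for k
  let ?R = "\<lambda>n N. (\<Sum>k\<le>2*N. \<bar>t\<bar> ^ k / fact k * \<bar>m n k - m' k\<bar>) + 2 * \<bar>t\<bar> ^ (2*N) / fact (2*N) * (m n (2*N) + m' (2*N))"
  have approx: "cmod (char (M n) t - char M' t) \<le>
      ?R n N" for n N
  proof -
    interpret Mn: real_distribution "M n" by fact
    interpret M': real_distribution M' by fact
    let ?S = "\<lambda>m. \<Sum>k\<le>2*N. (\<i> * t) ^ k / fact k * complex_of_real (m k)"
    \<comment> \<open>The even order 2N makes the absolute moment in the remainder an ordinary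
      moment.\<close>
    have 1: "cmod (char (M n) t - ?S (m n)) \<le> 2 * \<bar>t\<bar> ^ (2*N) / fact (2*N) * m n (2*N)"
      using Mn.char_approx1[of "2*N" t, OF int(1)] by (simp add: m_def power_even_abs)
    have 2: "cmod (char M' t - ?S m') \<le> 2 * \<bar>t\<bar> ^ (2*N) / fact (2*N) * m' (2*N)"
      using M'.char_approx1[of "2*N" t, OF int(2)] by (simp add: m'_def power_even_abs)
    have "?S (m n) - ?S m' = (\<Sum>k\<le>2*N. (\<i> * t) ^ k / fact k * complex_of_real (m n k - m' k))"
      by (simp add: sum_subtractf[symmetric] right_diff_distrib)
    also have "cmod \<dots> \<le> (\<Sum>k\<le>2*N. \<bar>t\<bar> ^ k / fact k * \<bar>m n k - m' k\<bar>)"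
      by (rule order_trans[OF norm_sum])
         (simp add: norm_mult norm_divide norm_power del: of_real_diff)
    finally have 3: "cmod (?S (m n) - ?S m') \<le> \<dots>" .
    have "cmod (char (M n) t - char M' t) \<le> cmod (char (M n) t - ?S (m n)) + cmod (?S (m n) - ?S m') + cmod (char M' t - ?S m')"
      using norm_triangle_ineq[of "char (M n) t - ?S (m n)" "(?S (m n) - ?S m') - (char M' t - ?S m')"]
        norm_triangle_ineq4[of "?S (m n) - ?S m'" "char M' t - ?S m'"] by simp
    also have "\<dots> \<le> 2 * \<bar>t\<bar> ^ (2*N) / fact (2*N) * m n (2*N) + (\<Sum>k\<le>2*N. \<bar>t\<bar> ^ k / fact k * \<bar>m n k - m' k\<bar>)
        + 2 * \<bar>t\<bar> ^ (2*N) / fact (2*N) * m' (2*N)"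
      using 1 2 3 by linarith
    finally show ?thesis by (simp only: distrib_left add_ac)
  qed
  show "(\<lambda>n. char (M n) t) \<longlonglongrightarrow> char M' t"
    unfolding LIM_zero_iff[symmetric, of "\<lambda>n. char (M n) t"]
  proof (rule tendstoI)
    fix e :: real assume e: "0 < e"
    \<comment> \<open>The degree depends on t, B and e only. The constant 4 collects the two
      remainders, each with constant 2, whose moments agree in the limit.\<close>
    have "(\<lambda>n. (\<bar>t\<bar> * B) ^ n / fact n) \<longlonglongrightarrow> 0"
      using summable_LIMSEQ_zero[OF summable_exp[of "\<bar>t\<bar> * B"]] by (simp add: field_simps)
    then have "(\<lambda>N. 4 * ((\<bar>t\<bar> * B) ^ (2*N) / fact (2*N))) \<longlonglongrightarrow> 4 * 0"
      by (intro tendsto_mult_left) (rule LIMSEQ_subseq_LIMSEQ[where f = "\<lambda>N. 2*N", unfolded o_def], auto simp: strict_mono_def)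
    then have "eventually (\<lambda>N. 4 * ((\<bar>t\<bar> * B) ^ (2*N) / fact (2*N)) < e) sequentially"
      using e by (intro order_tendstoD) auto
    then obtain N where N: "4 * ((\<bar>t\<bar> * B) ^ (2*N) / fact (2*N)) < e"
      by (auto simp: eventually_sequentially)
    have "(\<lambda>n. ?R n N)
      \<longlonglongrightarrow> (\<Sum>k\<le>2*N. \<bar>t\<bar> ^ k / fact k * \<bar>m' k - m' k\<bar>) + 2 * \<bar>t\<bar> ^ (2*N) / fact (2*N) * (m' (2*N) + m' (2*N))"
      using conv unfolding m_def m'_def by (intro tendsto_intros)
    also have "(\<Sum>k\<le>2*N. \<bar>t\<bar> ^ k / fact k * \<bar>m' k - m' k\<bar>) + 2 * \<bar>t\<bar> ^ (2*N) / fact (2*N) * (m' (2*N) + m' (2*N))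
      = 4 * \<bar>t\<bar> ^ (2*N) / fact (2*N) * m' (2*N)" by simp
    finally have lim: "(\<lambda>n. ?R n N)
      \<longlonglongrightarrow> 4 * \<bar>t\<bar> ^ (2*N) / fact (2*N) * m' (2*N)" .
    have "4 * \<bar>t\<bar> ^ (2*N) / fact (2*N) * m' (2*N) \<le> 4 * \<bar>t\<bar> ^ (2*N) / fact (2*N) * B ^ (2*N)"
      using growth[of "2*N"] unfolding m'_def by (intro mult_left_mono) auto
    also have "\<dots> < e" using N by (simp add: power_mult_distrib)
    finally have "eventually (\<lambda>n. ?R n N < e) sequentially"
      by (intro order_tendstoD(2)[OF lim])
    then show "eventually (\<lambda>n. dist (char (M n) t - char M' t) 0 < e) sequentially"
      unfolding dist_norm diff_zero
      by eventually_elim (rule order_le_less_trans[OF approx])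
  qed
qed

lemma weak_conv_m_eventually_cong:
  assumes "eventually (\<lambda>n. M n = N n) sequentially"
  shows "weak_conv_m M L \<longleftrightarrow> weak_conv_m N L"
proof -
  have "((\<lambda>n. cdf (M n) x) \<longlonglongrightarrow> l) \<longleftrightarrow> ((\<lambda>n. cdf (N n) x) \<longlonglongrightarrow> l)" for x l
    by (intro tendsto_cong eventually_mono[OF assms]) simp
  then show ?thesis by (simp add: weak_conv_m_def weak_conv_def)
qed

section \<open>Weighted point measures and their moments\<close>

lemma spectral_meas_real_distribution:
  assumes "\<And>i. i < n \<Longrightarrow> 0 \<le> w i" "(\<Sum>i<n. w i) = 1"
  shows "real_distribution (spectral_meas n c x w)"
proof -
  have "(\<Sum>i<n. ennreal (w i)) = 1"
    using assms by (subst sum_ennreal) auto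
  then have "emeasure (density (count_space {..<n}) (\<lambda>i. ennreal (w i))) {..<n} = 1"
    by (subst emeasure_density) (auto simp: nn_integral_count_space_finite)
  then have "prob_space (density (count_space {..<n}) (\<lambda>i. ennreal (w i)))"
    by (intro prob_spaceI) simp
  then show ?thesis
    by (simp add: real_distribution_def real_distribution_axioms_def spectral_meas_def prob_space.prob_space_distr)
qed

lemma spectral_meas_moment:
  assumes "\<And>i. i < n \<Longrightarrow> 0 \<le> w i"
  shows "integrable (spectral_meas n c x w) (\<lambda>y. y ^ k)"
    and "(\<integral>y. y ^ k \<partial>spectral_meas n c x w) = (\<Sum>i<n. w i * (c * x i) ^ k)"
proof -
  have ae: "AE i in count_space {..<n}. 0 \<le> w i" using assms by (simp add: AE_count_space)
  show "integrable (spectral_meas n c x w) (\<lambda>y. y ^ k)"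
    unfolding spectral_meas_def
    by (simp add: integrable_distr_eq integrable_density ae integrable_count_space)
  have "(\<integral>y. y ^ k \<partial>spectral_meas n c x w) = (\<integral>i. w i * (c * x i) ^ k \<partial>count_space {..<n})"
    unfolding spectral_meas_def by (simp add: integral_distr integral_density ae)
  also have "\<dots> = (\<Sum>i<n. w i * (c * x i) ^ k)" by (simp add: lebesgue_integral_count_space_finite)
  finally show "(\<integral>y. y ^ k \<partial>spectral_meas n c x w) = (\<Sum>i<n. w i * (c * x i) ^ k)" .
qed

lemma spectral_meas_weak_conv:
  fixes x w :: "nat \<Rightarrow> nat \<Rightarrow> real"
  assumes w: "\<And>n. n \<ge> 1 \<Longrightarrow> (\<forall>i<n. 0 \<le> w n i) \<and> (\<Sum>i<n. w n i) = 1"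
    and M': "real_distribution M'" "\<And>k. integrable M' (\<lambda>x. x ^ k)" "\<And>k. (\<integral>x. x ^ k \<partial>M') \<le> B ^ k"
    and conv: "\<And>k. (\<lambda>n. \<Sum>i<n. w n i * (c n * x n i) ^ k) \<longlonglongrightarrow> (\<integral>x. x ^ k \<partial>M')"
  shows "weak_conv_m (\<lambda>n. spectral_meas n (c n) (x n) (w n)) M'"
proof -
  \<comment> \<open>For n = 0 there are no weights and the spectral measure is null rather than a
    probability measure; the limit law is put in its place, which does not affect
    convergence.\<close>
  define N where "N n = (if n \<ge> 1 then spectral_meas n (c n) (x n) (w n) else M')" for n
  have ev: "eventually (\<lambda>n. spectral_meas n (c n) (x n) (w n) = N n) sequentially"
    using eventually_ge_at_top[of 1] by eventually_elim (simp add: N_def)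
  have "weak_conv_m N M'"
  proof (rule method_of_moments)
    show "real_distribution (N n)" for n
      using w[of n] M' by (simp add: N_def spectral_meas_real_distribution)
    show "integrable (N n) (\<lambda>x. x ^ k)" for n k
      using w[of n] M' by (simp add: N_def spectral_meas_moment)
    show "(\<lambda>n. \<integral>x. x ^ k \<partial>N n) \<longlonglongrightarrow> (\<integral>x. x ^ k \<partial>M')" for k
    proof (rule Lim_transform_eventually[OF conv])
      show "\<forall>\<^sub>F n in sequentially. (\<Sum>i<n. w n i * (c n * x n i) ^ k) = (\<integral>x. x ^ k \<partial>N n)"
        using eventually_ge_at_top[of 1]
        by eventually_elim (use w in \<open>simp add: N_def spectral_meas_moment(2)\<close>)
    qed
  qed (use M' in auto)
  then show ?thesis by (simp add: weak_conv_m_eventually_cong[OF ev])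
qed

section \<open>Symmetric Dirichlet weights\<close>

text \<open>The integrand is the derivative of u^k (s - u)^k F(u) with the beta kernel factored out;
  k > 0 makes the boundary terms vanish. For k < 1 the kernel is singular at the ends, so the
  interior form of the fundamental theorem is used.\<close>

lemma beta_integration_by_parts:
  fixes F F' :: "real \<Rightarrow> real"
  assumes k: "0 < k" and F: "\<And>u. (F has_real_derivative F' u) (at u)"
  shows "(LINT u|lborel. (if 0 < u \<and> u < s then u powr (k - 1) * (s - u) powr (k - 1) *
            (k * (s - 2 * u) * F u + u * (s - u) * F' u) else 0)) = 0" (is "integral\<^sup>L lborel ?g = 0")
proof (cases "0 < s \<and> integrable lborel ?g")
  case True
  define H where "H u = u powr k * (s - u) powr k * F u" for u
  have Fc: "continuous_on A F" for A
    using F by (intro continuous_at_imp_continuous_on ballI DERIV_isCont) auto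
  have "(?g has_integral H s - H 0) {0..s}"
  proof (rule fundamental_theorem_of_calculus_interior)
    show "continuous_on {0..s} H"
      unfolding H_def using k by (intro continuous_intros continuous_on_powr' Fc) auto
    fix u assume u: "u \<in> {0<..<s}"
    have pw: "x powr k = x * x powr (k - 1)" if "0 < x" for x :: real
      using that by (simp add: powr_diff)
    have d1: "((\<lambda>u. u powr k) has_real_derivative k * u powr (k - 1)) (at u)"
      using u by (intro has_real_derivative_powr) auto
    have d2: "((\<lambda>u. (s - u) powr k) has_real_derivative k * (s - u) powr (k - 1) * (0 - 1)) (at u)"
      using u by (intro DERIV_chain2[OF has_real_derivative_powr] DERIV_diff DERIV_const DERIV_ident) auto
    have "(H has_real_derivative (k * u powr (k - 1) * (s - u) powr k + k * (s - u) powr (k - 1) * (0 - 1) * u powr k) * F u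
        + F' u * (u powr k * (s - u) powr k)) (at u)"
      unfolding H_def by (intro DERIV_mult d1 d2 F)
    also have "(k * u powr (k - 1) * (s - u) powr k + k * (s - u) powr (k - 1) * (0 - 1) * u powr k) * F u
        + F' u * (u powr k * (s - u) powr k) = ?g u"
      using u by (simp add: pw) (simp add: algebra_simps)
    finally show "(H has_vector_derivative ?g u) (at u)"
      by (simp add: has_real_derivative_iff_has_vector_derivative)
  qed (use True in auto)
  then have "(?g has_integral 0) {0..s}" using k by (simp add: H_def)
  then have "(?g has_integral 0) UNIV"
    by (rule has_integral_on_superset) auto
  then show ?thesis
    using has_integral_integral_lborel[of ?g] True has_integral_unique by blast
next
  \<comment> \<open>Two default cases: for s \<le> 0 the interval is empty, and a non-integrable
    function has Bochner integral 0.\<close>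
  case False
  then consider "s \<le> 0" | "\<not> integrable lborel ?g" by linarith
  then show ?thesis
  proof cases
    case 1
    then have "?g = (\<lambda>_. 0)" by (auto simp: fun_eq_iff)
    then show ?thesis by simp
  qed (rule not_integrable_integral_eq)
qed

definition simplex_point :: "nat \<Rightarrow> (nat \<Rightarrow> real) \<Rightarrow> nat \<Rightarrow> real" where
  "simplex_point n y = (\<lambda>i\<in>{..<n}. if i < n - 1 then y i else 1 - (\<Sum>j<n-1. y j))"

lemma dirichlet_sym_alt:
  "dirichlet_sym n k = distr (density (coords (n-1)) (\<lambda>y. ennreal (dirichlet_sym_density n k y)))
       (coords n) (simplex_point n)"
  by (simp add: dirichlet_sym_def simplex_point_def[abs_def])

lemma PiM_component_measurable:
  "i \<in> I \<Longrightarrow> (\<lambda>y. y i) \<in> borel_measurable (PiM I (\<lambda>_. lborel :: real measure))"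
  using measurable_component_singleton[of i I "\<lambda>_. lborel :: real measure"] by simp

lemma simplex_point_measurable [measurable]:
  "simplex_point n \<in> coords (n-1) \<rightarrow>\<^sub>M coords n"
  unfolding simplex_point_def
proof (rule measurable_restrict)
  fix i assume "i \<in> {..<n}"
  have c: "(\<lambda>y. y j) \<in> borel_measurable (coords (n-1))" if "j < n - 1" for j
    using that by (intro PiM_component_measurable) simp
  show "(\<lambda>y. if i < n - 1 then y i else 1 - (\<Sum>j<n-1. y j)) \<in> coords (n-1) \<rightarrow>\<^sub>M lborel"
    using c by (cases "i < n - 1") (auto intro!: borel_measurable_diff borel_measurable_sum)
qed

lemma simplex_point_measurable_density:
  "simplex_point n \<in> density (coords (n-1)) f \<rightarrow>\<^sub>M coords n"
  using simplex_point_measurable by (simp only: measurable_density_eq1)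

lemma dirichlet_sym_density_measurable [measurable]:
  "dirichlet_sym_density n k \<in> borel_measurable (coords (n-1))"
proof -
  note [measurable] = PiM_component_measurable
  have "dirichlet_sym_density n k = (\<lambda>y. if (\<forall>i\<in>{..<n-1}. 0 < y i) \<and> (\<Sum>i<n-1. y i) < 1 then
        Gamma (real n * k) / Gamma k ^ n *
        (\<Prod>i<n-1. y i powr (k - 1)) * (1 - (\<Sum>i<n-1. y i)) powr (k - 1) else 0)"
    by (auto simp: fun_eq_iff dirichlet_sym_density_def)
  also have "\<dots> \<in> borel_measurable (coords (n-1))"
    by measurable
  finally show ?thesis .
qed

lemma dirichlet_sym_density_nonneg: "0 < k \<Longrightarrow> 0 \<le> dirichlet_sym_density n k y"
  by (cases "n = 0") (auto simp: dirichlet_sym_density_def intro!: mult_nonneg_nonneg prod_nonneg divide_nonneg_nonneg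
      Gamma_real_nonneg zero_le_power)

lemma sets_dirichlet_sym [simp, measurable_cong]: "sets (dirichlet_sym n k) = sets (coords n)"
  by (simp add: dirichlet_sym_def)

lemma space_dirichlet_sym: "space (dirichlet_sym n k) = space (coords n)"
  by (simp add: dirichlet_sym_def)

lemma simplex_point_sum: "1 \<le> n \<Longrightarrow> (\<Sum>i<n. c i * simplex_point n y i) =
    (\<Sum>i<n-1. c i * y i) + c (n - 1) * (1 - (\<Sum>j<n-1. y j))"
  by (cases n) (simp_all add: simplex_point_def)

context
  fixes n :: nat and k :: real
  assumes n: "1 \<le> n" and k: "0 < k"
begin

lemma AE_dirichlet_simplex: "AE w in dirichlet_sym n k. (\<forall>i<n. 0 \<le> w i) \<and> (\<Sum>i<n. w i) = 1"
proof -
  note [measurable] = PiM_component_measurable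
  have "(\<forall>i<n. 0 \<le> simplex_point n y i) \<and> (\<Sum>i<n. simplex_point n y i) = 1"
    if "0 < dirichlet_sym_density n k y" for y
    using that simplex_point_sum[OF n, of "\<lambda>_. 1" y]
    by (auto simp: dirichlet_sym_density_def simplex_point_def less_imp_le split: if_splits)
  then have "AE y in coords (n-1). 0 < ennreal (dirichlet_sym_density n k y) \<longrightarrow>
      (\<forall>i\<in>{..<n}. 0 \<le> simplex_point n y i) \<and> (\<Sum>i<n. simplex_point n y i) = 1"
    by (intro AE_I2) (simp only: ennreal_less_zero_iff, simp)
  then have *: "AE y in density (coords (n-1)) (\<lambda>y. ennreal (dirichlet_sym_density n k y)).
      (\<forall>i\<in>{..<n}. 0 \<le> simplex_point n y i) \<and> (\<Sum>i<n. simplex_point n y i) = 1"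
    by (subst AE_density[OF measurable_compose[OF dirichlet_sym_density_measurable measurable_ennreal]])
  have "{w \<in> space (coords n). (\<forall>i\<in>{..<n}. 0 \<le> w i) \<and> (\<Sum>i<n. w i) = 1}
      \<in> sets (coords n)"
    by measurable
  from AE_distr_iff[OF simplex_point_measurable_density this] *
  have "AE w in dirichlet_sym n k. (\<forall>i\<in>{..<n}. 0 \<le> w i) \<and> (\<Sum>i<n. w i) = 1"
    unfolding dirichlet_sym_alt by simp
  then show ?thesis by (simp add: Ball_def)
qed

text \<open>All free coordinates except i are frozen, so that mass s is divided between coordinate i
  (share u) and the last one (share s - u). On this fibre the density is a constant times a
  symmetric beta kernel. Both the exchange symmetry and the integration by parts are read off from
  it.\<close>

lemma dirichlet_fibre:
  assumes i: "i < n - 1" and I: "I = {..<n-1} - {i}"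
  defines "K \<equiv> \<lambda>x. if \<forall>j\<in>I. 0 < x j then Gamma (real n * k) / Gamma k ^ n * (\<Prod>j\<in>I. x j powr (k - 1)) else 0"
    and "s \<equiv> \<lambda>x. 1 - (\<Sum>j\<in>I. x j)"
  shows "dirichlet_sym_density n k (x(i := u)) =
      K x * (if 0 < u \<and> u < s x then u powr (k - 1) * (s x - u) powr (k - 1) else 0)"
    and "simplex_point n (x(i := u)) = (\<lambda>j\<in>{..<n}. if j = i then u else if j = n - 1 then s x - u else x j)"
    and "(\<Sum>j<n. c j * simplex_point n (x(i := u)) j) = (\<Sum>j\<in>I. c j * x j) + c i * u + c (n - 1) * (s x - u)"
proof -
  have ins: "{..<n-1} = insert i I" "i \<notin> I" "finite I" using i I by auto
  have ins': "j < n - 1 \<longleftrightarrow> j = i \<or> j \<in> I" for j using ins(1) by auto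
  have sum: "(\<Sum>j<n-1. c j * (x(i := u)) j) = c i * u + (\<Sum>j\<in>I. c j * x j)" for c
    unfolding ins(1) using ins(2,3) by (auto intro!: sum.cong)
  have sum1: "(\<Sum>j<n-1. (x(i := u)) j) = u + (\<Sum>j\<in>I. x j)" using sum[of "\<lambda>_. 1"] by simp
  have prod: "(\<Prod>j<n-1. (x(i := u)) j powr (k - 1)) = u powr (k - 1) * (\<Prod>j\<in>I. x j powr (k - 1))"
    unfolding ins(1) using ins(2,3) by (auto intro!: prod.cong)
  have all: "(\<forall>j<n-1. 0 < (x(i := u)) j) \<longleftrightarrow> 0 < u \<and> (\<forall>j\<in>I. 0 < x j)"
    using ins' ins(2) by auto
  show "dirichlet_sym_density n k (x(i := u)) =
      K x * (if 0 < u \<and> u < s x then u powr (k - 1) * (s x - u) powr (k - 1) else 0)"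
    unfolding dirichlet_sym_density_def sum1 prod all K_def s_def by (auto simp: algebra_simps)
  show "simplex_point n (x(i := u)) = (\<lambda>j\<in>{..<n}. if j = i then u else if j = n - 1 then s x - u else x j)"
    unfolding simplex_point_def sum1 s_def using i n by (auto simp: fun_eq_iff restrict_def)
  show "(\<Sum>j<n. c j * simplex_point n (x(i := u)) j) = (\<Sum>j\<in>I. c j * x j) + c i * u + c (n - 1) * (s x - u)"
    unfolding simplex_point_sum[OF n] sum sum1 s_def by (simp add: algebra_simps)
qed

lemma nn_integral_dirichlet_sym:
  assumes [measurable]: "f \<in> borel_measurable (coords n)"
  shows "(\<integral>\<^sup>+ w. f w \<partial>dirichlet_sym n k) =
    (\<integral>\<^sup>+ y. ennreal (dirichlet_sym_density n k y) * f (simplex_point n y) \<partial>coords (n-1))"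
proof -
  have m: "(\<lambda>y. f (simplex_point n y)) \<in> borel_measurable (coords (n-1))"
    by (rule measurable_compose[OF simplex_point_measurable assms])
  have d: "(\<lambda>y. ennreal (dirichlet_sym_density n k y)) \<in> borel_measurable (coords (n-1))"
    by (rule measurable_compose[OF dirichlet_sym_density_measurable measurable_ennreal])
  show ?thesis
    unfolding dirichlet_sym_alt
    by (subst nn_integral_distr[OF simplex_point_measurable_density])
       (use assms nn_integral_density[OF d m] in simp_all)
qed

lemma integral_dirichlet_sym:
  fixes f :: "(nat \<Rightarrow> real) \<Rightarrow> real"
  assumes [measurable]: "f \<in> borel_measurable (coords n)"
  shows "(\<integral>w. f w \<partial>dirichlet_sym n k) =
      (\<integral>y. dirichlet_sym_density n k y * f (simplex_point n y) \<partial>coords (n-1))"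
    and "integrable (dirichlet_sym n k) f \<longleftrightarrow>
      integrable (coords (n-1)) (\<lambda>y. dirichlet_sym_density n k y * f (simplex_point n y))"
proof -
  have m: "(\<lambda>y. f (simplex_point n y)) \<in> borel_measurable (coords (n-1))"
    by (rule measurable_compose[OF simplex_point_measurable assms])
  have nn: "AE y in coords (n-1). 0 \<le> dirichlet_sym_density n k y"
    using dirichlet_sym_density_nonneg[OF k] by blast
  show "(\<integral>w. f w \<partial>dirichlet_sym n k) =
      (\<integral>y. dirichlet_sym_density n k y * f (simplex_point n y) \<partial>coords (n-1))"
    unfolding dirichlet_sym_alt integral_distr[OF simplex_point_measurable_density assms]
    using integral_density[OF m dirichlet_sym_density_measurable nn] by simp
  show "integrable (dirichlet_sym n k) f \<longleftrightarrow>
      integrable (coords (n-1)) (\<lambda>y. dirichlet_sym_density n k y * f (simplex_point n y))"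
    unfolding dirichlet_sym_alt integrable_distr_eq[OF simplex_point_measurable_density assms]
    using integrable_density[OF m dirichlet_sym_density_measurable nn] by simp
qed

text \<open>The parametrisation singles out the last coordinate, which hides the symmetry of the
  law. On a fibre the exchange of coordinate i with the last one is the reflection u -> s - u, which
  preserves Lebesgue measure and the beta kernel.\<close>

lemma dirichlet_sym_swap_last:
  assumes i: "i < n - 1"
  defines "\<sigma> \<equiv> \<lambda>w. \<lambda>j\<in>{..<n}. w (Transposition.transpose i (n - 1) j)"
  shows "distr (dirichlet_sym n k) (coords n) \<sigma> = dirichlet_sym n k"
proof -
  interpret product_sigma_finite "\<lambda>_::nat. lborel :: real measure" by standard
  define I where "I = {..<n-1} - {i}"
  have ins: "{..<n-1} = insert i I" "i \<notin> I" "finite I" using i by (auto simp: I_def)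
  have tr: "Transposition.transpose i (n - 1) j < n" if "j < n" for j using that i by (auto simp: Transposition.transpose_def)
  have \<sigma>m [measurable]: "\<sigma> \<in> coords n \<rightarrow>\<^sub>M coords n"
    unfolding \<sigma>_def by (rule measurable_restrict) (use tr in \<open>auto intro!: PiM_component_measurable\<close>)
  have eq: "(\<integral>\<^sup>+ w. f (\<sigma> w) \<partial>dirichlet_sym n k) = (\<integral>\<^sup>+ w. f w \<partial>dirichlet_sym n k)"
    if f [measurable]: "f \<in> borel_measurable (coords n)" for f :: "_ \<Rightarrow> ennreal"
  proof -
    define g where "g y = ennreal (dirichlet_sym_density n k y) * f (simplex_point n y)" for y
    define h where "h y = ennreal (dirichlet_sym_density n k y) * f (\<sigma> (simplex_point n y))" for y
    have d: "(\<lambda>y. ennreal (dirichlet_sym_density n k y)) \<in> borel_measurable (coords (n-1))"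
      by (rule measurable_compose[OF dirichlet_sym_density_measurable measurable_ennreal])
    have g: "g \<in> borel_measurable (PiM (insert i I) (\<lambda>_. lborel))"
      unfolding g_def ins(1)[symmetric]
      by (intro borel_measurable_times_ennreal d measurable_compose[OF simplex_point_measurable f])
    have h: "h \<in> borel_measurable (PiM (insert i I) (\<lambda>_. lborel))"
      unfolding h_def ins(1)[symmetric]
      by (intro borel_measurable_times_ennreal d measurable_compose[OF simplex_point_measurable]
          measurable_compose[OF \<sigma>m f])
    have inner: "(\<integral>\<^sup>+ u. h (x(i := u)) \<partial>lborel) = (\<integral>\<^sup>+ u. g (x(i := u)) \<partial>lborel)"
      if x: "x \<in> space (PiM I (\<lambda>_. lborel))" for x
    proof -
      define s where "s = 1 - (\<Sum>j\<in>I. x j)"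
      have gx: "(\<lambda>u. g (x(i := u))) \<in> borel_measurable borel"
      proof -
        have "(\<lambda>u. x(i := u)) \<in> lborel \<rightarrow>\<^sub>M PiM (insert i I) (\<lambda>_. lborel)"
          using x by (intro measurable_fun_upd[where J = I]) auto
        from measurable_compose[OF this g] show ?thesis by simp
      qed
      have "(\<integral>\<^sup>+ u. g (x(i := u)) \<partial>lborel) = (\<integral>\<^sup>+ u. g (x(i := s + (-1) * u)) \<partial>lborel)"
        using nn_integral_real_affine[OF gx, of "-1" s] by simp
      also have "\<dots> = (\<integral>\<^sup>+ u. h (x(i := u)) \<partial>lborel)"
      proof (rule nn_integral_cong)
        fix u :: real
        have "simplex_point n (x(i := s + (-1) * u)) = \<sigma> (simplex_point n (x(i := u)))"
          unfolding dirichlet_fibre(2)[OF i I_def] \<sigma>_def s_def[symmetric]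
          using i tr by (auto simp: fun_eq_iff restrict_def Transposition.transpose_def)
        moreover have "dirichlet_sym_density n k (x(i := s + (-1) * u)) = dirichlet_sym_density n k (x(i := u))"
          unfolding dirichlet_fibre(1)[OF i I_def] s_def[symmetric] by auto
        ultimately show "g (x(i := s + (-1) * u)) = h (x(i := u))" by (simp add: g_def h_def)
      qed
      finally show ?thesis by simp
    qed
    have "(\<integral>\<^sup>+ y. h y \<partial>PiM (insert i I) (\<lambda>_. lborel)) = (\<integral>\<^sup>+ y. g y \<partial>PiM (insert i I) (\<lambda>_. lborel))"
      unfolding product_nn_integral_insert[OF ins(3,2) g] product_nn_integral_insert[OF ins(3,2) h]
      by (intro nn_integral_cong inner)
    then show ?thesis
      using nn_integral_dirichlet_sym[OF f] nn_integral_dirichlet_sym[OF measurable_compose[OF \<sigma>m f]]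
      unfolding g_def h_def ins(1)[symmetric] by simp
  qed
  show ?thesis
  proof (rule measure_eqI)
    fix A assume "A \<in> sets (distr (dirichlet_sym n k) (coords n) \<sigma>)"
    then have A [measurable]: "A \<in> sets (coords n)" by simp
    have "emeasure (distr (dirichlet_sym n k) (coords n) \<sigma>) A =
        (\<integral>\<^sup>+ w. indicator A w \<partial>distr (dirichlet_sym n k) (coords n) \<sigma>)" by simp
    also have "\<dots> = (\<integral>\<^sup>+ w. indicator A (\<sigma> w) \<partial>dirichlet_sym n k)"
      by (rule nn_integral_distr) simp_all
    also have "\<dots> = (\<integral>\<^sup>+ w. indicator A w \<partial>dirichlet_sym n k)" by (rule eq) simp
    also have "\<dots> = emeasure (dirichlet_sym n k) A" by simp
    finally show "emeasure (distr (dirichlet_sym n k) (coords n) \<sigma>) A = emeasure (dirichlet_sym n k) A" .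
  qed simp
qed

text \<open>Moving mass from the last coordinate to coordinate i changes S at rate c_i - c_last, so
  the test function S^3 contributes the derivative 3 S^2 (c_i - c_last). The cube is chosen because
  a later multiplication by c_i and summation over i turn w_i S^3 into S^4.\<close>

lemma dirichlet_sym_ibp:
  fixes c :: "nat \<Rightarrow> real"
  assumes i: "i < n - 1"
  defines "S \<equiv> \<lambda>w. \<Sum>j<n. c j * w j"
  assumes int: "integrable (dirichlet_sym n k)
      (\<lambda>w. k * (w (n - 1) - w i) * S w ^ 3 + w i * w (n - 1) * (3 * (S w)\<^sup>2 * (c i - c (n - 1))))"
  shows "(\<integral>w. k * (w (n - 1) - w i) * S w ^ 3 + w i * w (n - 1) * (3 * (S w)\<^sup>2 * (c i - c (n - 1)))
      \<partial>dirichlet_sym n k) = 0" (is "(\<integral>w. ?\<Psi> w \<partial>_) = 0")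
proof -
  interpret product_sigma_finite "\<lambda>_::nat. lborel :: real measure" by standard
  define I where "I = {..<n-1} - {i}"
  have ins: "{..<n-1} = insert i I" "i \<notin> I" "finite I" using i by (auto simp: I_def)
  have m: "?\<Psi> \<in> borel_measurable (coords n)"
    using borel_measurable_integrable[OF int] by simp
  define g where "g y = dirichlet_sym_density n k y * ?\<Psi> (simplex_point n y)" for y
  have g: "integrable (PiM (insert i I) (\<lambda>_. lborel)) g"
    using int unfolding integral_dirichlet_sym(2)[OF m] g_def ins(1)[symmetric] by simp
  have "(\<integral>u. g (x(i := u)) \<partial>lborel) = 0" for x
  proof -
    define s where "s = 1 - (\<Sum>j\<in>I. x j)"
    define F where "F u = ((\<Sum>j\<in>I. c j * x j) + c i * u + c (n - 1) * (s - u)) ^ 3" for u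
    define F' where "F' u = 3 * ((\<Sum>j\<in>I. c j * x j) + c i * u + c (n - 1) * (s - u))\<^sup>2 * (c i - c (n - 1))" for u
    have F: "(F has_real_derivative F' u) (at u)" for u
      unfolding F_def F'_def by (auto intro!: derivative_eq_intros)
    define K where "K = (if \<forall>j\<in>I. 0 < x j then Gamma (real n * k) / Gamma k ^ n * (\<Prod>j\<in>I. x j powr (k - 1)) else 0)"
    have "g (x(i := u)) = K * (if 0 < u \<and> u < s then u powr (k - 1) * (s - u) powr (k - 1) *
            (k * (s - 2 * u) * F u + u * (s - u) * F' u) else 0)" for u
    proof -
      have w: "simplex_point n (x(i := u)) i = u" "simplex_point n (x(i := u)) (n - 1) = s - u"
        unfolding dirichlet_fibre(2)[OF i I_def] s_def[symmetric] using i by auto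
      have Sw: "S (simplex_point n (x(i := u))) = (\<Sum>j\<in>I. c j * x j) + c i * u + c (n - 1) * (s - u)"
        unfolding S_def dirichlet_fibre(3)[OF i I_def] s_def ..
      show ?thesis
        unfolding g_def w Sw F_def[symmetric] F'_def[symmetric] dirichlet_fibre(1)[OF i I_def] s_def[symmetric] K_def[symmetric]
        by (auto simp: algebra_simps)
    qed
    then show ?thesis using beta_integration_by_parts[OF k F, of s] by simp
  qed
  then have "(\<integral>y. g y \<partial>PiM (insert i I) (\<lambda>_. lborel)) = 0"
    unfolding product_integral_insert[OF ins(3,2) g] by simp
  then show ?thesis
    unfolding integral_dirichlet_sym(1)[OF m] g_def ins(1)[symmetric] .
qed

text \<open>The integration by parts above pairs each coordinate with the last one; summing over coordinates and
  using the symmetry of the law gives the self-bounding identity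
  \<open>(kn + 3) E S\<^sup>4 = 3 E (S\<^sup>2 T)\<close> with \<open>S = \<Sum>c\<^sub>jw\<^sub>j\<close> and \<open>T = \<Sum>c\<^sub>j\<^sup>2w\<^sub>j\<close>.\<close>
lemma dirichlet_sym_fourth_moment:
  fixes c :: "nat \<Rightarrow> real"
  assumes P: "prob_space (dirichlet_sym n k)" and c: "(\<Sum>j<n. c j) = 0"
  shows "(\<integral>\<^sup>+ w. ennreal ((\<Sum>j<n. c j * w j) ^ 4) \<partial>dirichlet_sym n k)
      \<le> ennreal (9 / (k * n)\<^sup>2 * ((\<Sum>j<n. c j ^ 4) / n))"
proof -
  let ?D = "dirichlet_sym n k"
  interpret prob_space ?D by fact
  let ?L = "n - 1"
  define S where "S c w = (\<Sum>j<n. c j * w j)" for c w :: "nat \<Rightarrow> real"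
  define T where "T c w = (\<Sum>j<n. (c j)\<^sup>2 * w j)" for c w :: "nat \<Rightarrow> real"
  let ?X = "\<lambda>c i w. k * (w ?L - w i) * S c w ^ 3 + w i * w ?L * (3 * (S c w)\<^sup>2 * (c i - c ?L))"
  let ?Y = "\<lambda>c j w. k * S c w ^ 4 - 3 * (w j * (S c w)\<^sup>2 * (T c w - c j * S c w))"
  have L: "?L < n" using n by simp
  have comp: "j < n \<Longrightarrow> (\<lambda>w. w j) \<in> borel_measurable (coords n)" for j
    by (rule PiM_component_measurable) simp
  have meas: "borel_measurable (?D) = borel_measurable (coords n)"
    by (rule measurable_cong_sets) simp_all
  have w1: "AE w in ?D. \<forall>j<n. \<bar>w j\<bar> \<le> 1"
    using AE_dirichlet_simplex
  proof eventually_elim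
    fix w :: "nat \<Rightarrow> real" assume w: "(\<forall>i<n. 0 \<le> w i) \<and> (\<Sum>i<n. w i) = 1"
    have "w j \<le> (\<Sum>i<n. w i)" if "j < n" for j
      using w that by (intro member_le_sum) auto
    then show "\<forall>j<n. \<bar>w j\<bar> \<le> 1" using w by auto
  qed
  let ?B = "ess_bounded (?D)"
  have bdd_w: "?B (\<lambda>w. w j)" if "j < n" for j
  proof (rule ess_boundedI)
    show "AE w in ?D. \<bar>w j\<bar> \<le> 1" using w1 that by (auto elim: eventually_mono)
  qed (use comp[OF that] in \<open>simp add: meas\<close>)
  have bdd_S: "?B (S c)" for c
    unfolding S_def[abs_def] by (intro ess_bounded_intros bdd_w) simp
  have bdd_T: "?B (T c)" for c
    unfolding T_def[abs_def] by (intro ess_bounded_intros bdd_w) simp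
  note bdds = ess_bounded_intros bdd_w bdd_S bdd_T L
  have step1: "(\<integral>w. ?X c i w \<partial>?D) = 0"
    if i: "i < n" for i and c :: "nat \<Rightarrow> real"
  proof (cases "i < n - 1")
    case True
    have "integrable (?D)
        (\<lambda>w. ?X c i w)"
      using i by (intro ess_bounded_integrable bdds)
    then show ?thesis using dirichlet_sym_ibp[OF True, of c] by (simp add: S_def)
  next
    case False
    then have "i = ?L" using i by simp
    then show ?thesis by simp
  qed
  \<comment> \<open>Step 1 is multiplied by -c_i and summed. The centring removes the term in which
    S^3 meets only the last weight, and the sum of c_i w_i rebuilds one more factor S.\<close>
  have step2: "(\<integral>w. ?Y c ?L w \<partial>?D) = 0"
    if c: "(\<Sum>j<n. c j) = 0" for c :: "nat \<Rightarrow> real"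
  proof -
    have "0 = (\<Sum>i<n. - c i * (\<integral>w. ?X c i w \<partial>?D))"
      using step1 by simp
    also have "\<dots> = (\<integral>w. (\<Sum>i<n. - c i * ?X c i w) \<partial>?D)"
      unfolding integral_mult_right_zero[symmetric]
      by (rule Bochner_Integration.integral_sum[symmetric]) (auto intro!: ess_bounded_integrable bdds)
    also have "(\<lambda>w. \<Sum>i<n. - c i * ?X c i w)
      = (\<lambda>w. ?Y c ?L w)"
    proof
      fix w
      have "(\<Sum>i<n. - c i * ?X c i w) =
         (\<Sum>i<n. (- k * w ?L * S c w ^ 3) * c i + (k * S c w ^ 3) * (c i * w i) - (3 * w ?L * (S c w)\<^sup>2) * ((c i)\<^sup>2 * w i)
            + (3 * w ?L * (S c w)\<^sup>2 * c ?L) * (c i * w i))"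
        by (intro sum.cong refl) (simp add: algebra_simps power2_eq_square power3_eq_cube)
      also have "\<dots> = (- k * w ?L * S c w ^ 3) * (\<Sum>i<n. c i) + (k * S c w ^ 3) * S c w - (3 * w ?L * (S c w)\<^sup>2) * T c w
            + (3 * w ?L * (S c w)\<^sup>2 * c ?L) * S c w"
        unfolding S_def T_def sum.distrib sum_subtractf sum_distrib_left[symmetric] ..
      also have "\<dots> = ?Y c ?L w"
        using c by (simp add: algebra_simps power2_eq_square power3_eq_cube power4_eq_xxxx)
      finally show "(\<Sum>i<n. - c i * ?X c i w) = \<dots>" .
    qed
    finally show ?thesis by simp
  qed
  have swap: "(\<integral>w. f (\<lambda>j\<in>{..<n}. w (Transposition.transpose i ?L j)) \<partial>?D) = (\<integral>w. f w \<partial>?D)"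
    if i: "i < n" and f: "?B f" for i and f :: "(nat \<Rightarrow> real) \<Rightarrow> real"
  proof (cases "i < n - 1")
    case True
    have "(\<lambda>w. \<lambda>j\<in>{..<n}. w (Transposition.transpose i ?L j)) \<in> ?D \<rightarrow>\<^sub>M coords n"
      unfolding measurable_cong_sets[OF sets_dirichlet_sym refl]
      by (rule measurable_restrict) (use i in \<open>auto intro!: PiM_component_measurable simp: Transposition.transpose_def\<close>)
    from integral_distr[OF this ess_bounded_measurable[OF f, unfolded meas]] show ?thesis unfolding dirichlet_sym_swap_last[OF True] by simp
  next
    case False
    then have "i = ?L" using i by simp
    then show ?thesis
      by (intro Bochner_Integration.integral_cong refl arg_cong[where f = f])
         (auto simp: space_dirichlet_sym space_PiM PiE_def extensional_def restrict_def fun_eq_iff)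
  qed
  \<comment> \<open>The last index is traded for j: step 2 holds for every centred coefficient
    vector, in particular for the one with c_j and c_last exchanged, and the symmetry of the law
    exchanges the weights back.\<close>
  have step3: "(\<integral>w. ?Y c j w \<partial>?D) = 0" if j: "j < n" for j
  proof -
    let ?\<sigma> = "Transposition.transpose j ?L"
    have bij: "bij_betw ?\<sigma> {..<n} {..<n}"
      using j L by (intro bij_betw_byWitness[where f' = ?\<sigma>]) (auto simp: Transposition.transpose_def)
    have re: "(\<Sum>i<n. g (?\<sigma> i)) = (\<Sum>i<n. g i)" for g :: "nat \<Rightarrow> real"
      by (rule sum.reindex_bij_betw[OF bij])
    define c' where "c' = (\<lambda>i. c (?\<sigma> i))"
    have Sre: "S c (\<lambda>i\<in>{..<n}. w (?\<sigma> i)) = S c' w" for w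
      using re[of "\<lambda>i. c' i * w i"] unfolding S_def c'_def by simp
    have Tre: "T c (\<lambda>i\<in>{..<n}. w (?\<sigma> i)) = T c' w" for w
      using re[of "\<lambda>i. (c' i)\<^sup>2 * w i"] unfolding T_def c'_def by simp
    have "(\<Sum>i<n. c' i) = 0" using re[of c] c by (simp add: c'_def)
    from step2[OF this]
    have "0 = (\<integral>w. k * S c' w ^ 4 - 3 * (w ?L * (S c' w)\<^sup>2 * (T c' w - c j * S c' w)) \<partial>?D)"
      by (simp add: c'_def)
    also have "\<dots> = (\<integral>w. (\<lambda>w. ?Y c j w) (\<lambda>i\<in>{..<n}. w (?\<sigma> i)) \<partial>?D)"
      using j by (simp add: Sre Tre del: One_nat_def)
    also have "\<dots> = (\<integral>w. ?Y c j w \<partial>?D)"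
      using j by (intro swap bdds)
    finally show ?thesis by simp
  qed
  \<comment> \<open>Summation over j uses that the weights add up to 1 and that the c_j w_j add up
    to S; the latter yields the extra 3 S^4.\<close>
  have step4: "(\<integral>w. k * n * S c w ^ 4 - 3 * ((S c w)\<^sup>2 * (T c w - (S c w)\<^sup>2)) \<partial>?D) = 0"
  proof -
    have "0 = (\<Sum>j<n. (\<integral>w. ?Y c j w \<partial>?D))"
      using step3 by simp
    also have "\<dots> = (\<integral>w. (\<Sum>j<n. ?Y c j w) \<partial>?D)"
      by (rule Bochner_Integration.integral_sum[symmetric]) (auto intro!: ess_bounded_integrable bdds)
    also have "\<dots> = (\<integral>w. k * n * S c w ^ 4 - 3 * ((S c w)\<^sup>2 * (T c w - (S c w)\<^sup>2)) \<partial>?D)"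
    proof (rule integral_cong_AE)
      show "AE w in ?D. (\<Sum>j<n. ?Y c j w)
          = k * n * S c w ^ 4 - 3 * ((S c w)\<^sup>2 * (T c w - (S c w)\<^sup>2))"
        using AE_dirichlet_simplex
      proof eventually_elim
        fix w :: "nat \<Rightarrow> real" assume w: "(\<forall>i<n. 0 \<le> w i) \<and> (\<Sum>i<n. w i) = 1"
        have "(\<Sum>j<n. ?Y c j w)
          = (\<Sum>j<n. k * S c w ^ 4 - (3 * (S c w)\<^sup>2 * T c w) * w j + (3 * (S c w)\<^sup>2 * S c w) * (c j * w j))"
          by (intro sum.cong refl) (simp add: algebra_simps)
        also have "\<dots> = k * n * S c w ^ 4 - (3 * (S c w)\<^sup>2 * T c w) * (\<Sum>j<n. w j) + (3 * (S c w)\<^sup>2 * S c w) * S c w"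
          unfolding sum.distrib sum_subtractf sum_distrib_left[symmetric] by (simp add: S_def)
        finally show "(\<Sum>j<n. ?Y c j w)
          = k * n * S c w ^ 4 - 3 * ((S c w)\<^sup>2 * (T c w - (S c w)\<^sup>2))"
          using w by (simp add: algebra_simps power2_eq_square)
      qed
    qed (auto intro!: ess_bounded_measurable bdds)
    finally show ?thesis by simp
  qed
  have Ew: "(\<integral>w. w j \<partial>?D) = 1 / n" if j: "j < n" for j
  proof -
    have all: "(\<integral>w. w j \<partial>?D) = (\<integral>w. w ?L \<partial>?D)" if j: "j < n" for j
      using swap[OF j, of "\<lambda>w. w j"] bdd_w[OF j] j by simp
    have "1 = (\<integral>w. (\<Sum>j<n. w j) \<partial>?D)"
    proof -
      have "(\<integral>w. (\<Sum>j<n. w j) \<partial>?D) = (\<integral>w. 1 \<partial>?D)"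
        by (rule integral_cong_AE) (use AE_dirichlet_simplex in \<open>auto elim: eventually_mono\<close>)
      then show ?thesis by (simp add: prob_space)
    qed
    also have "\<dots> = (\<Sum>j<n. (\<integral>w. w j \<partial>?D))"
      by (rule Bochner_Integration.integral_sum) (auto intro!: ess_bounded_integrable bdds)
    also have "\<dots> = (\<Sum>i<n. (\<integral>w. w j \<partial>?D))"
      by (intro sum.cong refl trans[OF all all[OF j, symmetric]]) simp
    finally show ?thesis using n by (simp add: field_simps)
  qed
  have ET: "(\<integral>w. (T c w)\<^sup>2 \<partial>?D) \<le> (\<Sum>j<n. c j ^ 4) / n"
  proof -
    have "(\<integral>w. (T c w)\<^sup>2 \<partial>?D) \<le> (\<integral>w. (\<Sum>j<n. c j ^ 4 * w j) \<partial>?D)"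
    proof (rule integral_mono_AE)
      show "AE w in ?D. (T c w)\<^sup>2 \<le> (\<Sum>j<n. c j ^ 4 * w j)"
        using AE_dirichlet_simplex
      proof eventually_elim
        fix w :: "nat \<Rightarrow> real" assume w: "(\<forall>i<n. 0 \<le> w i) \<and> (\<Sum>i<n. w i) = 1"
        \<comment> \<open>The variance of the values c_j^2 under the weights w is
          nonnegative.\<close>
        have "0 \<le> (\<Sum>j<n. ((c j)\<^sup>2 - T c w)\<^sup>2 * w j)" using w by (intro sum_nonneg) auto
        also have "\<dots> = (\<Sum>j<n. c j ^ 4 * w j - 2 * T c w * ((c j)\<^sup>2 * w j) + (T c w)\<^sup>2 * w j)"
          by (intro sum.cong refl) (simp add: algebra_simps power2_eq_square power4_eq_xxxx)
        also have "\<dots> = (\<Sum>j<n. c j ^ 4 * w j) - 2 * T c w * T c w + (T c w)\<^sup>2 * (\<Sum>j<n. w j)"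
          unfolding sum.distrib sum_subtractf sum_distrib_left[symmetric] by (simp add: T_def)
        finally show "(T c w)\<^sup>2 \<le> (\<Sum>j<n. c j ^ 4 * w j)" using w by (simp add: power2_eq_square)
      qed
    qed (auto intro!: ess_bounded_integrable bdds)
    also have "\<dots> = (\<Sum>j<n. (\<integral>w. c j ^ 4 * w j \<partial>?D))"
      by (rule Bochner_Integration.integral_sum) (auto intro!: ess_bounded_integrable bdds)
    also have "\<dots> = (\<Sum>j<n. c j ^ 4 / n)" by (intro sum.cong) (auto simp: Ew)
    finally show ?thesis by (simp add: sum_divide_distrib)
  qed
  define x where "x = k * n"
  have x: "0 < x" using k n by (simp add: x_def)
  have "(\<integral>w. x / 2 * (S c w ^ 4 - 9 / x\<^sup>2 * (T c w)\<^sup>2) \<partial>?D)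
      \<le> (\<integral>w. x * S c w ^ 4 - 3 * ((S c w)\<^sup>2 * (T c w - (S c w)\<^sup>2)) \<partial>?D)"
  proof (intro integral_mono ess_bounded_integrable bdds)
    fix w
    \<comment> \<open>Completing the square gives 3 S^2 T \<le> (x/2) S^4 + (9/(2x)) T^2, so half of
      x S^4 absorbs the mixed term. This is the origin of the constant 9.\<close>
    have "0 \<le> x / 2 * ((S c w)\<^sup>2 - 3 / x * T c w)\<^sup>2 + 3 * S c w ^ 4" using x by simp
    also have "\<dots> = x * S c w ^ 4 - 3 * ((S c w)\<^sup>2 * (T c w - (S c w)\<^sup>2)) - x / 2 * (S c w ^ 4 - 9 / x\<^sup>2 * (T c w)\<^sup>2)"
      using x by (simp add: field_simps power2_eq_square power4_eq_xxxx)
    finally show "x / 2 * (S c w ^ 4 - 9 / x\<^sup>2 * (T c w)\<^sup>2) \<le> x * S c w ^ 4 - 3 * ((S c w)\<^sup>2 * (T c w - (S c w)\<^sup>2))"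
      by simp
  qed
  also have "\<dots> = 0" using step4 by (simp add: x_def)
  also have "(\<integral>w. x / 2 * (S c w ^ 4 - 9 / x\<^sup>2 * (T c w)\<^sup>2) \<partial>?D) =
     x / 2 * ((\<integral>w. S c w ^ 4 \<partial>?D) - 9 / x\<^sup>2 * (\<integral>w. (T c w)\<^sup>2 \<partial>?D))"
    by (subst integral_mult_right_zero, subst Bochner_Integration.integral_diff)
       ((intro ess_bounded_integrable bdds)+, simp)
  finally have "(\<integral>w. S c w ^ 4 \<partial>?D) \<le> 9 / x\<^sup>2 * (\<integral>w. (T c w)\<^sup>2 \<partial>?D)"
    using x by (simp add: mult_le_0_iff)
  also have "\<dots> \<le> 9 / x\<^sup>2 * ((\<Sum>j<n. c j ^ 4) / n)"
    by (intro mult_left_mono ET) simp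
  finally have "(\<integral>w. S c w ^ 4 \<partial>?D) \<le> 9 / (k * n)\<^sup>2 * ((\<Sum>j<n. c j ^ 4) / n)"
    unfolding x_def .
  moreover have "(\<integral>\<^sup>+ w. ennreal (S c w ^ 4) \<partial>?D) = ennreal (\<integral>w. S c w ^ 4 \<partial>?D)"
    by (intro nn_integral_eq_integral ess_bounded_integrable bdds) simp
  ultimately show ?thesis unfolding S_def by (simp add: ennreal_leI)
qed

end

section \<open>Second-order expansion of a mean-one exponential\<close>

text \<open>On |u| \<le> 1/2 the third derivative of the logarithm is at most 2 * 2^3 = 16, and 16 /
  3! is below 3.\<close>

lemma ln_one_plus_taylor:
  assumes "\<bar>u\<bar> \<le> 1 / 2"
  shows "\<bar>ln (1 + u) - (u - u\<^sup>2 / 2 :: real)\<bar> \<le> 3 * \<bar>u\<bar> ^ 3"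
proof -
  define diff :: "nat \<Rightarrow> real \<Rightarrow> real" where
    "diff m = (if m = 0 then (\<lambda>t. ln (1 + t)) else if m = 1 then (\<lambda>t. 1 / (1 + t))
       else if m = 2 then (\<lambda>t. - 1 / (1 + t)\<^sup>2) else (\<lambda>t. 2 / (1 + t) ^ 3))" for m
  have "\<exists>t. \<bar>t\<bar> \<le> \<bar>u\<bar> \<and> ln (1 + u) = (\<Sum>m<3. diff m 0 / fact m * u ^ m) + diff 3 t / fact 3 * u ^ 3"
  proof (rule Maclaurin_bi_le)
    show "diff 0 = (\<lambda>t. ln (1 + t))" by (simp add: diff_def)
    show "\<forall>m t. m < 3 \<and> \<bar>t\<bar> \<le> \<bar>u\<bar> \<longrightarrow> (diff m has_real_derivative diff (Suc m) t) (at t)"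
    proof (intro allI impI)
      fix m :: nat and t assume *: "m < 3 \<and> \<bar>t\<bar> \<le> \<bar>u\<bar>"
      then have t: "0 < 1 + t" using assms by linarith
      consider "m = 0" | "m = 1" | "m = 2" using * by linarith
      then show "(diff m has_real_derivative diff (Suc m) t) (at t)"
      proof cases
        case 1 then show ?thesis using t by (auto simp: diff_def intro!: derivative_eq_intros)
      next
        case 2 then show ?thesis using t
          by (auto simp: diff_def power2_eq_square intro!: derivative_eq_intros)
      next
        case 3
        have "((\<lambda>t. - 1 / (1 + t)\<^sup>2) has_real_derivative 2 / (1 + t) ^ 3) (at t)"
          using t by (auto intro!: derivative_eq_intros simp: divide_simps) algebra
        then show ?thesis using 3 by (simp add: diff_def)
      qed
    qed
  qed
  then obtain t where t: "\<bar>t\<bar> \<le> \<bar>u\<bar>"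
    and eq: "ln (1 + u) = (\<Sum>m<3. diff m 0 / fact m * u ^ m) + diff 3 t / fact 3 * u ^ 3" by blast
  have "(1 / 2) ^ 3 \<le> (1 + t) ^ 3" using t assms by (intro power_mono) auto
  then have t0: "1 / 8 \<le> (1 + t) ^ 3" by (simp add: power3_eq_cube)
  have z: "0 \<le> 2 / (1 + t) ^ 3 / 6" by (intro divide_nonneg_nonneg order_trans[OF _ t0]) simp_all
  have b: "2 / (1 + t) ^ 3 \<le> 16" using frac_le[OF _ _ _ t0, of 2 2] by simp
  have "ln (1 + u) - (u - u\<^sup>2 / 2) = 2 / (1 + t) ^ 3 / 6 * u ^ 3"
    unfolding eq by (simp add: diff_def numeral_eq_Suc)
  then have "\<bar>ln (1 + u) - (u - u\<^sup>2 / 2)\<bar> = 2 / (1 + t) ^ 3 / 6 * \<bar>u\<bar> ^ 3"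
    by (simp only: abs_mult power_abs abs_of_nonneg[OF z])
  also have "\<dots> \<le> 3 * \<bar>u\<bar> ^ 3"
    using b by (intro mult_right_mono) auto
  finally show ?thesis .
qed

lemma exp_taylor:
  assumes "\<bar>v\<bar> \<le> (1::real)"
  shows "\<bar>exp v - (1 + v + v\<^sup>2 / 2)\<bar> \<le> \<bar>v\<bar> ^ 3"
proof -
  obtain t where t: "\<bar>t\<bar> \<le> \<bar>v\<bar>" and eq: "exp v = (\<Sum>m<3. v ^ m / fact m) + exp t / fact 3 * v ^ 3"
    using Maclaurin_exp_le[of v 3] by blast
  have "exp t \<le> exp 1" using t assms by auto
  also have "exp 1 \<le> (3::real)" using exp_le .
  finally have b: "exp t / 6 \<le> 1" by simp
  have "exp v - (1 + v + v\<^sup>2 / 2) = exp t / 6 * v ^ 3"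
    unfolding eq by (simp add: numeral_eq_Suc)
  then have "\<bar>exp v - (1 + v + v\<^sup>2 / 2)\<bar> = exp t / 6 * \<bar>v\<bar> ^ 3" by (simp only: abs_mult power_abs) simp
  also have "\<dots> \<le> 1 * \<bar>v\<bar> ^ 3" using b by (intro mult_right_mono) auto
  finally show ?thesis by simp
qed

text \<open>The constant is uniform in x, so the cubic error survives integration over
  \<open>X\<close>. The second-order coefficient is recorded as -V/2 because each logarithm ln (1 +
  t c) contributes -c^2/2; after exponentiation the coefficient of t^2 is (D^2 - V)/2.\<close>

definition log_expansion :: "real \<Rightarrow> 'a set \<Rightarrow> (real \<Rightarrow> 'a \<Rightarrow> real) \<Rightarrow> ('a \<Rightarrow> real) \<Rightarrow> ('a \<Rightarrow> real) \<Rightarrow> bool" where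
  "log_expansion t\<^sub>0 X L D V \<longleftrightarrow>
     (\<exists>C\<ge>0. \<forall>t\<in>{0..t\<^sub>0}. \<forall>x\<in>X. \<bar>L t x - (t * D x - t\<^sup>2 * V x / 2)\<bar> \<le> C * t ^ 3)"

lemma log_expansion_ln:
  assumes "\<And>x. x \<in> X \<Longrightarrow> \<bar>c x\<bar> \<le> K" "t\<^sub>0 * K \<le> 1 / 2" "0 \<le> K"
  shows "log_expansion t\<^sub>0 X (\<lambda>t x. p * ln (1 + t * c x)) (\<lambda>x. p * c x) (\<lambda>x. p * (c x)\<^sup>2)"
  unfolding log_expansion_def
proof (intro exI conjI ballI)
  show "0 \<le> \<bar>p\<bar> * (3 * K ^ 3)" using assms by simp
  fix t x assume t: "t \<in> {0..t\<^sub>0}" and x: "x \<in> X"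
  have tc: "\<bar>t * c x\<bar> \<le> t * K" using assms(1)[OF x] t by (auto simp: abs_mult intro!: mult_left_mono)
  also have "\<dots> \<le> t\<^sub>0 * K" using t assms(3) by (auto intro!: mult_right_mono)
  finally have "\<bar>t * c x\<bar> \<le> 1 / 2" using assms(2) by linarith
  from ln_one_plus_taylor[OF this]
  have *: "\<bar>ln (1 + t * c x) - (t * c x - (t * c x)\<^sup>2 / 2)\<bar> \<le> 3 * \<bar>t * c x\<bar> ^ 3" .
  have "p * ln (1 + t * c x) - (t * (p * c x) - t\<^sup>2 * (p * (c x)\<^sup>2) / 2)
      = p * (ln (1 + t * c x) - (t * c x - (t * c x)\<^sup>2 / 2))"
    by (simp add: algebra_simps power_mult_distrib)
  then have "\<bar>p * ln (1 + t * c x) - (t * (p * c x) - t\<^sup>2 * (p * (c x)\<^sup>2) / 2)\<bar>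
      = \<bar>p\<bar> * \<bar>ln (1 + t * c x) - (t * c x - (t * c x)\<^sup>2 / 2)\<bar>" by (simp add: abs_mult)
  also have "\<dots> \<le> \<bar>p\<bar> * (3 * \<bar>t * c x\<bar> ^ 3)" by (intro mult_left_mono *) simp
  also have "\<dots> \<le> \<bar>p\<bar> * (3 * (t * K) ^ 3)" using tc by (intro mult_left_mono power_mono) auto
  also have "\<dots> = \<bar>p\<bar> * (3 * K ^ 3) * t ^ 3" by (simp add: power_mult_distrib)
  finally show "\<bar>p * ln (1 + t * c x) - (t * (p * c x) - t\<^sup>2 * (p * (c x)\<^sup>2) / 2)\<bar> \<le> \<bar>p\<bar> * (3 * K ^ 3) * t ^ 3" .
qed

lemma log_expansion_add:
  assumes "log_expansion t\<^sub>0 X L1 D1 V1" "log_expansion t\<^sub>0 X L2 D2 V2"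
  shows "log_expansion t\<^sub>0 X (\<lambda>t x. L1 t x + L2 t x) (\<lambda>x. D1 x + D2 x) (\<lambda>x. V1 x + V2 x)"
proof -
  from assms obtain C1 C2 where C: "0 \<le> C1" "0 \<le> C2"
    and 1: "\<And>t x. t \<in> {0..t\<^sub>0} \<Longrightarrow> x \<in> X \<Longrightarrow> \<bar>L1 t x - (t * D1 x - t\<^sup>2 * V1 x / 2)\<bar> \<le> C1 * t ^ 3"
    and 2: "\<And>t x. t \<in> {0..t\<^sub>0} \<Longrightarrow> x \<in> X \<Longrightarrow> \<bar>L2 t x - (t * D2 x - t\<^sup>2 * V2 x / 2)\<bar> \<le> C2 * t ^ 3"
    unfolding log_expansion_def by blast
  have "\<bar>L1 t x + L2 t x - (t * (D1 x + D2 x) - t\<^sup>2 * (V1 x + V2 x) / 2)\<bar> \<le> (C1 + C2) * t ^ 3"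
    if "t \<in> {0..t\<^sub>0}" "x \<in> X" for t x
    using 1[OF that] 2[OF that] by (simp add: distrib_left distrib_right add_divide_distrib)
  then show ?thesis unfolding log_expansion_def using C by (intro exI[of _ "C1 + C2"]) auto
qed

lemma log_expansion_zero: "log_expansion t\<^sub>0 X (\<lambda>t x. 0) (\<lambda>x. 0) (\<lambda>x. 0)"
  unfolding log_expansion_def by (intro exI[of _ 0]) auto

lemma log_expansion_sum:
  assumes "\<And>i. i \<in> I \<Longrightarrow> log_expansion t\<^sub>0 X (L i) (D i) (V i)"
  shows "log_expansion t\<^sub>0 X (\<lambda>t x. \<Sum>i\<in>I. L i t x) (\<lambda>x. \<Sum>i\<in>I. D i x) (\<lambda>x. \<Sum>i\<in>I. V i x)"
  using assms
  by (induction I rule: infinite_finite_induct) (simp_all add: log_expansion_add log_expansion_zero)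

text \<open>Coefficient comparison from one side: divide by t and let t decrease to 0, then divide
  by t^2. It replaces differentiation under the integral sign.\<close>

lemma cubic_bound_imp_zero:
  fixes A B C t\<^sub>1 :: real
  assumes "0 < t\<^sub>1" and bound: "\<And>t. 0 < t \<Longrightarrow> t < t\<^sub>1 \<Longrightarrow> \<bar>t * A + t\<^sup>2 * B\<bar> \<le> C * t ^ 3"
  shows "A = 0" "B = 0"
proof -
  have ev: "eventually (\<lambda>t. 0 < t \<and> t < t\<^sub>1) (at_right (0::real))"
    using assms(1) by (auto simp: eventually_at_right_field)
  have "\<bar>A\<bar> \<le> 0"
  proof (rule tendsto_lowerbound)
    show "((\<lambda>t. t * \<bar>B\<bar> + C * t\<^sup>2) \<longlongrightarrow> 0) (at_right 0)"
      by (auto intro!: tendsto_eq_intros)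
    show "eventually (\<lambda>t. \<bar>A\<bar> \<le> t * \<bar>B\<bar> + C * t\<^sup>2) (at_right 0)"
      using ev
    proof eventually_elim
      fix t assume t: "0 < t \<and> t < t\<^sub>1"
      have "t * \<bar>A\<bar> = \<bar>(t * A + t\<^sup>2 * B) - t\<^sup>2 * B\<bar>" using t by (simp add: abs_mult)
      also have "\<dots> \<le> C * t ^ 3 + t\<^sup>2 * \<bar>B\<bar>"
        using bound[of t] t abs_triangle_ineq4[of "t * A + t\<^sup>2 * B" "t\<^sup>2 * B"] by (simp add: abs_mult)
      also have "\<dots> = t * (t * \<bar>B\<bar> + C * t\<^sup>2)" by (simp add: algebra_simps power2_eq_square power3_eq_cube)
      finally show "\<bar>A\<bar> \<le> t * \<bar>B\<bar> + C * t\<^sup>2" using t by simp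
    qed
  qed simp
  then show A: "A = 0" by simp
  have "\<bar>B\<bar> \<le> 0"
  proof (rule tendsto_lowerbound)
    show "((\<lambda>t. C * t) \<longlongrightarrow> 0) (at_right 0)"
      by (auto intro!: tendsto_eq_intros)
    show "eventually (\<lambda>t. \<bar>B\<bar> \<le> C * t) (at_right 0)"
      using ev
    proof eventually_elim
      fix t assume t: "0 < t \<and> t < t\<^sub>1"
      have "t\<^sup>2 * \<bar>B\<bar> \<le> t\<^sup>2 * (C * t)"
        using bound[of t] t A by (simp add: abs_mult power2_eq_square power3_eq_cube mult_ac)
      then show "\<bar>B\<bar> \<le> C * t" using t by simp
    qed
  qed simp
  then show "B = 0" by simp
qed

text \<open>The mean of exp (L_t) is constantly 1, so in its expansion t E D + t^2 E (D^2 - V)/2 +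
  O(t^3) both coefficients vanish. The uniform bounds on D and V make the error cubic in t after
  integration.\<close>

lemma (in prob_space) log_expansion_moments:
  assumes exp: "log_expansion t\<^sub>0 X L D V" and t0: "0 < t\<^sub>0"
    and X: "AE x in M. x \<in> X"
    and bdd: "\<And>x. x \<in> X \<Longrightarrow> \<bar>D x\<bar> \<le> B" "\<And>x. x \<in> X \<Longrightarrow> \<bar>V x\<bar> \<le> B"
    and meas: "D \<in> borel_measurable M" "V \<in> borel_measurable M" "\<And>t. L t \<in> borel_measurable M"
    and one: "\<And>t. 0 < t \<Longrightarrow> t < t\<^sub>0 \<Longrightarrow> (\<integral>\<^sup>+ x. ennreal (exp (L t x)) \<partial>M) = 1"
  shows "expectation D = 0" "expectation (\<lambda>x. (D x)\<^sup>2) = expectation V"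
proof -
  obtain C where C: "0 \<le> C"
    and L: "\<And>t x. t \<in> {0..t\<^sub>0} \<Longrightarrow> x \<in> X \<Longrightarrow> \<bar>L t x - (t * D x - t\<^sup>2 * V x / 2)\<bar> \<le> C * t ^ 3"
    using exp unfolding log_expansion_def by blast
  have B: "0 \<le> B"
  proof -
    have "\<exists>x. x \<in> X"
    proof (rule ccontr)
      assume "\<not> (\<exists>x. x \<in> X)"
      then have "AE x in M. False" using X by simp
      then show False by simp
    qed
    then show ?thesis using bdd(1) by (metis abs_ge_zero order_trans)
  qed
  have eD: "ess_bounded M D" and eV: "ess_bounded M V"
    using X bdd meas by (auto intro!: ess_boundedI[where B = B] elim!: eventually_mono)
  \<comment> \<open>\<open>K\<close> is chosen so that |L t x| \<le> t K for t \<le> 1, and t below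
    1 / (K + 1) then keeps the exponent in the range where the exponential is expanded.\<close>
  define K where "K = 2 * B + C"
  define t\<^sub>1 where "t\<^sub>1 = min t\<^sub>0 (min 1 (1 / (K + 1)))"
  have K: "0 \<le> K" using B C by (simp add: K_def)
  have t1: "0 < t\<^sub>1" using t0 K by (simp add: t\<^sub>1_def)
  \<comment> \<open>Three errors: the cubic remainder of the exponential, that of the logarithm, and
    the replacement of L^2 by (t D)^2.\<close>
  define C' where "C' = K ^ 3 + C + (B + C) * (K + B)"
  have main: "\<bar>exp (L t x) - 1 - (t * D x + t\<^sup>2 * ((D x)\<^sup>2 - V x) / 2)\<bar> \<le> C' * t ^ 3"
    and LK: "\<bar>L t x\<bar> \<le> 1"
    if t: "0 < t" "t < t\<^sub>1" and x: "x \<in> X" for t x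
  proof -
    have t1': "t \<le> 1" "t < t\<^sub>0" "t * (K + 1) < 1"
    proof -
      have "t\<^sub>1 \<le> t\<^sub>0" "t\<^sub>1 \<le> 1" "t\<^sub>1 \<le> 1 / (K + 1)"
        unfolding t\<^sub>1_def by (intro min.coboundedI1 min.coboundedI2 order_refl)+
      then show "t \<le> 1" "t < t\<^sub>0" "t * (K + 1) < 1"
        using t K less_divide_eq[of t 1 "K + 1"] by auto
    qed
    define e where "e = L t x - (t * D x - t\<^sup>2 * V x / 2)"
    have e: "\<bar>e\<bar> \<le> C * t ^ 3" using L[of t x] t t1' x by (simp add: e_def)
    have t32: "t ^ 3 \<le> t\<^sup>2" "t\<^sup>2 \<le> t" using t t1' power_decreasing[of 2 3 t] power_decreasing[of 1 2 t] by auto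
    have tV: "\<bar>t\<^sup>2 * V x / 2\<bar> \<le> t\<^sup>2 * B"
    proof -
      have "t\<^sup>2 * \<bar>V x\<bar> \<le> t\<^sup>2 * B" using bdd(2)[OF x] by (intro mult_left_mono) auto
      moreover have "0 \<le> t\<^sup>2 * \<bar>V x\<bar>" by simp
      moreover have "\<bar>t\<^sup>2 * V x / 2\<bar> = t\<^sup>2 * \<bar>V x\<bar> / 2" by (simp add: abs_mult)
      ultimately show ?thesis by linarith
    qed
    have tD: "\<bar>t * D x\<bar> \<le> t * B" using bdd(1)[OF x] t by (simp add: abs_mult)
    have Ct: "C * t ^ 3 \<le> C * t\<^sup>2" "C * t\<^sup>2 \<le> C * t" "t\<^sup>2 * B \<le> t * B"
      using t32 C B by (auto intro!: mult_left_mono mult_right_mono)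
    have L1: "\<bar>L t x\<bar> \<le> t * K"
    proof -
      have "\<bar>L t x\<bar> \<le> \<bar>t * D x\<bar> + \<bar>t\<^sup>2 * V x / 2\<bar> + \<bar>e\<bar>" unfolding e_def by linarith
      also have "\<dots> \<le> t * B + t * B + C * t" using tD tV e Ct by linarith
      finally show ?thesis by (simp add: K_def algebra_simps)
    qed
    have "t * K \<le> 1" using t1'(3) t by (simp add: algebra_simps)
    then show L2: "\<bar>L t x\<bar> \<le> 1" using L1 by linarith
    have e1: "\<bar>exp (L t x) - (1 + L t x + (L t x)\<^sup>2 / 2)\<bar> \<le> K ^ 3 * t ^ 3"
    proof -
      have "\<bar>L t x\<bar> ^ 3 \<le> (t * K) ^ 3" using L1 by (intro power_mono) auto
      then show ?thesis using exp_taylor[OF L2] by (simp add: power_mult_distrib mult.commute)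
    qed
    have e2: "\<bar>(L t x)\<^sup>2 - (t * D x)\<^sup>2\<bar> \<le> (B + C) * (K + B) * t ^ 3"
    proof -
      have "(L t x)\<^sup>2 - (t * D x)\<^sup>2 = (L t x - t * D x) * (L t x + t * D x)"
        by (simp add: power2_eq_square algebra_simps)
      then have "\<bar>(L t x)\<^sup>2 - (t * D x)\<^sup>2\<bar> = \<bar>L t x - t * D x\<bar> * \<bar>L t x + t * D x\<bar>" by (simp add: abs_mult)
      also have "\<dots> \<le> (t\<^sup>2 * (B + C)) * (t * (K + B))"
      proof (intro mult_mono)
        have "\<bar>L t x - t * D x\<bar> \<le> \<bar>e\<bar> + \<bar>t\<^sup>2 * V x / 2\<bar>" unfolding e_def by linarith
        also have "\<dots> \<le> t\<^sup>2 * (B + C)" using e tV Ct by (simp add: algebra_simps)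
        finally show "\<bar>L t x - t * D x\<bar> \<le> t\<^sup>2 * (B + C)" .
        show "\<bar>L t x + t * D x\<bar> \<le> t * (K + B)" using L1 tD by (simp add: distrib_left)
      qed (use B C t in auto)
      finally show ?thesis by (simp add: power2_eq_square power3_eq_cube mult_ac)
    qed
    have "exp (L t x) - 1 - (t * D x + t\<^sup>2 * ((D x)\<^sup>2 - V x) / 2) =
        (exp (L t x) - (1 + L t x + (L t x)\<^sup>2 / 2)) + e + ((L t x)\<^sup>2 - (t * D x)\<^sup>2) / 2"
      by (simp add: e_def field_simps power_mult_distrib)
    also have "\<bar>\<dots>\<bar> \<le> K ^ 3 * t ^ 3 + C * t ^ 3 + (B + C) * (K + B) * t ^ 3"
    proof -
      have "\<lbrakk>\<bar>p\<bar> \<le> P; \<bar>e\<bar> \<le> E; \<bar>z\<bar> \<le> Z\<rbrakk> \<Longrightarrow> \<bar>p + e + z / 2\<bar> \<le> P + E + Z" for p e z P E Z :: real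
        by linarith
      from this[OF e1 e e2] show ?thesis .
    qed
    finally show "\<bar>exp (L t x) - 1 - (t * D x + t\<^sup>2 * ((D x)\<^sup>2 - V x) / 2)\<bar> \<le> C' * t ^ 3"
      by (simp add: C'_def algebra_simps)
  qed
  have "\<bar>t * expectation D + t\<^sup>2 * ((expectation (\<lambda>x. (D x)\<^sup>2) - expectation V) / 2)\<bar> \<le> C' * t ^ 3"
    if t: "0 < t" "t < t\<^sub>1" for t
  proof -
    have eL: "ess_bounded M (\<lambda>x. exp (L t x))"
    proof (rule ess_boundedI[where B = "exp 1"])
      show "AE x in M. \<bar>exp (L t x)\<bar> \<le> exp 1" using X
        by eventually_elim (use LK[OF t] in \<open>simp add: abs_le_iff\<close>)
    qed (use meas(3) in simp)
    have "ennreal (expectation (\<lambda>x. exp (L t x))) = ennreal 1"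
      using one[of t] t by (subst nn_integral_eq_integral[symmetric]) (auto intro!: ess_bounded_integrable eL simp: t\<^sub>1_def)
    then have E1: "expectation (\<lambda>x. exp (L t x)) = 1"
      by (subst (asm) ennreal_inj) (auto intro!: integral_nonneg_AE)
    let ?r = "\<lambda>x. exp (L t x) - 1 - (t * D x + t\<^sup>2 / 2 * ((D x)\<^sup>2 - V x))"
    note ints = ess_bounded_integrable ess_bounded_intros eD eV eL
    have "expectation ?r = expectation (\<lambda>x. exp (L t x)) - 1 - (t * expectation D + t\<^sup>2 / 2 * (expectation (\<lambda>x. (D x)\<^sup>2) - expectation V))"
      by (simp add: ints Bochner_Integration.integral_diff Bochner_Integration.integral_add prob_space)
    then have "\<bar>t * expectation D + t\<^sup>2 * ((expectation (\<lambda>x. (D x)\<^sup>2) - expectation V) / 2)\<bar> = \<bar>expectation ?r\<bar>"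
      unfolding E1 by simp
    also have "\<dots> \<le> expectation (\<lambda>x. \<bar>?r x\<bar>)" by (rule integral_abs_bound)
    also have "\<dots> \<le> expectation (\<lambda>x. C' * t ^ 3)"
    proof (rule integral_mono_AE)
      show "AE x in M. \<bar>?r x\<bar> \<le> C' * t ^ 3" using X
        by eventually_elim (use main[OF t] in simp)
    qed (intro ints integrable_abs)+
    finally show ?thesis by (simp add: prob_space)
  qed
  from cubic_bound_imp_zero[OF t1 this]
  show "expectation D = 0" "expectation (\<lambda>x. (D x)\<^sup>2) = expectation V" by simp_all
qed

section \<open>Substitution on the unit cube\<close>

text \<open>The same map acts on each coordinate, so the Jacobian is diagonal and the formula
  follows from the one-dimensional substitution and Tonelli, by induction on the index set. The
  indicators keep the integration on the cube, the only place where the derivative is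
  controlled.\<close>

lemma nn_integral_unit_cube_substitution:
  fixes \<phi> \<phi>' :: "real \<Rightarrow> real" and g :: "('i \<Rightarrow> real) \<Rightarrow> real"
  assumes "finite I"
    and deriv: "\<And>x. x \<in> {0..1} \<Longrightarrow> (\<phi> has_real_derivative \<phi>' x) (at x)"
    and cont: "continuous_on {0..1} \<phi>'"
    and nonneg: "\<And>x. x \<in> {0..1} \<Longrightarrow> 0 \<le> \<phi>' x"
    and ends: "\<phi> 0 = 0" "\<phi> 1 = 1"
    and [measurable]: "\<phi> \<in> borel_measurable borel" "\<phi>' \<in> borel_measurable borel"
    and "g \<in> borel_measurable (PiM I (\<lambda>_. lborel))"
  shows "(\<integral>\<^sup>+ x. ennreal (g (\<lambda>i\<in>I. \<phi> (x i))) * (\<Prod>i\<in>I. ennreal (\<phi>' (x i)) * indicator {0..1} (x i)) \<partial>PiM I (\<lambda>_. lborel))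
    = (\<integral>\<^sup>+ x. ennreal (g x) * (\<Prod>i\<in>I. indicator {0..1} (x i)) \<partial>PiM I (\<lambda>_. lborel))"
  using assms(1,9)
proof (induction I arbitrary: g rule: finite_induct)
  case empty
  then show ?case by (simp add: PiM_empty nn_integral_count_space_finite)
next
  case (insert i I)
  interpret product_sigma_finite "\<lambda>_::'i. lborel :: real measure" by standard
  let ?P = "PiM I (\<lambda>_. lborel) :: ('i \<Rightarrow> real) measure" and ?Q = "PiM (insert i I) (\<lambda>_. lborel) :: ('i \<Rightarrow> real) measure"
  note fin = insert.hyps(1,2)
  have cm: "(\<lambda>u. ennreal (\<phi>' u) * indicator {0..1} u :: ennreal) \<in> borel_measurable lborel" by measurable
  have comp [measurable]: "(\<lambda>x. x j) \<in> borel_measurable (PiM J (\<lambda>_. lborel :: real measure))" if "j \<in> J" for j :: 'i and J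
    using measurable_component_singleton[OF that, of "\<lambda>_. lborel :: real measure"] by simp
  have g [measurable]: "g \<in> borel_measurable ?Q" by fact
  let ?w = "\<lambda>x. \<Prod>j\<in>I. ennreal (\<phi>' (x j)) * indicator {0..1} (x j) :: ennreal"
  let ?v = "\<lambda>x. \<Prod>j\<in>I. indicator {0..1} (x j) :: ennreal"
  let ?c = "\<lambda>u. ennreal (\<phi>' u) * indicator {0..1} u :: ennreal"
  have T [measurable]: "(\<lambda>x. \<lambda>j\<in>insert i I. \<phi> (x j)) \<in> ?Q \<rightarrow>\<^sub>M ?Q"
    by (intro measurable_restrict) simp
  have upd: "(\<lambda>x. x(i := \<phi> (x i))) \<in> ?Q \<rightarrow>\<^sub>M ?Q"
    by (intro measurable_fun_upd[where J = "insert i I"]) auto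
  have w [measurable]: "(\<lambda>x. \<Prod>j\<in>J. ennreal (\<phi>' (x j)) * indicator {0..1} (x j) :: ennreal) \<in> borel_measurable (PiM J (\<lambda>_. lborel))" for J :: "'i set"
    by measurable
  have v [measurable]: "(\<lambda>x. \<Prod>j\<in>J. indicator {0..1 :: real} (x j) :: ennreal) \<in> borel_measurable ?Q" if "J \<subseteq> insert i I" for J :: "'i set"
  proof (intro borel_measurable_prod_ennreal)
    fix j assume "j \<in> J"
    then have "j \<in> insert i I" using that by auto
    then show "(\<lambda>x. indicator {0..1} (x j) :: ennreal) \<in> borel_measurable (PiM (insert i I) (\<lambda>_. lborel :: real measure))"
      by measurable
  qed
  define F where "F x = ennreal (g (x(i := \<phi> (x i)))) * ?v x * ?c (x i)" for x
  have F: "F \<in> borel_measurable ?Q"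
    unfolding F_def using measurable_compose[OF upd g] v[of I] by measurable auto
  have prodc: "(\<Prod>j\<in>I. f ((x(i := u)) j)) = (\<Prod>j\<in>I. f (x j))" for f :: "real \<Rightarrow> ennreal" and x u
    using fin by (intro prod.cong) auto
  have gu: "(\<lambda>x. g (x(i := u))) \<in> borel_measurable ?P" for u
  proof -
    have "(\<lambda>x. x(i := u)) \<in> ?P \<rightarrow>\<^sub>M ?Q"
      by (intro measurable_fun_upd[where J = I]) auto
    from measurable_compose[OF this g] show ?thesis .
  qed
  have "(\<integral>\<^sup>+ x. ennreal (g (\<lambda>j\<in>insert i I. \<phi> (x j))) * (\<Prod>j\<in>insert i I. ?c (x j)) \<partial>?Q)
    = (\<integral>\<^sup>+ u. \<integral>\<^sup>+ x. ennreal (g (\<lambda>j\<in>insert i I. \<phi> ((x(i := u)) j))) * (\<Prod>j\<in>insert i I. ?c ((x(i := u)) j)) \<partial>?P \<partial>lborel)"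
    using measurable_compose[OF T g] w by (intro product_nn_integral_insert_rev[OF fin]) measurable
  also have "\<dots> = (\<integral>\<^sup>+ u. \<integral>\<^sup>+ x. ennreal (g ((\<lambda>j\<in>I. \<phi> (x j))(i := \<phi> u))) * ?w x * ?c u \<partial>?P \<partial>lborel)"
  proof (intro nn_integral_cong)
    fix u :: real and x :: "'i \<Rightarrow> real"
    have "(\<lambda>j\<in>insert i I. \<phi> ((x(i := u)) j)) = (\<lambda>j\<in>I. \<phi> (x j))(i := \<phi> u)"
      using fin by (auto simp: fun_eq_iff)
    moreover have "(\<Prod>j\<in>insert i I. ?c ((x(i := u)) j)) = ?w x * ?c u"
      unfolding prod.insert[OF fin] prodc[of ?c] by (simp add: mult.commute)
    ultimately show "ennreal (g (\<lambda>j\<in>insert i I. \<phi> ((x(i := u)) j))) * (\<Prod>j\<in>insert i I. ?c ((x(i := u)) j))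
      = ennreal (g ((\<lambda>j\<in>I. \<phi> (x j))(i := \<phi> u))) * ?w x * ?c u" by (simp add: mult.assoc)
  qed
  \<comment> \<open>With coordinate i frozen at \<phi> u, the induction hypothesis treats the
    others; the order of integration is then exchanged so that u comes last and can be substituted
    on its own.\<close>
  also have "\<dots> = (\<integral>\<^sup>+ u. \<integral>\<^sup>+ x. ennreal (g (x(i := \<phi> u))) * ?v x * ?c u \<partial>?P \<partial>lborel)"
  proof (rule nn_integral_cong)
    fix u :: real
    have TI: "(\<lambda>x. \<lambda>j\<in>I. \<phi> (x j)) \<in> ?P \<rightarrow>\<^sub>M ?P"
      by (intro measurable_restrict) simp
    note m1 = measurable_compose[OF TI gu[of "\<phi> u"]]
    have "(\<integral>\<^sup>+ x. ennreal (g ((\<lambda>j\<in>I. \<phi> (x j))(i := \<phi> u))) * ?w x * ?c u \<partial>?P)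
      = (\<integral>\<^sup>+ x. ennreal (g ((\<lambda>j\<in>I. \<phi> (x j))(i := \<phi> u))) * ?w x \<partial>?P) * ?c u"
      using m1 w[of I] by (intro nn_integral_multc) measurable
    also have "(\<integral>\<^sup>+ x. ennreal (g ((\<lambda>j\<in>I. \<phi> (x j))(i := \<phi> u))) * ?w x \<partial>?P)
      = (\<integral>\<^sup>+ x. ennreal (g (x(i := \<phi> u))) * ?v x \<partial>?P)"
      by (rule insert.IH[OF gu])
    also have "\<dots> * ?c u = (\<integral>\<^sup>+ x. ennreal (g (x(i := \<phi> u))) * ?v x * ?c u \<partial>?P)"
      using gu[of "\<phi> u"] by (intro nn_integral_multc[symmetric]) measurable
    finally show "(\<integral>\<^sup>+ x. ennreal (g ((\<lambda>j\<in>I. \<phi> (x j))(i := \<phi> u))) * ?w x * ?c u \<partial>?P)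
      = (\<integral>\<^sup>+ x. ennreal (g (x(i := \<phi> u))) * ?v x * ?c u \<partial>?P)" .
  qed
  also have "\<dots> = (\<integral>\<^sup>+ u. \<integral>\<^sup>+ x. F (x(i := u)) \<partial>?P \<partial>lborel)"
    unfolding F_def prodc[of "indicator {0..1}"] by (intro nn_integral_cong) simp
  also have "\<dots> = (\<integral>\<^sup>+ x. F x \<partial>?Q)"
    by (rule product_nn_integral_insert_rev[OF fin F, symmetric])
  also have "\<dots> = (\<integral>\<^sup>+ x. \<integral>\<^sup>+ u. F (x(i := u)) \<partial>lborel \<partial>?P)"
    by (rule product_nn_integral_insert[OF fin F])
  also have "\<dots> = (\<integral>\<^sup>+ x. \<integral>\<^sup>+ u. ennreal (g (x(i := u))) * (\<Prod>j\<in>insert i I. indicator {0..1} ((x(i := u)) j)) \<partial>lborel \<partial>?P)"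
  proof (rule nn_integral_cong)
    fix x :: "'i \<Rightarrow> real" assume x: "x \<in> space ?P"
    have gx [measurable]: "(\<lambda>u. g (x(i := u))) \<in> borel_measurable borel"
    proof -
      have "(\<lambda>u. x(i := u)) \<in> lborel \<rightarrow>\<^sub>M ?Q"
        using x by (intro measurable_fun_upd[where J = I]) auto
      from measurable_compose[OF this g] show ?thesis by simp
    qed
    have g\<phi>: "(\<lambda>u. g (x(i := \<phi> u))) \<in> borel_measurable lborel"
      using measurable_compose[OF _ gx, of \<phi> lborel] by simp
    have "(\<integral>\<^sup>+ u. F (x(i := u)) \<partial>lborel) = (\<integral>\<^sup>+ u. ?v x * (ennreal (g (x(i := \<phi> u))) * ?c u) \<partial>lborel)"
      unfolding F_def prodc[of "indicator {0..1}"] by (intro nn_integral_cong) (simp add: mult_ac)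
    also have "\<dots> = ?v x * (\<integral>\<^sup>+ u. ennreal (g (x(i := \<phi> u))) * ?c u \<partial>lborel)"
      by (intro nn_integral_cmult borel_measurable_times_ennreal measurable_compose[OF g\<phi> measurable_ennreal] cm)
    \<comment> \<open>\<open>max 0\<close> reproduces the truncation of negative values by
      \<open>ennreal\<close>, so that the real-valued substitution rule applies.\<close>
    also have "(\<integral>\<^sup>+ u. ennreal (g (x(i := \<phi> u))) * ?c u \<partial>lborel) =
        (\<integral>\<^sup>+ u. ennreal (\<bar>g (x(i := \<phi> u))\<bar> * 0 + max 0 (g (x(i := \<phi> u))) * \<phi>' u * indicator {0..1} u) \<partial>lborel)"
      using nonneg by (intro nn_integral_cong) (auto simp: indicator_def ennreal_mult'' max_def ennreal_neg)
    also have "\<dots> = (\<integral>\<^sup>+ u. ennreal (max 0 (g (x(i := u))) * indicator {\<phi> 0..\<phi> 1} u) \<partial>lborel)"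
      using nn_integral_substitution[of \<phi> 0 1 "\<lambda>u. max 0 (g (x(i := u)))" \<phi>', OF _ deriv cont nonneg]
      by (simp add: set_borel_measurable_def)
    also have "\<dots> = (\<integral>\<^sup>+ u. ennreal (g (x(i := u))) * indicator {0..1} u \<partial>lborel)"
      unfolding ends by (intro nn_integral_cong) (auto simp: indicator_def max_def ennreal_neg)
    also have "?v x * \<dots> = (\<integral>\<^sup>+ u. ?v x * (ennreal (g (x(i := u))) * indicator {0..1} u) \<partial>lborel)"
      using gx by (intro nn_integral_cmult[symmetric] borel_measurable_times_ennreal measurable_compose[OF _ measurable_ennreal]) auto
    also have "\<dots> = (\<integral>\<^sup>+ u. ennreal (g (x(i := u))) * (\<Prod>j\<in>insert i I. indicator {0..1} ((x(i := u)) j)) \<partial>lborel)"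
      unfolding prod.insert[OF fin] prodc[of "indicator {0..1}"] by (intro nn_integral_cong) (simp add: mult_ac)
    finally show "(\<integral>\<^sup>+ u. F (x(i := u)) \<partial>lborel) = \<dots>" .
  qed
  also have "\<dots> = (\<integral>\<^sup>+ x. ennreal (g x) * (\<Prod>j\<in>insert i I. indicator {0..1} (x j)) \<partial>?Q)"
    using v[of "insert i I"] by (intro product_nn_integral_insert[OF fin, symmetric]) measurable
  finally show ?case .
qed

section \<open>Loop equations of the Jacobi ensemble\<close>

text \<open>The divided difference of x^(k+1) (1 - x), written out as a polynomial. It therefore
  makes sense on the diagonal, where it is the derivative, and no division by x - y occurs in the
  loop equations.\<close>

definition div_diff :: "nat \<Rightarrow> real \<Rightarrow> real \<Rightarrow> real" where
  "div_diff k x y = (\<Sum>s\<le>k. x ^ s * y ^ (k - s)) - (\<Sum>s\<le>Suc k. x ^ s * y ^ (Suc k - s))"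

lemma div_diff_eq: "x ^ Suc k * (1 - x) - y ^ Suc k * (1 - y) = (x - y) * div_diff k x y"
proof -
  have *: "x ^ Suc m - y ^ Suc m = (x - y) * (\<Sum>s\<le>m. x ^ s * y ^ (m - s))" for m
    unfolding power_diff_sumr2[of x "Suc m" y] lessThan_Suc_atMost by (simp add: mult.commute)
  have "x ^ Suc k * (1 - x) - y ^ Suc k * (1 - y) = (x ^ Suc k - y ^ Suc k) - (x ^ Suc (Suc k) - y ^ Suc (Suc k))"
    by (simp add: algebra_simps)
  then show ?thesis unfolding * by (simp add: div_diff_def right_diff_distrib)
qed

lemma div_diff_diag: "div_diff k x x = real (k + 1) * x ^ k - real (k + 2) * x ^ (k + 1)"
proof -
  have *: "(\<Sum>s\<le>m. x ^ s * x ^ (m - s)) = real (m + 1) * x ^ m" for m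
  proof -
    have "(\<Sum>s\<le>m. x ^ s * x ^ (m - s)) = (\<Sum>s\<le>m. x ^ m)"
      by (intro sum.cong) (auto simp: power_add[symmetric])
    then show ?thesis by simp
  qed
  show ?thesis unfolding div_diff_def * by simp
qed

lemma div_diff_commute: "div_diff k x y = div_diff k y x"
proof -
  have *: "(\<Sum>s\<le>m. x ^ s * y ^ (m - s)) = (\<Sum>s\<le>m. y ^ s * x ^ (m - s))" for m
    by (subst sum.nat_diff_reindex[symmetric, of _ "Suc m", unfolded lessThan_Suc_atMost])
       (auto intro!: sum.cong simp: mult.commute)
  show ?thesis unfolding div_diff_def *[of k] *[of "Suc k"] ..
qed

text \<open>Both sums are nonnegative, so their difference is bounded by the larger of the two
  bounds. The factor max x y ^ k is kept because \<open>loop_V\<close> must later scale like the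
  2k-th power sum; a plain constant would lose the powers of a/b.\<close>

lemma div_diff_abs_le:
  assumes "0 \<le> x" "x \<le> 1" "0 \<le> y" "y \<le> 1"
  shows "\<bar>div_diff k x y\<bar> \<le> (real k + 2) * max x y ^ k"
proof -
  define M where "M = max x y"
  have M: "0 \<le> M" "M \<le> 1" "x \<le> M" "y \<le> M" using assms by (auto simp: M_def)
  have b: "(\<Sum>s\<le>m. x ^ s * y ^ (m - s)) \<le> real (m + 1) * M ^ m" "0 \<le> (\<Sum>s\<le>m. x ^ s * y ^ (m - s))" for m
  proof -
    have "(\<Sum>s\<le>m. x ^ s * y ^ (m - s)) \<le> (\<Sum>s\<le>m. M ^ s * M ^ (m - s))"
      using assms M by (intro sum_mono mult_mono power_mono) auto
    also have "\<dots> = (\<Sum>s\<le>m. M ^ m)" by (intro sum.cong) (auto simp: power_add[symmetric])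
    finally show "(\<Sum>s\<le>m. x ^ s * y ^ (m - s)) \<le> real (m + 1) * M ^ m" by simp
    show "0 \<le> (\<Sum>s\<le>m. x ^ s * y ^ (m - s))" using assms by (intro sum_nonneg) auto
  qed
  have "M ^ Suc k \<le> M ^ k" using M by (intro power_decreasing) auto
  then have "real (Suc k + 1) * M ^ Suc k \<le> (real k + 2) * M ^ k"
    by (intro mult_mono) (use M in auto)
  moreover have "real (k + 1) * M ^ k \<le> (real k + 2) * M ^ k" using M by (intro mult_right_mono) auto
  ultimately show ?thesis
    using b[of k] b[of "Suc k"] unfolding div_diff_def M_def[symmetric] by linarith
qed

lemma div_diff_bounded:
  assumes "0 \<le> x" "x \<le> 1" "0 \<le> y" "y \<le> 1"
  shows "\<bar>div_diff k x y\<bar> \<le> real k + 2"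
proof -
  have "max x y ^ k \<le> 1" using assms by (intro power_le_one) auto
  then have "(real k + 2) * max x y ^ k \<le> (real k + 2) * 1" by (intro mult_left_mono) auto
  from order_trans[OF div_diff_abs_le[OF assms, of k] this] show ?thesis by simp
qed

lemma div_diff_square_le:
  assumes "0 \<le> x" "x \<le> 1" "0 \<le> y" "y \<le> 1"
  shows "(div_diff k x y)\<^sup>2 \<le> (real k + 2)\<^sup>2 * (x ^ (2 * k) + y ^ (2 * k))"
proof -
  have "(div_diff k x y)\<^sup>2 \<le> ((real k + 2) * max x y ^ k)\<^sup>2"
    using power_mono[OF div_diff_abs_le[OF assms, of k], of 2] by simp
  also have "\<dots> = (real k + 2)\<^sup>2 * max x y ^ (2 * k)" by (simp add: power_mult_distrib power_mult[symmetric] mult.commute)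
  also have "\<dots> \<le> (real k + 2)\<^sup>2 * (x ^ (2 * k) + y ^ (2 * k))"
    using assms by (intro mult_left_mono) (auto simp: max_def)
  finally show ?thesis .
qed

text \<open>The vector field \<open>x\<^sup>k\<^sup>+\<^sup>1(1 - x)\<close> vanishes at both edges, so for small \<open>t\<close> its first-order flow
  \<open>\<phi>\<^sub>t(x) = x + t x\<^sup>k\<^sup>+\<^sup>1(1 - x)\<close> is a diffeomorphism of \<open>[0,1]\<close>; \<open>loop_log\<close> is the logarithm of the
  factor by which it multiplies the Jacobi density, and \<open>loop_D\<close>, \<open>loop_V\<close> are its Taylor coefficients.\<close>
definition loop_log :: "nat \<Rightarrow> real \<Rightarrow> real \<Rightarrow> real \<Rightarrow> nat \<Rightarrow> real \<Rightarrow> (nat \<Rightarrow> real) \<Rightarrow> real" where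
  "loop_log n \<beta> p q k t x = (\<Sum>j<n. \<Sum>i<j. \<beta> * ln (1 + t * div_diff k (x i) (x j))) +
     (\<Sum>i<n. p * ln (1 + t * (x i ^ k * (1 - x i))) + q * ln (1 + t * (- (x i ^ Suc k)))
        + 1 * ln (1 + t * div_diff k (x i) (x i)))"

definition loop_D :: "nat \<Rightarrow> real \<Rightarrow> real \<Rightarrow> real \<Rightarrow> nat \<Rightarrow> (nat \<Rightarrow> real) \<Rightarrow> real" where
  "loop_D n \<beta> p q k x = (\<Sum>j<n. \<Sum>i<j. \<beta> * div_diff k (x i) (x j)) +
     (\<Sum>i<n. p * (x i ^ k * (1 - x i)) + q * (- (x i ^ Suc k)) + 1 * div_diff k (x i) (x i))"

definition loop_V :: "nat \<Rightarrow> real \<Rightarrow> real \<Rightarrow> real \<Rightarrow> nat \<Rightarrow> (nat \<Rightarrow> real) \<Rightarrow> real" where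
  "loop_V n \<beta> p q k x = (\<Sum>j<n. \<Sum>i<j. \<beta> * (div_diff k (x i) (x j))\<^sup>2) +
     (\<Sum>i<n. p * (x i ^ k * (1 - x i))\<^sup>2 + q * (- (x i ^ Suc k))\<^sup>2 + 1 * (div_diff k (x i) (x i))\<^sup>2)"

definition open_cube :: "nat \<Rightarrow> (nat \<Rightarrow> real) set" where
  "open_cube n = {x. \<forall>i<n. 0 < x i \<and> x i < 1}"

text \<open>Every logarithm has the form ln (1 + t c) with |c| \<le> k + 2, and the range of t keeps
  t |c| \<le> 1/2.\<close>

lemma loop_log_expansion:
  "log_expansion (1 / (2 * (real k + 2))) (open_cube n) (loop_log n \<beta> p q k) (loop_D n \<beta> p q k) (loop_V n \<beta> p q k)"
  unfolding loop_log_def[abs_def] loop_D_def[abs_def] loop_V_def[abs_def]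
proof (intro log_expansion_add log_expansion_sum log_expansion_ln[where K = "real k + 2"])
  fix x i j assume x: "x \<in> open_cube n"
  show "\<bar>div_diff k (x i) (x j)\<bar> \<le> real k + 2" if "j \<in> {..<n}" "i \<in> {..<j}"
    using x that by (intro div_diff_bounded) (auto simp: open_cube_def less_imp_le)
  assume "i \<in> {..<n}"
  then have xi: "0 \<le> x i" "x i \<le> 1" using x by (auto simp: open_cube_def less_imp_le)
  then show "\<bar>div_diff k (x i) (x i)\<bar> \<le> real k + 2" by (intro div_diff_bounded)
  have *: "x i ^ m \<le> 1" "0 \<le> x i ^ m" for m using xi by (auto intro: power_le_one)
  have "\<bar>x i ^ k * (1 - x i)\<bar> \<le> 1 * 1" using xi * unfolding abs_mult by (intro mult_mono) auto
  then show "\<bar>x i ^ k * (1 - x i)\<bar> \<le> real k + 2" by simp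
  show "\<bar>- (x i ^ Suc k)\<bar> \<le> real k + 2" using *[of "Suc k"] by simp
qed (auto simp: field_simps)

text \<open>Each factor of the density is multiplied by an explicit positive quantity: \<phi>(x) = x
  (1 + t x^k (1 - x)), 1 - \<phi>(x) = (1 - x) (1 - t x^(k+1)), and differences are multiplied by 1
  + t times the divided difference. The identity is exact, also where coordinates coincide.\<close>

lemma jacobi_unnorm_flow:
  fixes a b \<beta> :: real
  assumes x: "x \<in> open_cube n" and t: "0 < t" "t < 1 / (2 * (real k + 2))"
  defines "p \<equiv> a - (\<beta> / 2 * (real n - 1) + 1)" and "q \<equiv> b - (\<beta> / 2 * (real n - 1) + 1)"
  shows "jacobi_unnorm n \<beta> a b (\<lambda>i\<in>{..<n}. x i + t * (x i ^ Suc k * (1 - x i))) * (\<Prod>i<n. 1 + t * div_diff k (x i) (x i))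
    = jacobi_unnorm n \<beta> a b x * exp (loop_log n \<beta> p q k t x)"
proof -
  define \<phi> where "\<phi> = (\<lambda>u. u + t * (u ^ Suc k * (1 - u)) :: real)"
  have xi: "0 < x i" "x i < 1" if "i < n" for i using x that by (auto simp: open_cube_def)
  have small: "0 < 1 + t * c" if "\<bar>c\<bar> \<le> real k + 2" for c
  proof -
    have "\<bar>t * c\<bar> \<le> t * (real k + 2)" using that t by (simp add: abs_mult)
    also have "\<dots> < 1" using t by (simp add: field_simps)
    finally show ?thesis by linarith
  qed
  have pos1: "0 < 1 + t * div_diff k (x i) (x j)" if "i < n" "j < n" for i j
    using xi[OF that(1)] xi[OF that(2)] by (intro small div_diff_bounded) auto
  have pw: "x i ^ m \<le> 1" "0 \<le> x i ^ m" if "i < n" for i m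
    using xi[OF that] by (auto intro: power_le_one)
  have pos2: "0 < 1 + t * (x i ^ k * (1 - x i))" if "i < n" for i
    using xi[OF that] t by (intro add_pos_nonneg) auto
  have pos3: "0 < 1 + t * (- (x i ^ Suc k))" if "i < n" for i
    using pw[OF that, of "Suc k"] by (intro small) auto
  have \<phi>1: "\<phi> (x i) = x i * (1 + t * (x i ^ k * (1 - x i)))" for i
    by (simp add: \<phi>_def algebra_simps)
  have \<phi>2: "1 - \<phi> (x i) = (1 - x i) * (1 + t * (- (x i ^ Suc k)))" for i
    by (simp add: \<phi>_def algebra_simps)
  have \<phi>3: "\<phi> (x i) - \<phi> (x j) = (x i - x j) * (1 + t * div_diff k (x i) (x j))" for i j
  proof -
    have "\<phi> (x i) - \<phi> (x j) = (x i - x j) + t * (x i ^ Suc k * (1 - x i) - x j ^ Suc k * (1 - x j))"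
      by (simp add: \<phi>_def algebra_simps)
    then show ?thesis unfolding div_diff_eq by (simp add: algebra_simps)
  qed
  have in01: "0 < \<phi> (x i) \<and> \<phi> (x i) < 1" if "i < n" for i
  proof -
    have "0 < \<phi> (x i)" unfolding \<phi>1 using xi[OF that] pos2[OF that] by simp
    moreover have "0 < 1 - \<phi> (x i)" unfolding \<phi>2 using xi[OF that] pos3[OF that] by simp
    ultimately show ?thesis by simp
  qed
  have e1: "\<bar>\<phi> (x i) - \<phi> (x j)\<bar> powr \<beta> = \<bar>x i - x j\<bar> powr \<beta> * exp (\<beta> * ln (1 + t * div_diff k (x i) (x j)))"
    if "i < n" "j < n" for i j
    using pos1[OF that] unfolding \<phi>3 abs_mult by (simp add: powr_mult) (simp add: powr_def)
  have e2: "\<phi> (x i) powr p = x i powr p * exp (p * ln (1 + t * (x i ^ k * (1 - x i))))" if "i < n" for i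
    unfolding \<phi>1 using pos2[OF that] xi[OF that] by (simp add: powr_mult) (simp add: powr_def)
  have e3: "(1 - \<phi> (x i)) powr q = (1 - x i) powr q * exp (q * ln (1 + t * (- (x i ^ Suc k))))" if "i < n" for i
    unfolding \<phi>2 using pos3[OF that] xi[OF that] by (simp add: powr_mult) (simp add: powr_def)
  have e4: "1 + t * div_diff k (x i) (x i) = exp (1 * ln (1 + t * div_diff k (x i) (x i)))" if "i < n" for i
    using pos1[OF that that] by simp
  have A: "(\<Prod>j<n. \<Prod>i<j. \<bar>\<phi> (x i) - \<phi> (x j)\<bar> powr \<beta>) =
      (\<Prod>j<n. \<Prod>i<j. \<bar>x i - x j\<bar> powr \<beta>) * exp (\<Sum>j<n. \<Sum>i<j. \<beta> * ln (1 + t * div_diff k (x i) (x j)))"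
    by (simp add: exp_sum prod.distrib[symmetric] e1)
  have B: "(\<Prod>i<n. \<phi> (x i) powr p * (1 - \<phi> (x i)) powr q) * (\<Prod>i<n. 1 + t * div_diff k (x i) (x i)) =
      (\<Prod>i<n. x i powr p * (1 - x i) powr q) *
      exp (\<Sum>i<n. p * ln (1 + t * (x i ^ k * (1 - x i))) + q * ln (1 + t * (- (x i ^ Suc k)))
        + 1 * ln (1 + t * div_diff k (x i) (x i)))"
    unfolding exp_sum[OF finite_lessThan] prod.distrib[symmetric]
  proof (intro prod.cong refl)
    fix i assume "i \<in> {..<n}"
    then have i: "i < n" by simp
    show "\<phi> (x i) powr p * (1 - \<phi> (x i)) powr q * (1 + t * div_diff k (x i) (x i)) =
         x i powr p * (1 - x i) powr q *
         exp (p * ln (1 + t * (x i ^ k * (1 - x i))) + q * ln (1 + t * (- (x i ^ Suc k)))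
           + 1 * ln (1 + t * div_diff k (x i) (x i)))"
      unfolding exp_add e2[OF i] e3[OF i] e4[OF i, symmetric] by simp
  qed
  have "jacobi_unnorm n \<beta> a b (\<lambda>i\<in>{..<n}. \<phi> (x i)) =
      (\<Prod>j<n. \<Prod>i<j. \<bar>\<phi> (x i) - \<phi> (x j)\<bar> powr \<beta>) * (\<Prod>i<n. \<phi> (x i) powr p * (1 - \<phi> (x i)) powr q)"
    using in01 unfolding jacobi_unnorm_def p_def q_def by (auto intro!: arg_cong2[where f = "(*)"] prod.cong)
  moreover have "jacobi_unnorm n \<beta> a b x =
      (\<Prod>j<n. \<Prod>i<j. \<bar>x i - x j\<bar> powr \<beta>) * (\<Prod>i<n. x i powr p * (1 - x i) powr q)"
    using xi unfolding jacobi_unnorm_def p_def q_def by simp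
  ultimately show ?thesis
    using A B unfolding loop_log_def exp_add \<phi>_def by (simp add: mult_ac)
qed

lemma div_diff_measurable [measurable]:
  assumes [measurable]: "f \<in> borel_measurable M" "g \<in> borel_measurable M"
  shows "(\<lambda>x. div_diff k (f x) (g x)) \<in> borel_measurable M"
  unfolding div_diff_def by measurable

lemma jacobi_unnorm_nonneg: "0 \<le> jacobi_unnorm n \<beta> a b x"
  by (auto simp: jacobi_unnorm_def intro!: mult_nonneg_nonneg prod_nonneg)

lemma jacobi_unnorm_outside: "x \<notin> open_cube n \<Longrightarrow> jacobi_unnorm n \<beta> a b x = 0"
  by (auto simp: jacobi_unnorm_def open_cube_def)

lemma loop_measurable:
  shows "loop_D n \<beta> p q k \<in> borel_measurable (coords n)" (is ?D)
    and "loop_V n \<beta> p q k \<in> borel_measurable (coords n)" (is ?V)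
    and "loop_log n \<beta> p q k t \<in> borel_measurable (coords n)" (is ?L)
    and "jacobi_unnorm n \<beta> a b \<in> borel_measurable (coords n)" (is ?J)
proof -
  let ?M = "coords n"
  have c: "(\<lambda>x. x i) \<in> borel_measurable ?M" if "i \<in> {..<n}" for i
    using that by (rule PiM_component_measurable)
  have c': "(\<lambda>x. x i) \<in> borel_measurable ?M" if "j \<in> {..<n}" "i \<in> {..<j}" for i j
    using that by (intro PiM_component_measurable) auto
  note m = borel_measurable_add borel_measurable_sum borel_measurable_times borel_measurable_const
    borel_measurable_ln borel_measurable_power borel_measurable_diff borel_measurable_uminus div_diff_measurable
    borel_measurable_prod powr_real_measurable borel_measurable_abs
  show ?D unfolding loop_D_def[abs_def] by (intro m) (assumption | rule c c')+
  show ?V unfolding loop_V_def[abs_def] by (intro m) (assumption | rule c c')+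
  show ?L unfolding loop_log_def[abs_def] by (intro m) (assumption | rule c c')+
  have "(\<lambda>x. (\<Prod>j<n. \<Prod>i<j. \<bar>x i - x j\<bar> powr \<beta>) *
        (\<Prod>i<n. x i powr (a - (\<beta> / 2 * (real n - 1) + 1)) *
                 (1 - x i) powr (b - (\<beta> / 2 * (real n - 1) + 1)))) \<in> borel_measurable ?M"
    by (intro m) (assumption | rule c c')+
  moreover have "{x \<in> space ?M. \<forall>i\<in>{..<n}. 0 < x i \<and> x i < 1} \<in> sets ?M"
  proof -
    note [measurable] = c
    show ?thesis by measurable
  qed
  ultimately have "(\<lambda>x. if \<forall>i\<in>{..<n}. 0 < x i \<and> x i < 1 then (\<Prod>j<n. \<Prod>i<j. \<bar>x i - x j\<bar> powr \<beta>) *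
        (\<Prod>i<n. x i powr (a - (\<beta> / 2 * (real n - 1) + 1)) *
                 (1 - x i) powr (b - (\<beta> / 2 * (real n - 1) + 1))) else 0) \<in> borel_measurable ?M"
    by (intro measurable_If) auto
  then show ?J unfolding jacobi_unnorm_def[abs_def] by (simp add: Ball_def)
qed

text \<open>This is the mean-one property before normalisation. In extended nonnegative integrals it
  can be stated before the normalising integral is known to be finite.\<close>

lemma nn_integral_jacobi_flow:
  fixes a b \<beta> :: real and n k :: nat
  assumes t: "0 < t" "t < 1 / (2 * (real k + 2))"
  defines "p \<equiv> a - (\<beta> / 2 * (real n - 1) + 1)" and "q \<equiv> b - (\<beta> / 2 * (real n - 1) + 1)"
  shows "(\<integral>\<^sup>+ x. ennreal (jacobi_unnorm n \<beta> a b x * exp (loop_log n \<beta> p q k t x)) \<partial>coords n)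
    = (\<integral>\<^sup>+ x. ennreal (jacobi_unnorm n \<beta> a b x) \<partial>coords n)"
proof -
  define \<phi> where "\<phi> = (\<lambda>u. u + t * (u ^ Suc k * (1 - u)) :: real)"
  define \<phi>' where "\<phi>' = (\<lambda>u. 1 + t * div_diff k u u)"
  let ?M = "coords n"
  let ?\<rho> = "jacobi_unnorm n \<beta> a b"
  have nn: "0 \<le> \<phi>' u" if "u \<in> {0..1}" for u
  proof -
    have "t * \<bar>div_diff k u u\<bar> \<le> t * (real k + 2)"
      using that t by (intro mult_left_mono div_diff_bounded) auto
    also have "\<dots> < 1" using t by (simp add: field_simps)
    finally have "\<bar>t * div_diff k u u\<bar> < 1" using t by (simp add: abs_mult)
    then show ?thesis unfolding \<phi>'_def by linarith
  qed
  have sub: "(\<integral>\<^sup>+ x. ennreal (?\<rho> (\<lambda>i\<in>{..<n}. \<phi> (x i))) * (\<Prod>i<n. ennreal (\<phi>' (x i)) * indicator {0..1} (x i)) \<partial>?M)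
    = (\<integral>\<^sup>+ x. ennreal (?\<rho> x) * (\<Prod>i<n. indicator {0..1} (x i)) \<partial>?M)"
  proof (rule nn_integral_unit_cube_substitution[OF finite_lessThan _ _ nn])
    show "(\<phi> has_real_derivative \<phi>' u) (at u)" for u
    proof -
      have d: "((\<lambda>u. u ^ Suc m) has_real_derivative real (Suc m) * u ^ m) (at u)" for m
        using DERIV_pow[of "Suc m" u] by simp
      have "\<phi> = (\<lambda>u. u + t * (u ^ Suc k - u ^ Suc (Suc k)))"
        by (simp add: \<phi>_def fun_eq_iff algebra_simps)
      moreover have "((\<lambda>u. u + t * (u ^ Suc k - u ^ Suc (Suc k))) has_real_derivative
          1 + t * (real (Suc k) * u ^ k - real (Suc (Suc k)) * u ^ Suc k)) (at u)"
        by (intro DERIV_add DERIV_ident DERIV_cmult DERIV_diff d)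
      ultimately show ?thesis by (simp add: \<phi>'_def div_diff_diag)
    qed
    show "continuous_on {0..1} \<phi>'" unfolding \<phi>'_def div_diff_diag by (intro continuous_intros)
    show "\<phi> \<in> borel_measurable borel" unfolding \<phi>_def by measurable
    show "\<phi>' \<in> borel_measurable borel" unfolding \<phi>'_def by measurable
    show "?\<rho> \<in> borel_measurable ?M" by (rule loop_measurable)
  qed (simp_all add: \<phi>_def)
  have L: "ennreal (?\<rho> (\<lambda>i\<in>{..<n}. \<phi> (x i))) * (\<Prod>i<n. ennreal (\<phi>' (x i)) * indicator {0..1} (x i))
      = ennreal (?\<rho> x * exp (loop_log n \<beta> p q k t x))" for x
  proof (cases "x \<in> open_cube n")
    case True
    then have "(\<Prod>i<n. ennreal (\<phi>' (x i)) * indicator {0..1} (x i)) = (\<Prod>i<n. ennreal (\<phi>' (x i)))"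
      by (intro prod.cong) (auto simp: open_cube_def less_imp_le)
    also have "\<dots> = ennreal (\<Prod>i<n. \<phi>' (x i))"
      using True by (intro prod_ennreal nn) (auto simp: open_cube_def less_imp_le)
    finally have "ennreal (?\<rho> (\<lambda>i\<in>{..<n}. \<phi> (x i))) * (\<Prod>i<n. ennreal (\<phi>' (x i)) * indicator {0..1} (x i))
        = ennreal (?\<rho> (\<lambda>i\<in>{..<n}. \<phi> (x i)) * (\<Prod>i<n. \<phi>' (x i)))"
      by (simp add: ennreal_mult' jacobi_unnorm_nonneg)
    then show ?thesis
      using jacobi_unnorm_flow[OF True t, of \<beta> a b] unfolding \<phi>_def \<phi>'_def p_def q_def by simp
  next
    case False
    then obtain i where i: "i < n" "\<not> (0 < x i \<and> x i < 1)" by (auto simp: open_cube_def)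
    have "?\<rho> (\<lambda>i\<in>{..<n}. \<phi> (x i)) = 0 \<or> indicator {0..1} (x i) = (0::ennreal)"
    \<comment> \<open>The endpoints 0 and 1 are fixed by \<phi>, so a point on the boundary of the
      cube is sent to the boundary, where the density vanishes.\<close>
    proof (cases "x i \<in> {0..1}")
      case True
      then have "x i = 0 \<or> x i = 1" using i by auto
      then have "\<phi> (x i) = 0 \<or> \<phi> (x i) = 1" by (auto simp: \<phi>_def)
      then have "(\<lambda>i\<in>{..<n}. \<phi> (x i)) \<notin> open_cube n" using i(1) by (force simp: open_cube_def)
      then show ?thesis by (simp add: jacobi_unnorm_outside)
    qed simp
    then have "ennreal (?\<rho> (\<lambda>i\<in>{..<n}. \<phi> (x i))) * (\<Prod>i<n. ennreal (\<phi>' (x i)) * indicator {0..1} (x i)) = 0"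
      using i(1) by (auto intro!: prod_zero bexI[of _ i])
    then show ?thesis using False by (simp add: jacobi_unnorm_outside)
  qed
  have R: "ennreal (?\<rho> x) * (\<Prod>i<n. indicator {0..1} (x i)) = ennreal (?\<rho> x)" for x
  proof (cases "x \<in> open_cube n")
    case True
    then have "(\<Prod>i<n. indicator {0..1} (x i)) = (1 :: ennreal)"
      by (intro prod.neutral) (auto simp: open_cube_def less_imp_le)
    then show ?thesis by simp
  qed (simp add: jacobi_unnorm_outside)
  show ?thesis using sub unfolding L R .
qed

lemma sets_jacobi_ensemble [simp, measurable_cong]:
  "sets (jacobi_ensemble n \<beta> a b) = sets (coords n)"
  by (simp add: jacobi_ensemble_def)

lemma nn_integral_jacobi_ensemble:
  fixes f :: "(nat \<Rightarrow> real) \<Rightarrow> ennreal"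
  assumes "f \<in> borel_measurable (coords n)"
  shows "(\<integral>\<^sup>+ x. f x \<partial>jacobi_ensemble n \<beta> a b) =
    (\<integral>\<^sup>+ x. ennreal (jacobi_unnorm n \<beta> a b x) * f x \<partial>coords n) /
    (\<integral>\<^sup>+ x. ennreal (jacobi_unnorm n \<beta> a b x) \<partial>coords n)"
proof -
  note J = measurable_compose[OF loop_measurable(4) measurable_ennreal]
  let ?M = "coords n"
  let ?Z = "(\<integral>\<^sup>+ x. ennreal (jacobi_unnorm n \<beta> a b x) \<partial>?M)"
  have "(\<integral>\<^sup>+ x. f x \<partial>jacobi_ensemble n \<beta> a b) = (\<integral>\<^sup>+ x. ennreal (jacobi_unnorm n \<beta> a b x) / ?Z * f x \<partial>?M)"
    unfolding jacobi_ensemble_def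
    by (rule nn_integral_density[OF borel_measurable_divide_ennreal[OF J borel_measurable_const] assms])
  also have "\<dots> = (\<integral>\<^sup>+ x. ennreal (jacobi_unnorm n \<beta> a b x) * f x / ?Z \<partial>?M)"
    by (intro nn_integral_cong) (simp add: divide_ennreal_def mult_ac)
  also have "\<dots> = (\<integral>\<^sup>+ x. ennreal (jacobi_unnorm n \<beta> a b x) * f x \<partial>?M) / ?Z"
    by (intro nn_integral_divide borel_measurable_times_ennreal J assms)
  finally show ?thesis .
qed

lemma AE_jacobi_cube: "AE x in jacobi_ensemble n \<beta> a b. x \<in> open_cube n"
proof -
  note J = measurable_compose[OF loop_measurable(4) measurable_ennreal]
  show ?thesis
    unfolding jacobi_ensemble_def AE_density[OF borel_measurable_divide_ennreal[OF J borel_measurable_const]]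
  proof (intro AE_I2 impI)
    fix x :: "nat \<Rightarrow> real"
    assume *: "0 < ennreal (jacobi_unnorm n \<beta> a b x) / (\<integral>\<^sup>+ y. ennreal (jacobi_unnorm n \<beta> a b y) \<partial>coords n)"
    show "x \<in> open_cube n"
    proof (rule ccontr)
      assume "x \<notin> open_cube n"
      from * show False unfolding jacobi_unnorm_outside[OF \<open>x \<notin> open_cube n\<close>] by simp
    qed
  qed
qed

text \<open>The total mass is Z / Z for the normalising integral Z. This is 1 for 0 < Z <
  \<infinity>, and 0 in both degenerate cases by the conventions of \<open>ennreal\<close>.\<close>

lemma emeasure_jacobi_ensemble_cases: "emeasure (jacobi_ensemble n \<beta> a b) (space (jacobi_ensemble n \<beta> a b)) \<in> {0, 1}"
proof -
  let ?M = "coords n"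
  let ?Z = "(\<integral>\<^sup>+ x. ennreal (jacobi_unnorm n \<beta> a b x) \<partial>?M)"
  have "emeasure (jacobi_ensemble n \<beta> a b) (space (jacobi_ensemble n \<beta> a b)) = ?Z / ?Z"
    using nn_integral_jacobi_ensemble[of "\<lambda>_. 1" n \<beta> a b] by simp
  also have "\<dots> \<in> {0, 1}"
    by (cases "?Z = 0 \<or> ?Z = \<top>") (auto simp: less_top ennreal_divide_self)
  finally show ?thesis .
qed

text \<open>The first identity is the loop (Schwinger-Dyson) equation; the second gives its
  fluctuations exactly. Being a probability law forces Z / Z = 1, and this turns the unnormalised
  flow identity into the mean-one property.\<close>

lemma jacobi_loop_equations:
  fixes a b \<beta> :: real and n k :: nat
  assumes P: "prob_space (jacobi_ensemble n \<beta> a b)"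
  defines "p \<equiv> a - (\<beta> / 2 * (real n - 1) + 1)" and "q \<equiv> b - (\<beta> / 2 * (real n - 1) + 1)"
  shows "(\<integral>x. loop_D n \<beta> p q k x \<partial>jacobi_ensemble n \<beta> a b) = 0"
    and "(\<integral>x. (loop_D n \<beta> p q k x)\<^sup>2 \<partial>jacobi_ensemble n \<beta> a b) = (\<integral>x. loop_V n \<beta> p q k x \<partial>jacobi_ensemble n \<beta> a b)"
proof -
  interpret prob_space "jacobi_ensemble n \<beta> a b" by fact
  let ?M = "coords n"
  let ?Z = "(\<integral>\<^sup>+ x. ennreal (jacobi_unnorm n \<beta> a b x) \<partial>?M)"
  have meas: "borel_measurable (jacobi_ensemble n \<beta> a b) = borel_measurable ?M"
    by (rule measurable_cong_sets) simp_all
  have ZZ: "?Z / ?Z = 1"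
    using nn_integral_jacobi_ensemble[of "\<lambda>_. 1" n \<beta> a b] emeasure_space_1 by simp
  have one: "(\<integral>\<^sup>+ x. ennreal (exp (loop_log n \<beta> p q k t x)) \<partial>jacobi_ensemble n \<beta> a b) = 1"
    if t: "0 < t" "t < 1 / (2 * (real k + 2))" for t
  proof -
    have m: "(\<lambda>x. ennreal (exp (loop_log n \<beta> p q k t x))) \<in> borel_measurable ?M"
      using loop_measurable(3) by measurable
    show ?thesis
      unfolding nn_integral_jacobi_ensemble[OF m]
      using nn_integral_jacobi_flow[OF t, of n \<beta> a b] ZZ unfolding p_def q_def
      by (simp add: ennreal_mult' jacobi_unnorm_nonneg)
  qed
  \<comment> \<open>A crude bound that grows with n; at this point n is fixed and only finiteness
    matters.\<close>
  define B where "B = (\<Sum>j<n. \<Sum>i<j. \<bar>\<beta>\<bar> * (real k + 2)\<^sup>2) + (\<Sum>i<n. \<bar>p\<bar> + \<bar>q\<bar> + (real k + 2)\<^sup>2)"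
  have bD: "\<bar>loop_D n \<beta> p q k x\<bar> \<le> B" and bV: "\<bar>loop_V n \<beta> p q k x\<bar> \<le> B" if x: "x \<in> open_cube n" for x
  proof -
    have xi: "0 \<le> x i" "x i \<le> 1" if "i < n" for i using x that by (auto simp: open_cube_def less_imp_le)
    have pw: "0 \<le> x i ^ m" "x i ^ m \<le> 1" if "i < n" for i m using xi[OF that] by (auto intro: power_le_one)
    have d1: "\<bar>div_diff k (x i) (x j)\<bar> \<le> real k + 2" if "i < n" "j < n" for i j
      using xi[OF that(1)] xi[OF that(2)] by (intro div_diff_bounded)
    have kk: "real k + 2 \<le> (real k + 2)\<^sup>2" by (simp add: power2_eq_square)
    have d2: "\<bar>(div_diff k (x i) (x j))\<^sup>2\<bar> \<le> (real k + 2)\<^sup>2" if "i < n" "j < n" for i j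
      using power_mono[OF d1[OF that], of 2] by simp
    have d3: "\<bar>div_diff k (x i) (x j)\<bar> \<le> (real k + 2)\<^sup>2" if "i < n" "j < n" for i j
      using d1[OF that] kk by linarith
    have u: "\<bar>x i ^ k * (1 - x i)\<bar> \<le> 1" if "i < n" for i
      using xi[OF that] pw[OF that, of k] unfolding abs_mult by (intro mult_le_one) auto
    have u2: "\<bar>(x i ^ k * (1 - x i))\<^sup>2\<bar> \<le> 1" if "i < n" for i
      using power_mono[OF u[OF that], of 2] by simp
    have w: "\<bar>- (x i ^ Suc k)\<bar> \<le> 1" "\<bar>(- (x i ^ Suc k))\<^sup>2\<bar> \<le> 1" if "i < n" for i
    proof -
      show *: "\<bar>- (x i ^ Suc k)\<bar> \<le> 1" using pw[OF that, of "Suc k"] by simp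
      show "\<bar>(- (x i ^ Suc k))\<^sup>2\<bar> \<le> 1" using power_mono[OF *, of 2] by simp
    qed
    have cmul: "\<bar>c * y\<bar> \<le> \<bar>c\<bar>" if "\<bar>y\<bar> \<le> 1" for c y :: real
      using mult_left_mono[OF that, of "\<bar>c\<bar>"] by (simp add: abs_mult)
    have tri: "\<lbrakk>\<bar>y1\<bar> \<le> z1; \<bar>y2\<bar> \<le> z2; \<bar>y3\<bar> \<le> z3\<rbrakk> \<Longrightarrow> \<bar>y1 + y2 + 1 * y3\<bar> \<le> z1 + z2 + z3" for y1 y2 y3 z1 z2 z3 :: real
      by linarith
    show "\<bar>loop_D n \<beta> p q k x\<bar> \<le> B"
      unfolding loop_D_def B_def
      apply (rule order_trans[OF abs_triangle_ineq])
      apply (intro add_mono order_trans[OF sum_abs] sum_mono)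
      subgoal for j i using d3 by (simp add: abs_mult mult_left_mono)
      subgoal for i using cmul[OF u, of i p] cmul[OF w(1), of i q] d3[of i i] by (intro tri) auto
      done
    show "\<bar>loop_V n \<beta> p q k x\<bar> \<le> B"
      unfolding loop_V_def B_def
      apply (rule order_trans[OF abs_triangle_ineq])
      apply (intro add_mono order_trans[OF sum_abs] sum_mono)
      subgoal for j i using d2 by (simp add: abs_mult mult_left_mono)
      subgoal for i using cmul[OF u2, of i p] cmul[OF w(2), of i q] d2[of i i] by (intro tri) auto
      done
  qed
  note res = log_expansion_moments[OF loop_log_expansion[of k n \<beta> p q] _ AE_jacobi_cube bD bV _ _ _ one,
      unfolded meas, OF _ _ _ loop_measurable(1,2,3)]
  show "(\<integral>x. loop_D n \<beta> p q k x \<partial>jacobi_ensemble n \<beta> a b) = 0"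
    "(\<integral>x. (loop_D n \<beta> p q k x)\<^sup>2 \<partial>jacobi_ensemble n \<beta> a b) = (\<integral>x. loop_V n \<beta> p q k x \<partial>jacobi_ensemble n \<beta> a b)"
    by (rule res; simp)+
qed

section \<open>Rescaled empirical moments\<close>

lemma sum_pairs_symmetric:
  fixes g :: "nat \<Rightarrow> nat \<Rightarrow> real"
  assumes "\<And>i j. g i j = g j i"
  shows "(\<Sum>j<n. \<Sum>i<j. g i j) = ((\<Sum>i<n. \<Sum>j<n. g i j) - (\<Sum>i<n. g i i)) / 2"
proof (induction n)
  case (Suc n)
  have "(\<Sum>i<Suc n. \<Sum>j<Suc n. g i j) = (\<Sum>i<n. \<Sum>j<n. g i j) + (\<Sum>i<n. g i n) + (\<Sum>j<n. g n j) + g n n"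
    by (simp add: sum.distrib)
  also have "(\<Sum>j<n. g n j) = (\<Sum>i<n. g i n)" by (simp add: assms[of n])
  finally show ?case using Suc by simp
qed simp

definition emp_moment :: "nat \<Rightarrow> real \<Rightarrow> nat \<Rightarrow> (nat \<Rightarrow> real) \<Rightarrow> real" where
  "emp_moment n c k x = (\<Sum>i<n. (c * x i) ^ k) / n"

lemma emp_moment_0: "1 \<le> n \<Longrightarrow> emp_moment n c 0 x = 1"
  by (simp add: emp_moment_def)

lemma emp_moment_nonneg: "0 \<le> c \<Longrightarrow> x \<in> open_cube n \<Longrightarrow> 0 \<le> emp_moment n c k x"
  by (auto simp: emp_moment_def open_cube_def less_imp_le intro!: divide_nonneg_nonneg sum_nonneg)

text \<open>Pointwise, u^s v^(k-s) \<le> max u v ^ k \<le> u^k + v^k; averaging over both variables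
  gives the factor 2. This makes the quadratic part of the loop equation linear in the k-th moment,
  as the induction for the mean bounds requires.\<close>

lemma emp_moment_prod_le:
  assumes c: "0 \<le> c" and x: "x \<in> open_cube n" and "s \<le> k"
  shows "emp_moment n c s x * emp_moment n c (k - s) x \<le> 2 * emp_moment n c k x"
proof (cases "n = 0")
  case False
  define y where "y i = c * x i" for i
  have y: "0 \<le> y i" if "i < n" for i using x c that by (auto simp: y_def open_cube_def less_imp_le)
  have mix: "u ^ s * v ^ (k - s) \<le> u ^ k + v ^ k" if "0 \<le> u" "0 \<le> v" for u v :: real
  proof -
    have "u ^ s * v ^ (k - s) \<le> max u v ^ s * max u v ^ (k - s)"
      using that by (intro mult_mono power_mono) auto
    also have "\<dots> = max u v ^ k" using \<open>s \<le> k\<close> by (simp add: power_add[symmetric])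
    also have "\<dots> \<le> u ^ k + v ^ k" using that by (auto simp: max_def)
    finally show ?thesis .
  qed
  have "(\<Sum>i<n. y i ^ s) * (\<Sum>j<n. y j ^ (k - s)) = (\<Sum>i<n. \<Sum>j<n. y i ^ s * y j ^ (k - s))"
    by (rule sum_product)
  also have "\<dots> \<le> (\<Sum>i<n. \<Sum>j<n. y i ^ k + y j ^ k)"
    using y by (intro sum_mono mix) auto
  also have "\<dots> = 2 * real n * (\<Sum>i<n. y i ^ k)"
    by (simp add: sum.distrib sum_distrib_left[symmetric])
  finally have "(\<Sum>i<n. y i ^ s) * (\<Sum>j<n. y j ^ (k - s)) / (real n * real n) \<le> 2 * real n * (\<Sum>i<n. y i ^ k) / (real n * real n)"
    by (intro divide_right_mono) auto
  then show ?thesis using False by (simp add: emp_moment_def y_def)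
qed (simp add: emp_moment_def)

text \<open>The sum over pairs is half of the full double sum minus its diagonal. The removed
  diagonal has the same form as the Jacobian term, and together they carry the coefficient 1 -
  \<beta>/2.\<close>

lemma loop_D_power_sums:
  fixes x :: "nat \<Rightarrow> real" and n :: nat
  defines "P \<equiv> \<lambda>s. \<Sum>i<n. x i ^ s"
  shows "loop_D n \<beta> p q k x = (p + (1 - \<beta> / 2) * (real k + 1)) * P k - (p + q + (1 - \<beta> / 2) * (real k + 2)) * P (Suc k)
     + \<beta> / 2 * ((\<Sum>s\<le>k. P s * P (k - s)) - (\<Sum>s\<le>Suc k. P s * P (Suc k - s)))"
proof -
  have full: "(\<Sum>i<n. \<Sum>j<n. \<Sum>s\<le>m. x i ^ s * x j ^ (m - s)) = (\<Sum>s\<le>m. P s * P (m - s))" for m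
  proof -
    have "(\<Sum>i<n. \<Sum>j<n. \<Sum>s\<le>m. x i ^ s * x j ^ (m - s)) = (\<Sum>i<n. \<Sum>s\<le>m. \<Sum>j<n. x i ^ s * x j ^ (m - s))"
      by (intro sum.cong refl sum.swap)
    also have "\<dots> = (\<Sum>s\<le>m. \<Sum>i<n. \<Sum>j<n. x i ^ s * x j ^ (m - s))" by (rule sum.swap)
    finally show ?thesis by (simp add: P_def sum_product)
  qed
  have diag: "(\<Sum>i<n. div_diff k (x i) (x i)) = (real k + 1) * P k - (real k + 2) * P (Suc k)"
    unfolding div_diff_diag by (simp add: P_def sum_subtractf sum_distrib_left[symmetric] add.commute)
  have "(\<Sum>j<n. \<Sum>i<j. \<beta> * div_diff k (x i) (x j)) = \<beta> * (\<Sum>j<n. \<Sum>i<j. div_diff k (x i) (x j))"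
    by (simp add: sum_distrib_left)
  also have "(\<Sum>j<n. \<Sum>i<j. div_diff k (x i) (x j)) =
      ((\<Sum>i<n. \<Sum>j<n. div_diff k (x i) (x j)) - (\<Sum>i<n. div_diff k (x i) (x i))) / 2"
    by (rule sum_pairs_symmetric) (rule div_diff_commute)
  also have "(\<Sum>i<n. \<Sum>j<n. div_diff k (x i) (x j)) = (\<Sum>s\<le>k. P s * P (k - s)) - (\<Sum>s\<le>Suc k. P s * P (Suc k - s))"
    unfolding full[symmetric] div_diff_def by (simp only: sum_subtractf)
  finally have pairs: "(\<Sum>j<n. \<Sum>i<j. \<beta> * div_diff k (x i) (x j)) =
    \<beta> * (((\<Sum>s\<le>k. P s * P (k - s)) - (\<Sum>s\<le>Suc k. P s * P (Suc k - s)) - (\<Sum>i<n. div_diff k (x i) (x i))) / 2)" .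
  have "(\<Sum>i<n. p * (x i ^ k * (1 - x i)) + q * (- (x i ^ Suc k)) + 1 * div_diff k (x i) (x i)) =
      (\<Sum>i<n. p * x i ^ k - (p + q) * x i ^ Suc k + div_diff k (x i) (x i))"
    by (intro sum.cong refl) (simp add: algebra_simps)
  also have "\<dots> = p * P k - (p + q) * P (Suc k) + (\<Sum>i<n. div_diff k (x i) (x i))"
    by (simp only: sum.distrib sum_subtractf sum_distrib_left[symmetric] P_def)
  finally have single: "(\<Sum>i<n. p * (x i ^ k * (1 - x i)) + q * (- (x i ^ Suc k)) + 1 * div_diff k (x i) (x i)) =
      p * P k - (p + q) * P (Suc k) + (\<Sum>i<n. div_diff k (x i) (x i))" .
  have "\<beta> * ((S1 - S2 - (A - B)) / 2) + (p * u - (p + q) * v + (A - B)) =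
    p * u - (p + q) * v + (1 - \<beta> / 2) * (A - B) + \<beta> / 2 * (S1 - S2)" for S1 S2 A B u v
    by (simp add: field_simps)
  from this[of "\<Sum>s\<le>k. P s * P (k - s)" "\<Sum>s\<le>Suc k. P s * P (Suc k - s)"]
  have "loop_D n \<beta> p q k x = p * P k - (p + q) * P (Suc k) + (1 - \<beta> / 2) * ((real k + 1) * P k - (real k + 2) * P (Suc k))
     + \<beta> / 2 * ((\<Sum>s\<le>k. P s * P (k - s)) - (\<Sum>s\<le>Suc k. P s * P (Suc k - s)))"
    unfolding loop_D_def pairs single diag by simp
  also have "p * P k - (p + q) * P (Suc k) + (1 - \<beta> / 2) * ((real k + 1) * P k - (real k + 2) * P (Suc k)) =
    (p + (1 - \<beta> / 2) * (real k + 1)) * P k - (p + q + (1 - \<beta> / 2) * (real k + 2)) * P (Suc k)"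
    by (simp add: algebra_simps)
  finally show ?thesis .
qed

text \<open>The exponents may be negative, hence the absolute values. The q-term is kept apart: its
  coefficient is of the larger order b, but its two extra powers of x gain (a/b)^2 after
  rescaling.\<close>

lemma loop_V_le:
  fixes x :: "nat \<Rightarrow> real" and n :: nat
  assumes x: "x \<in> open_cube n" and \<beta>: "0 \<le> \<beta>"
  defines "P \<equiv> \<lambda>s. \<Sum>i<n. x i ^ s"
  shows "loop_V n \<beta> p q k x \<le> (\<bar>p\<bar> + 2 * (real k + 2)\<^sup>2 * (1 + \<beta> * n)) * P (2 * k) + \<bar>q\<bar> * P (2 * k + 2)"
proof -
  let ?K = "(real k + 2)\<^sup>2"
  have xi: "0 \<le> x i" "x i \<le> 1" if "i < n" for i using x that by (auto simp: open_cube_def less_imp_le)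
  have d: "(div_diff k (x i) (x j))\<^sup>2 \<le> ?K * (x i ^ (2 * k) + x j ^ (2 * k))" if "i < n" "j < n" for i j
    using xi[OF that(1)] xi[OF that(2)] by (intro div_diff_square_le)
  have "(\<Sum>j<n. \<Sum>i<j. \<beta> * (div_diff k (x i) (x j))\<^sup>2) \<le> (\<Sum>j<n. \<Sum>i<n. \<beta> * (div_diff k (x i) (x j))\<^sup>2)"
    using \<beta> by (intro sum_mono sum_mono2) auto
  also have "\<dots> \<le> (\<Sum>j<n. \<Sum>i<n. \<beta> * (?K * (x i ^ (2 * k) + x j ^ (2 * k))))"
    using \<beta> d by (intro sum_mono mult_left_mono) auto
  also have "\<dots> = \<beta> * (?K * (2 * real n * P (2 * k)))"
  proof -
    have "(\<Sum>j<n. \<Sum>i<n. f i + f j) = 2 * real n * (\<Sum>i<n. f i)" for f :: "nat \<Rightarrow> real"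
      by (simp add: sum.distrib sum_distrib_left[symmetric])
    then show ?thesis unfolding sum_distrib_left[symmetric] P_def by simp
  qed
  finally have 1: "(\<Sum>j<n. \<Sum>i<j. \<beta> * (div_diff k (x i) (x j))\<^sup>2) \<le> \<beta> * (?K * (2 * real n * P (2 * k)))" .
  have "(\<Sum>i<n. p * (x i ^ k * (1 - x i))\<^sup>2 + q * (- (x i ^ Suc k))\<^sup>2 + 1 * (div_diff k (x i) (x i))\<^sup>2)
      \<le> (\<Sum>i<n. \<bar>p\<bar> * x i ^ (2 * k) + \<bar>q\<bar> * x i ^ (2 * k + 2) + ?K * (2 * x i ^ (2 * k)))"
  proof (intro sum_mono add_mono)
    fix i assume "i \<in> {..<n}"
    then have i: "i < n" by simp
    have "(x i ^ k * (1 - x i))\<^sup>2 = x i ^ (2 * k) * (1 - x i)\<^sup>2"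
      by (simp add: power_mult_distrib power_mult[symmetric] mult.commute)
    also have "\<dots> \<le> x i ^ (2 * k) * 1"
      using xi[OF i] by (intro mult_left_mono power_le_one) auto
    finally have "\<bar>p\<bar> * (x i ^ k * (1 - x i))\<^sup>2 \<le> \<bar>p\<bar> * x i ^ (2 * k)" by (intro mult_left_mono) auto
    moreover have "p * (x i ^ k * (1 - x i))\<^sup>2 \<le> \<bar>p\<bar> * (x i ^ k * (1 - x i))\<^sup>2"
      by (intro mult_right_mono) auto
    ultimately show "p * (x i ^ k * (1 - x i))\<^sup>2 \<le> \<bar>p\<bar> * x i ^ (2 * k)" by linarith
    have "(- (x i ^ Suc k))\<^sup>2 = x i ^ (2 * k + 2)"
      by (simp add: power_mult[symmetric] power_mult_distrib power2_eq_square power_add mult_2)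
    then show "q * (- (x i ^ Suc k))\<^sup>2 \<le> \<bar>q\<bar> * x i ^ (2 * k + 2)"
      using xi[OF i] by (simp del: power_Suc) (intro mult_right_mono, auto)
    show "1 * (div_diff k (x i) (x i))\<^sup>2 \<le> ?K * (2 * x i ^ (2 * k))"
      using d[OF i i] by simp
  qed
  also have "\<dots> = \<bar>p\<bar> * P (2 * k) + \<bar>q\<bar> * P (2 * k + 2) + ?K * (2 * P (2 * k))"
    unfolding sum.distrib sum_distrib_left[symmetric] P_def ..
  finally show ?thesis using 1 unfolding loop_V_def by (simp add: algebra_simps)
qed

section \<open>Normalised loop equation and its two moment estimates\<close>

definition jac_exponent :: "nat \<Rightarrow> real \<Rightarrow> real \<Rightarrow> real" where
  "jac_exponent n \<beta> a = a - (\<beta> / 2 * (real n - 1) + 1)"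

abbreviation coeff_a :: "nat \<Rightarrow> real \<Rightarrow> real \<Rightarrow> nat \<Rightarrow> real" where
  "coeff_a n \<beta> a k \<equiv> (jac_exponent n \<beta> a + (1 - \<beta> / 2) * (real k + 1)) / a"

abbreviation coeff_b :: "nat \<Rightarrow> real \<Rightarrow> real \<Rightarrow> real \<Rightarrow> nat \<Rightarrow> real" where
  "coeff_b n \<beta> a b k \<equiv> (jac_exponent n \<beta> a + jac_exponent n \<beta> b + (1 - \<beta> / 2) * (real k + 2)) / b"

text \<open>\<open>loop_D\<close> divided by n a (a/b)^k and expressed in the rescaled moments. With
  this normalisation the coefficients tend to 1 - \<tau>, 1 and \<tau>, and the second convolution
  is damped by a/b.\<close>

definition scaled_D :: "nat \<Rightarrow> real \<Rightarrow> real \<Rightarrow> real \<Rightarrow> nat \<Rightarrow> (nat \<Rightarrow> real) \<Rightarrow> real" where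
  "scaled_D n \<beta> a b k x =
     coeff_a n \<beta> a k * emp_moment n (b / a) k x
     - coeff_b n \<beta> a b k * emp_moment n (b / a) (Suc k) x
     + \<beta> / 2 * n / a * ((\<Sum>s\<le>k. emp_moment n (b / a) s x * emp_moment n (b / a) (k - s) x)
         - a / b * (\<Sum>s\<le>Suc k. emp_moment n (b / a) s x * emp_moment n (b / a) (Suc k - s) x))"

definition mean_moment :: "nat \<Rightarrow> real \<Rightarrow> real \<Rightarrow> real \<Rightarrow> nat \<Rightarrow> real" where
  "mean_moment n \<beta> a b k = (\<integral>x. emp_moment n (b / a) k x \<partial>jacobi_ensemble n \<beta> a b)"

context
  fixes n :: nat and \<beta> a b :: real
  assumes n: "1 \<le> n" and \<beta>: "0 < \<beta>" and a: "0 < a" and b: "0 < b"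
begin

lemma power_sum_emp_moment: "(\<Sum>i<n. x i ^ s) = real n * (a / b) ^ s * emp_moment n (b / a) s x"
proof -
  have "(\<Sum>i<n. (b / a * x i) ^ s) = (b / a) ^ s * (\<Sum>i<n. x i ^ s)"
    by (simp only: power_mult_distrib sum_distrib_left)
  then show ?thesis using n a b by (simp add: emp_moment_def power_divide)
qed

lemma scaled_D_eq: "loop_D n \<beta> (jac_exponent n \<beta> a) (jac_exponent n \<beta> b) k x = real n * a * (a / b) ^ k * scaled_D n \<beta> a b k x"
proof -
  have conv: "(\<Sum>s\<le>m. (\<Sum>i<n. x i ^ s) * (\<Sum>i<n. x i ^ (m - s))) =
      (real n)\<^sup>2 * (a / b) ^ m * (\<Sum>s\<le>m. emp_moment n (b / a) s x * emp_moment n (b / a) (m - s) x)" for m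
  proof -
    have "(\<Sum>i<n. x i ^ s) * (\<Sum>i<n. x i ^ (m - s)) = (real n)\<^sup>2 * (a / b) ^ m * (emp_moment n (b / a) s x * emp_moment n (b / a) (m - s) x)" if "s \<le> m" for s
    proof -
      have "(a / b) ^ m = (a / b) ^ s * (a / b) ^ (m - s)" using that by (simp add: power_add[symmetric])
      then show ?thesis unfolding power_sum_emp_moment by (simp only:) (simp add: power2_eq_square mult_ac)
    qed
    then show ?thesis by (simp add: sum_distrib_left)
  qed
  define r where "r = a / b"
  have ab: "a = r * b" using b by (simp add: r_def)
  have r: "r \<noteq> 0" using a b by (simp add: r_def)
  have "A * (real n * r ^ k * u) - B * (real n * r ^ Suc k * v) + c * ((real n)\<^sup>2 * r ^ k * S1 - (real n)\<^sup>2 * r ^ Suc k * S2)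
      = real n * (r * b) * r ^ k * (A / (r * b) * u - B / b * v + c * n / (r * b) * (S1 - r * S2))" for A B c u v S1 S2
    using r b by (simp add: field_simps power2_eq_square)
  note this[of _ "emp_moment n (b / a) k x" _ "emp_moment n (b / a) (Suc k) x",
      folded ab, unfolded r_def]
  then show ?thesis
    unfolding loop_D_power_sums unfolding conv unfolding power_sum_emp_moment scaled_D_def .
qed

context
  assumes P: "prob_space (jacobi_ensemble n \<beta> a b)"
begin

lemma borel_measurable_jacobi_ensemble:
  "borel_measurable (jacobi_ensemble n \<beta> a b) = borel_measurable (coords n)"
  by (rule measurable_cong_sets) simp_all

lemma ess_bounded_emp_moment: "ess_bounded (jacobi_ensemble n \<beta> a b) (emp_moment n (b / a) k)"
  unfolding emp_moment_def[abs_def] divide_inverse[of "sum _ _"]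
proof (intro ess_bounded_intros)
  fix i assume i: "i \<in> {..<n}"
  show "ess_bounded (jacobi_ensemble n \<beta> a b) (\<lambda>x. x i)"
  proof (rule ess_boundedI)
    show "(\<lambda>x. x i) \<in> borel_measurable (jacobi_ensemble n \<beta> a b)"
      unfolding borel_measurable_jacobi_ensemble by (rule PiM_component_measurable[OF i])
    show "AE x in jacobi_ensemble n \<beta> a b. \<bar>x i\<bar> \<le> 1"
      using AE_jacobi_cube by eventually_elim (use i in \<open>auto simp: open_cube_def less_imp_le\<close>)
  qed
qed

lemma ess_bounded_scaled_D: "ess_bounded (jacobi_ensemble n \<beta> a b) (scaled_D n \<beta> a b k)"
  unfolding scaled_D_def[abs_def] by (intro ess_bounded_intros ess_bounded_emp_moment)

lemma scaled_D_expectation: "(\<integral>x. scaled_D n \<beta> a b k x \<partial>jacobi_ensemble n \<beta> a b) = 0"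
  using jacobi_loop_equations(1)[OF P, of k, folded jac_exponent_def] n a b
  unfolding scaled_D_eq by simp

lemma mean_moment_nonneg: "0 \<le> mean_moment n \<beta> a b k"
  unfolding mean_moment_def
proof (rule integral_nonneg_AE)
  show "AE x in jacobi_ensemble n \<beta> a b. 0 \<le> emp_moment n (b / a) k x"
    using AE_jacobi_cube by eventually_elim (use a b in \<open>simp add: emp_moment_nonneg\<close>)
qed

text \<open>In the mean-zero identity the damped convolution has a favourable sign and is dropped,
  and the other one is at most 2 (k + 1) times the k-th moment. The next mean moment is thus
  controlled linearly by the previous one.\<close>

lemma mean_moment_step:
  "coeff_b n \<beta> a b k * mean_moment n \<beta> a b (Suc k)
    \<le> (\<bar>coeff_a n \<beta> a k\<bar> + 2 * (real k + 1) * (\<beta> / 2 * n / a)) * mean_moment n \<beta> a b k"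
proof -
  let ?J = "jacobi_ensemble n \<beta> a b" and ?m = "emp_moment n (b / a)"
  interpret prob_space ?J by (rule P)
  define A where "A = coeff_a n \<beta> a k"
  define B where "B = coeff_b n \<beta> a b k"
  define c where "c = \<beta> / 2 * n / a"
  have c: "0 \<le> c" using \<beta> a by (simp add: c_def)
  have ba: "0 \<le> b / a" using a b by simp
  note ints = ess_bounded_integrable ess_bounded_intros ess_bounded_emp_moment
  have "0 = (\<integral>x. scaled_D n \<beta> a b k x \<partial>?J)" by (simp add: scaled_D_expectation)
  also have "\<dots> \<le> (\<integral>x. (\<bar>A\<bar> + 2 * (real k + 1) * c) * ?m k x - B * ?m (Suc k) x \<partial>?J)"
  proof (rule integral_mono_AE)
    show "integrable ?J (scaled_D n \<beta> a b k)" by (intro ess_bounded_integrable ess_bounded_scaled_D)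
    show "integrable ?J (\<lambda>x. (\<bar>A\<bar> + 2 * (real k + 1) * c) * ?m k x - B * ?m (Suc k) x)" by (intro ints)
    show "AE x in ?J. scaled_D n \<beta> a b k x \<le> (\<bar>A\<bar> + 2 * (real k + 1) * c) * ?m k x - B * ?m (Suc k) x"
      using AE_jacobi_cube
    proof eventually_elim
      fix x assume x: "x \<in> open_cube n"
      have m: "0 \<le> ?m k x" for k by (rule emp_moment_nonneg[OF ba x])
      have "(\<Sum>s\<le>k. ?m s x * ?m (k - s) x) \<le> (\<Sum>s\<le>k. 2 * ?m k x)"
        by (intro sum_mono emp_moment_prod_le[OF ba x]) simp
      moreover have "0 \<le> a / b * (\<Sum>s\<le>Suc k. ?m s x * ?m (Suc k - s) x)"
        using a b by (intro mult_nonneg_nonneg sum_nonneg m) auto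
      ultimately have "(\<Sum>s\<le>k. ?m s x * ?m (k - s) x) - a / b * (\<Sum>s\<le>Suc k. ?m s x * ?m (Suc k - s) x)
          \<le> (\<Sum>s\<le>k. 2 * ?m k x)" by linarith
      also have "(\<Sum>s\<le>k. 2 * ?m k x) = 2 * (real k + 1) * ?m k x" by simp
      finally have "(\<Sum>s\<le>k. ?m s x * ?m (k - s) x) - a / b * (\<Sum>s\<le>Suc k. ?m s x * ?m (Suc k - s) x)
          \<le> 2 * (real k + 1) * ?m k x" .
      from mult_left_mono[OF this c] mult_right_mono[OF abs_ge_self[of A] m[of k]]
      show "scaled_D n \<beta> a b k x \<le> (\<bar>A\<bar> + 2 * (real k + 1) * c) * ?m k x - B * ?m (Suc k) x"
        unfolding scaled_D_def A_def[symmetric] B_def[symmetric] c_def[symmetric] by (simp add: algebra_simps)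
    qed
  qed
  also have "\<dots> = (\<bar>A\<bar> + 2 * (real k + 1) * c) * mean_moment n \<beta> a b k - B * mean_moment n \<beta> a b (Suc k)"
    by (subst Bochner_Integration.integral_diff) (intro ints, intro ints, simp add: mean_moment_def)
  finally show ?thesis unfolding A_def B_def c_def by simp
qed

text \<open>The second loop equation replaces the square by \<open>loop_V\<close>, divided by (n a
  (a/b)^k)^2. In the last summand the two extra powers of x change the a^2 in the denominator into
  b^2.\<close>

lemma scaled_D_second_moment:
  "(\<integral>x. (scaled_D n \<beta> a b k x)\<^sup>2 \<partial>jacobi_ensemble n \<beta> a b) \<le>
     (\<bar>jac_exponent n \<beta> a\<bar> + 2 * (real k + 2)\<^sup>2 * (1 + \<beta> * n)) / (n * a\<^sup>2) * mean_moment n \<beta> a b (2 * k)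
     + \<bar>jac_exponent n \<beta> b\<bar> / (n * b\<^sup>2) * mean_moment n \<beta> a b (2 * k + 2)"
proof -
  let ?J = "jacobi_ensemble n \<beta> a b" and ?m = "emp_moment n (b / a)"
  interpret prob_space ?J by (rule P)
  note ints = ess_bounded_integrable ess_bounded_intros ess_bounded_emp_moment
  define N where "N = real n * a * (a / b) ^ k"
  have N: "0 < N" using n a b by (simp add: N_def)
  let ?p = "jac_exponent n \<beta> a" and ?q = "jac_exponent n \<beta> b"
  have *: "(\<integral>x. (loop_D n \<beta> ?p ?q k x)\<^sup>2 \<partial>?J) = (\<integral>x. loop_V n \<beta> ?p ?q k x \<partial>?J)"
    using jacobi_loop_equations(2)[OF P, of k, folded jac_exponent_def] .
  have "N\<^sup>2 * (\<integral>x. (scaled_D n \<beta> a b k x)\<^sup>2 \<partial>?J) = (\<integral>x. loop_V n \<beta> ?p ?q k x \<partial>?J)"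
    using * unfolding scaled_D_eq N_def[symmetric] power_mult_distrib by simp
  also have "\<dots> \<le> (\<integral>x. (\<bar>?p\<bar> + 2 * (real k + 2)\<^sup>2 * (1 + \<beta> * n)) * (real n * (a / b) ^ (2 * k) * ?m (2 * k) x)
      + \<bar>?q\<bar> * (real n * (a / b) ^ (2 * k + 2) * ?m (2 * k + 2) x) \<partial>?J)"
  proof (cases "integrable ?J (loop_V n \<beta> ?p ?q k)")
    case True
    show ?thesis
    proof (rule integral_mono_AE[OF True])
      show "AE x in ?J. loop_V n \<beta> ?p ?q k x \<le> (\<bar>?p\<bar> + 2 * (real k + 2)\<^sup>2 * (1 + \<beta> * n)) * (real n * (a / b) ^ (2 * k) * ?m (2 * k) x)
          + \<bar>?q\<bar> * (real n * (a / b) ^ (2 * k + 2) * ?m (2 * k + 2) x)"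
        using AE_jacobi_cube
        by eventually_elim (use \<beta> in \<open>simp only: power_sum_emp_moment[symmetric]\<close>, intro loop_V_le, auto)
    qed (intro ints)
  next
    \<comment> \<open>Here the left integral has the default value 0, so nonnegativity of the
      right-hand side is enough.\<close>
    case False
    have "0 \<le> (\<integral>x. (\<bar>?p\<bar> + 2 * (real k + 2)\<^sup>2 * (1 + \<beta> * n)) * (real n * (a / b) ^ (2 * k) * ?m (2 * k) x)
      + \<bar>?q\<bar> * (real n * (a / b) ^ (2 * k + 2) * ?m (2 * k + 2) x) \<partial>?J)"
    proof (rule integral_nonneg_AE)
      show "AE x in ?J. 0 \<le> (\<bar>?p\<bar> + 2 * (real k + 2)\<^sup>2 * (1 + \<beta> * n)) * (real n * (a / b) ^ (2 * k) * ?m (2 * k) x)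
      + \<bar>?q\<bar> * (real n * (a / b) ^ (2 * k + 2) * ?m (2 * k + 2) x)"
        using AE_jacobi_cube
        by eventually_elim
          (intro add_nonneg_nonneg mult_nonneg_nonneg emp_moment_nonneg zero_le_power divide_nonneg_nonneg,
            use a b \<beta> in simp_all)
    qed
    then show ?thesis using False by (simp add: not_integrable_integral_eq)
  qed
  also have "\<dots> = (\<bar>?p\<bar> + 2 * (real k + 2)\<^sup>2 * (1 + \<beta> * n)) * (real n * (a / b) ^ (2 * k) * mean_moment n \<beta> a b (2 * k))
      + \<bar>?q\<bar> * (real n * (a / b) ^ (2 * k + 2) * mean_moment n \<beta> a b (2 * k + 2))"
    by (subst Bochner_Integration.integral_add) (intro ints, intro ints, simp add: mean_moment_def)
  also have "\<dots> = N\<^sup>2 * ((\<bar>?p\<bar> + 2 * (real k + 2)\<^sup>2 * (1 + \<beta> * n)) / (n * a\<^sup>2) * mean_moment n \<beta> a b (2 * k)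
     + \<bar>?q\<bar> / (n * b\<^sup>2) * mean_moment n \<beta> a b (2 * k + 2))"
  proof -
    have 1: "real n * (a / b) ^ (2 * k) = N\<^sup>2 / (n * a\<^sup>2)"
      unfolding N_def power_even_eq using n a by (simp add: power_mult_distrib power2_eq_square)
    have 2: "real n * (a / b) ^ (2 * k + 2) = N\<^sup>2 / (n * b\<^sup>2)"
    proof -
      have "real n * (a / b) ^ (2 * k + 2) = real n * (a / b) ^ (2 * k) * (a / b)\<^sup>2" by (simp only: power_add mult.assoc)
      then show ?thesis unfolding 1 using n a b by (simp add: power_divide)
    qed
    have "c1 * (N\<^sup>2 / d1 * e1) + c2 * (N\<^sup>2 / d2 * e2) = N\<^sup>2 * (c1 / d1 * e1 + c2 / d2 * e2)" for c1 c2 d1 d2 e1 e2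
      by (simp add: distrib_left mult_ac)
    then show ?thesis unfolding 1 2 .
  qed
  finally show ?thesis using N by simp
qed

end

end

section \<open>Asymptotics\<close>

text \<open>Without sigma-finiteness the product measure is the iterated integral only if that set
  function is a measure, and it is 0 by default otherwise; hence the two possible values.\<close>

lemma emeasure_pair_measure_space:
  "emeasure (A \<Otimes>\<^sub>M B) (space (A \<Otimes>\<^sub>M B)) \<in> {0, emeasure A (space A) * emeasure B (space B)}"
proof -
  have "(\<integral>\<^sup>+ x. \<integral>\<^sup>+ y. indicator (space A \<times> space B) (x, y) \<partial>B \<partial>A) = (\<integral>\<^sup>+ x. emeasure B (space B) \<partial>A)"
  proof (rule nn_integral_cong)
    fix x assume "x \<in> space A"
    then have "(\<integral>\<^sup>+ y. indicator (space A \<times> space B) (x, y) \<partial>B) = (\<integral>\<^sup>+ y. 1 \<partial>B)"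
      by (intro nn_integral_cong) auto
    then show "(\<integral>\<^sup>+ y. indicator (space A \<times> space B) (x, y) \<partial>B) = emeasure B (space B)" by simp
  qed
  also have "\<dots> = emeasure A (space A) * emeasure B (space B)" by (simp add: mult.commute)
  finally show ?thesis
    unfolding space_pair_measure by (simp add: pair_measure_def emeasure_measure_of_conv)
qed

text \<open>Total mass 1 excludes the default value 0, so the factors have masses with product 1,
  and the first mass can then only be 1. This recovers both marginal laws as probability laws from
  the joint law.\<close>

lemma prob_space_pair_factors:
  assumes "prob_space (A \<Otimes>\<^sub>M B)" "emeasure A (space A) \<in> {0, 1}"
  shows "prob_space A" "prob_space B"
proof -
  have "emeasure A (space A) * emeasure B (space B) = 1"
    using emeasure_pair_measure_space[of A B] prob_space.emeasure_space_1[OF assms(1)] by auto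
  then have "emeasure A (space A) = 1" "emeasure B (space B) = 1" using assms(2) by auto
  then show "prob_space A" "prob_space B" by (auto intro: prob_spaceI)
qed

lemma distr_pair_snd:
  assumes "prob_space A" "prob_space B"
  shows "distr (A \<Otimes>\<^sub>M B) B snd = B"
proof (rule measure_eqI)
  interpret A: prob_space A by fact
  interpret B: prob_space B by fact
  fix X assume "X \<in> sets (distr (A \<Otimes>\<^sub>M B) B snd)"
  then have X: "X \<in> sets B" by simp
  then have "emeasure (distr (A \<Otimes>\<^sub>M B) B snd) X = emeasure (A \<Otimes>\<^sub>M B) (space A \<times> X)"
    using sets.sets_into_space[OF X]
    by (auto simp: emeasure_distr space_pair_measure intro!: arg_cong[where f = "emeasure (A \<Otimes>\<^sub>M B)"])
  also have "\<dots> = emeasure B X"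
    using X by (subst B.emeasure_pair_measure_Times) (auto simp: A.emeasure_space_1)
  finally show "emeasure (distr (A \<Otimes>\<^sub>M B) B snd) X = emeasure B X" .
qed simp

text \<open>Strong induction on the degree. The new moment also occurs twice inside the damped
  convolution, namely in its first and last terms; these are moved to the left, where the resulting
  factor \<open>den\<close> tends to 1 and can be divided out.\<close>

lemma moment_recursion_limit:
  fixes m :: "nat \<Rightarrow> nat \<Rightarrow> real" and A B D :: "nat \<Rightarrow> nat \<Rightarrow> real" and c r :: "nat \<Rightarrow> real"
  assumes D: "\<And>k n. D k n = A k n * m n k - B k n * m n (Suc k)
      + c n * ((\<Sum>s\<le>k. m n s * m n (k - s)) - r n * (\<Sum>s\<le>Suc k. m n s * m n (Suc k - s)))"
    and D0: "\<And>k. D k \<longlonglongrightarrow> 0"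
    and A: "\<And>k. A k \<longlonglongrightarrow> 1 - \<tau>" and B: "\<And>k. B k \<longlonglongrightarrow> 1" and c: "c \<longlonglongrightarrow> \<tau>" and r: "r \<longlonglongrightarrow> 0"
    and m0: "(\<lambda>n. m n 0) \<longlonglongrightarrow> 1"
  shows "(\<lambda>n. m n k) \<longlonglongrightarrow> mp_moment \<tau> k"
proof (induction k rule: less_induct)
  case (less k)
  show ?case
  proof (cases k)
    case 0 then show ?thesis using m0 by simp
  next
    case (Suc j)
    have IH: "(\<lambda>n. m n s) \<longlonglongrightarrow> mp_moment \<tau> s" if "s \<le> j" for s using less Suc that by simp
    let ?S = "\<lambda>n. \<Sum>s\<le>j. m n s * m n (j - s)"
    let ?S' = "\<lambda>n. \<Sum>s\<in>{1..j}. m n s * m n (Suc j - s)"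
    define den where "den n = B j n + 2 * c n * r n * m n 0" for n
    have split: "(\<Sum>s\<le>Suc j. m n s * m n (Suc j - s)) = ?S' n + 2 * m n 0 * m n (Suc j)" for n
    proof -
      have "{..Suc j} = insert 0 (insert (Suc j) {1..j})" by auto
      then show ?thesis by simp
    qed
    have eq: "den n * m n (Suc j) = A j n * m n j + c n * ?S n - c n * r n * ?S' n - D j n" for n
      unfolding D split den_def by (simp add: algebra_simps)
    have den: "den \<longlonglongrightarrow> 1 + 2 * \<tau> * 0 * 1"
      unfolding den_def by (intro tendsto_intros B c r m0)
    have "(\<lambda>n. A j n * m n j + c n * ?S n - c n * r n * ?S' n - D j n) \<longlonglongrightarrow>
        (1 - \<tau>) * mp_moment \<tau> j + \<tau> * (\<Sum>s\<le>j. mp_moment \<tau> s * mp_moment \<tau> (j - s))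
        - \<tau> * 0 * (\<Sum>s\<in>{1..j}. mp_moment \<tau> s * mp_moment \<tau> (Suc j - s)) - 0"
      by (intro tendsto_intros A c r D0 IH) auto
    then have num: "(\<lambda>n. den n * m n (Suc j)) \<longlonglongrightarrow> mp_moment \<tau> (Suc j)" unfolding eq by simp
    have "(\<lambda>n. den n * m n (Suc j) / den n) \<longlonglongrightarrow> mp_moment \<tau> (Suc j) / (1 + 2 * \<tau> * 0 * 1)"
      by (intro tendsto_divide num den) simp
    moreover have "eventually (\<lambda>n. den n * m n (Suc j) / den n = m n (Suc j)) sequentially"
    proof -
      have "eventually (\<lambda>n. 0 < den n) sequentially" by (rule order_tendstoD(1)[OF den]) simp
      then show ?thesis by eventually_elim simp
    qed
    ultimately show ?thesis unfolding Suc by (simp add: tendsto_cong)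
  qed
qed

lemma tendsto_imp_eventually_le:
  fixes f :: "nat \<Rightarrow> real"
  assumes "f \<longlonglongrightarrow> l"
  shows "eventually (\<lambda>n. f n \<le> l + 1) sequentially"
  using order_tendstoD(2)[OF assms, of "l + 1"] by (auto elim: eventually_mono)

section \<open>Limits of the coefficients and bounds uniform in n\<close>

context
  fixes \<beta> \<tau> :: real and a b :: "nat \<Rightarrow> real"
  assumes \<beta>: "0 < \<beta>" and ab: "\<forall>n. a n > 0 \<and> b n > 0"
    and lim_a: "(\<lambda>n. \<beta> / 2 * real n / a n) \<longlonglongrightarrow> \<tau>" and \<tau>: "0 < \<tau>"
    and lim_b: "filterlim (\<lambda>n. b n / real n) at_top sequentially"
begin

lemma n_over_a: "(\<lambda>n. real n / a n) \<longlonglongrightarrow> 2 * \<tau> / \<beta>"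
  using tendsto_mult_left[OF lim_a, of "2 / \<beta>"] \<beta> by simp

lemma inverse_a: "(\<lambda>n. 1 / a n) \<longlonglongrightarrow> 0"
proof (rule Lim_transform_eventually)
  show "(\<lambda>n. real n / a n * (1 / real n)) \<longlonglongrightarrow> 0"
    using tendsto_mult[OF n_over_a lim_1_over_n] by simp
  show "eventually (\<lambda>n. real n / a n * (1 / real n) = 1 / a n) sequentially"
    using eventually_gt_at_top[of 0] by eventually_elim simp
qed

lemma n_over_b: "(\<lambda>n. real n / b n) \<longlonglongrightarrow> 0"
  using tendsto_inverse_0_at_top[OF lim_b] by simp

lemma inverse_b: "(\<lambda>n. 1 / b n) \<longlonglongrightarrow> 0"
proof (rule Lim_transform_eventually)
  show "(\<lambda>n. real n / b n * (1 / real n)) \<longlonglongrightarrow> 0"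
    using tendsto_mult[OF n_over_b lim_1_over_n] by simp
  show "eventually (\<lambda>n. real n / b n * (1 / real n) = 1 / b n) sequentially"
    using eventually_gt_at_top[of 0] by eventually_elim simp
qed

lemma a_over_b: "(\<lambda>n. a n / b n) \<longlonglongrightarrow> 0"
proof (rule Lim_transform_eventually)
  show "(\<lambda>n. real n / b n / (real n / a n)) \<longlonglongrightarrow> 0"
    using tendsto_divide[OF n_over_b n_over_a] \<tau> \<beta> by simp
  show "eventually (\<lambda>n. real n / b n / (real n / a n) = a n / b n) sequentially"
    using eventually_gt_at_top[of 0] by eventually_elim simp
qed

lemma exponent_over_a: "(\<lambda>n. jac_exponent n \<beta> (a n) / a n) \<longlonglongrightarrow> 1 - \<tau>"
proof -
  have "(\<lambda>n. 1 - \<beta> / 2 * real n / a n + (\<beta> / 2 - 1) * (1 / a n)) \<longlonglongrightarrow> 1 - \<tau> + (\<beta> / 2 - 1) * 0"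
    by (intro tendsto_intros lim_a inverse_a)
  moreover have "1 - \<beta> / 2 * real n / a n + (\<beta> / 2 - 1) * (1 / a n) = jac_exponent n \<beta> (a n) / a n" for n
    using ab[rule_format, of n] by (simp add: jac_exponent_def field_simps)
  ultimately show ?thesis by simp
qed

lemma exponent_over_b: "(\<lambda>n. jac_exponent n \<beta> (b n) / b n) \<longlonglongrightarrow> 1"
proof -
  have "(\<lambda>n. 1 - \<beta> / 2 * (real n / b n) + (\<beta> / 2 - 1) * (1 / b n)) \<longlonglongrightarrow> 1 - \<beta> / 2 * 0 + (\<beta> / 2 - 1) * 0"
    by (intro tendsto_intros n_over_b inverse_b)
  moreover have "1 - \<beta> / 2 * (real n / b n) + (\<beta> / 2 - 1) * (1 / b n) = jac_exponent n \<beta> (b n) / b n" for n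
    using ab[rule_format, of n] by (simp add: jac_exponent_def field_simps)
  ultimately show ?thesis by simp
qed

lemma coeff_A: "(\<lambda>n. coeff_a n \<beta> (a n) k) \<longlonglongrightarrow> 1 - \<tau>"
proof -
  have "(\<lambda>n. jac_exponent n \<beta> (a n) / a n + (1 - \<beta> / 2) * (real k + 1) * (1 / a n)) \<longlonglongrightarrow> 1 - \<tau> + (1 - \<beta> / 2) * (real k + 1) * 0"
    by (intro tendsto_intros exponent_over_a inverse_a)
  then show ?thesis by (simp add: add_divide_distrib)
qed

lemma coeff_B: "(\<lambda>n. coeff_b n \<beta> (a n) (b n) k) \<longlonglongrightarrow> 1"
proof -
  have "(\<lambda>n. jac_exponent n \<beta> (a n) / a n * (a n / b n) + jac_exponent n \<beta> (b n) / b n + (1 - \<beta> / 2) * (real k + 2) * (1 / b n))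
      \<longlonglongrightarrow> (1 - \<tau>) * 0 + 1 + (1 - \<beta> / 2) * (real k + 2) * 0"
    by (intro tendsto_intros exponent_over_a exponent_over_b a_over_b inverse_b)
  moreover have "a n \<noteq> 0" for n using ab[rule_format, of n] by simp
  ultimately show ?thesis by (simp add: add_divide_distrib)
qed

context
  assumes P: "\<And>n. 1 \<le> n \<Longrightarrow> prob_space (jacobi_ensemble n \<beta> (a n) (b n))"
begin

text \<open>The step inequality is iterated from the 0-th moment, which is 1. Its left coefficient
  tends to 1 and eventually exceeds 1/2, at the price of a factor 2; the bound depends on k but not
  on n.\<close>

lemma mean_moment_bounded:
  "\<exists>C. eventually (\<lambda>n. mean_moment n \<beta> (a n) (b n) k \<le> C) sequentially"
proof (induction k)
  case 0
  have "eventually (\<lambda>n. mean_moment n \<beta> (a n) (b n) 0 \<le> 1) sequentially"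
    using eventually_ge_at_top[of 1]
  proof eventually_elim
    fix n :: nat assume n: "1 \<le> n"
    interpret prob_space "jacobi_ensemble n \<beta> (a n) (b n)" by (rule P[OF n])
    show "mean_moment n \<beta> (a n) (b n) 0 \<le> 1"
      using n by (simp add: mean_moment_def emp_moment_0 prob_space)
  qed
  then show ?case by blast
next
  case (Suc k)
  then obtain C where C: "eventually (\<lambda>n. mean_moment n \<beta> (a n) (b n) k \<le> C) sequentially"
    by blast
  let ?G = "\<lambda>n. \<bar>coeff_a n \<beta> (a n) k\<bar> + 2 * (real k + 1) * (\<beta> / 2 * n / a n)"
  define g where "g = \<bar>1 - \<tau>\<bar> + 2 * (real k + 1) * \<tau>"
  have g0: "0 \<le> g" using \<tau> by (simp add: g_def)
  have "?G \<longlonglongrightarrow> g" unfolding g_def by (intro tendsto_intros coeff_A lim_a)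
  then have G: "eventually (\<lambda>n. ?G n \<le> g + 1) sequentially" by (rule tendsto_imp_eventually_le)
  have B: "eventually (\<lambda>n. 1 / 2 < coeff_b n \<beta> (a n) (b n) k) sequentially"
    by (rule order_tendstoD(1)[OF coeff_B]) simp
  have "eventually (\<lambda>n. mean_moment n \<beta> (a n) (b n) (Suc k) \<le> 2 * ((g + 1) * C)) sequentially"
    using C G B eventually_ge_at_top[of 1]
  proof eventually_elim
    fix n :: nat
    assume 1: "mean_moment n \<beta> (a n) (b n) k \<le> C" and 2: "?G n \<le> g + 1"
      and 3: "1 / 2 < coeff_b n \<beta> (a n) (b n) k" and n: "1 \<le> n"
    have pos: "0 < a n" "0 < b n" using ab by auto
    define E where "E k = mean_moment n \<beta> (a n) (b n) k" for k
    have E: "0 \<le> E k" for k unfolding E_def by (rule mean_moment_nonneg[OF n \<beta> pos P[OF n]])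
    have "1 / 2 * E (Suc k) \<le> coeff_b n \<beta> (a n) (b n) k * E (Suc k)"
      using 3 E by (intro mult_right_mono) auto
    also have "\<dots> \<le> ?G n * E k" unfolding E_def by (rule mean_moment_step[OF n \<beta> pos P[OF n]])
    also have "\<dots> \<le> (g + 1) * C" using 1 2 E g0 unfolding E_def[symmetric] by (intro mult_mono) auto
    finally show "E (Suc k) \<le> 2 * ((g + 1) * C)" by simp
  qed
  then show ?case by blast
qed

lemma scaled_D_second_moment_bound:
  "\<exists>C. eventually (\<lambda>n. (\<integral>x. (scaled_D n \<beta> (a n) (b n) k x)\<^sup>2 \<partial>jacobi_ensemble n \<beta> (a n) (b n)) \<le> C / (real n)\<^sup>2) sequentially"
proof -
  let ?I = "\<lambda>n. \<integral>x. (scaled_D n \<beta> (a n) (b n) k x)\<^sup>2 \<partial>jacobi_ensemble n \<beta> (a n) (b n)"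
  obtain C1 where C1: "eventually (\<lambda>n. mean_moment n \<beta> (a n) (b n) (2 * k) \<le> C1) sequentially"
    using mean_moment_bounded by blast
  obtain C2 where C2: "eventually (\<lambda>n. mean_moment n \<beta> (a n) (b n) (2 * k + 2) \<le> C2) sequentially"
    using mean_moment_bounded by blast
  let ?K = "2 * (real k + 2)\<^sup>2"
  \<comment> \<open>\<open>?u\<close> and \<open>?v\<close> are the two coefficients of the
    second-moment bound multiplied by n^2. The first converges because n/a does, and the second
    tends to 0 with n/b.\<close>
  let ?u = "\<lambda>n. real n / a n * (\<bar>jac_exponent n \<beta> (a n) / a n\<bar> + ?K * (1 / a n + \<beta> * (real n / a n)))"
  let ?v = "\<lambda>n. real n / b n * \<bar>jac_exponent n \<beta> (b n) / b n\<bar>"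
  define u where "u = 2 * \<tau> / \<beta> * (\<bar>1 - \<tau>\<bar> + ?K * (0 + \<beta> * (2 * \<tau> / \<beta>)))"
  have u0: "0 \<le> u" using \<tau> \<beta> by (simp add: u_def)
  have "?u \<longlonglongrightarrow> u" unfolding u_def by (intro tendsto_intros n_over_a exponent_over_a inverse_a)
  then have U: "eventually (\<lambda>n. ?u n \<le> u + 1) sequentially" by (rule tendsto_imp_eventually_le)
  have "?v \<longlonglongrightarrow> 0 * \<bar>1\<bar>" by (intro tendsto_intros n_over_b exponent_over_b)
  then have "eventually (\<lambda>n. ?v n \<le> 0 * \<bar>1\<bar> + 1) sequentially" by (rule tendsto_imp_eventually_le)
  then have V: "eventually (\<lambda>n. ?v n \<le> 1) sequentially" by simp
  have "eventually (\<lambda>n. ?I n \<le> ((u + 1) * C1 + 1 * C2) / (real n)\<^sup>2) sequentially"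
    using C1 C2 U V eventually_ge_at_top[of 1]
  proof eventually_elim
    fix n :: nat
    assume c1: "mean_moment n \<beta> (a n) (b n) (2 * k) \<le> C1"
      and c2: "mean_moment n \<beta> (a n) (b n) (2 * k + 2) \<le> C2"
      and un: "?u n \<le> u + 1" and vn: "?v n \<le> 1" and n: "1 \<le> n"
    have pos: "0 < a n" "0 < b n" using ab by auto
    define E where "E k = mean_moment n \<beta> (a n) (b n) k" for k
    have E: "0 \<le> E k" for k unfolding E_def by (rule mean_moment_nonneg[OF n \<beta> pos P[OF n]])
    have "?I n \<le>
      (\<bar>jac_exponent n \<beta> (a n)\<bar> + ?K * (1 + \<beta> * n)) / (n * (a n)\<^sup>2) * E (2 * k)
       + \<bar>jac_exponent n \<beta> (b n)\<bar> / (n * (b n)\<^sup>2) * E (2 * k + 2)"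
      unfolding E_def by (rule scaled_D_second_moment[OF n \<beta> pos P[OF n]])
    also have "(\<bar>jac_exponent n \<beta> (a n)\<bar> + ?K * (1 + \<beta> * n)) / (n * (a n)\<^sup>2) = ?u n / (real n)\<^sup>2"
      using n pos by (simp add: abs_divide field_simps power2_eq_square)
    also have "\<bar>jac_exponent n \<beta> (b n)\<bar> / (n * (b n)\<^sup>2) = ?v n / (real n)\<^sup>2"
      using n pos by (simp add: abs_divide power2_eq_square)
    also have "?u n / (real n)\<^sup>2 * E (2 * k) + ?v n / (real n)\<^sup>2 * E (2 * k + 2) = (?u n * E (2 * k) + ?v n * E (2 * k + 2)) / (real n)\<^sup>2"
      by (simp only: add_divide_distrib times_divide_eq_left)
    also have "\<dots> \<le> ((u + 1) * C1 + 1 * C2) / (real n)\<^sup>2"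
      using un vn c1 c2 E u0 unfolding E_def[symmetric] by (intro divide_right_mono add_mono mult_mono) auto
    finally show "?I n \<le> ((u + 1) * C1 + 1 * C2) / (real n)\<^sup>2" .
  qed
  then show ?thesis by blast
qed

end

end

text \<open>For nonnegative numbers (u - v)^4 \<le> u^4 + v^4. The mean term costs 8 = 2^2 * 2, by
  applying m_s^2 \<le> 2 m_(2s) at s = k and s = 2k; together 1 + 8 = 9.\<close>

lemma centred_fourth_power_mean:
  assumes c: "0 \<le> c" and x: "x \<in> open_cube n" and n: "1 \<le> n"
  shows "(\<Sum>i<n. ((c * x i) ^ k - emp_moment n c k x) ^ 4) / n \<le> 9 * emp_moment n c (4 * k) x"
proof -
  define m where "m = emp_moment n c k x"
  have m: "0 \<le> m" unfolding m_def by (rule emp_moment_nonneg[OF c x])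
  have diff: "(u - v) ^ 4 \<le> u ^ 4 + v ^ 4" if "0 \<le> u" "0 \<le> v" for u v :: real
  proof -
    have "\<bar>u - v\<bar> ^ 4 \<le> max u v ^ 4" using that by (intro power_mono) auto
    also have "\<dots> \<le> u ^ 4 + v ^ 4" using that by (auto simp: max_def)
    finally show ?thesis by simp
  qed
  have "(\<Sum>i<n. ((c * x i) ^ k - m) ^ 4) \<le> (\<Sum>i<n. (c * x i) ^ (4 * k) + m ^ 4)"
  proof (rule sum_mono)
    fix i assume "i \<in> {..<n}"
    then have "0 \<le> c * x i" using x c by (auto simp: open_cube_def less_imp_le)
    then have "((c * x i) ^ k - m) ^ 4 \<le> ((c * x i) ^ k) ^ 4 + m ^ 4" using m by (intro diff) auto
    then show "((c * x i) ^ k - m) ^ 4 \<le> (c * x i) ^ (4 * k) + m ^ 4"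
      by (simp add: power_mult[symmetric] mult.commute)
  qed
  also have "\<dots> = n * (emp_moment n c (4 * k) x + m ^ 4)"
    using n by (simp add: sum.distrib emp_moment_def distrib_left)
  finally have 1: "(\<Sum>i<n. ((c * x i) ^ k - m) ^ 4) / n \<le> emp_moment n c (4 * k) x + m ^ 4"
    using n by (simp add: field_simps)
  have sq: "(emp_moment n c s x)\<^sup>2 \<le> 2 * emp_moment n c (2 * s) x" for s
    using emp_moment_prod_le[OF c x, of s "2 * s"] by (simp add: power2_eq_square)
  have "m ^ 4 = (m\<^sup>2)\<^sup>2" by simp
  also have "\<dots> \<le> (2 * emp_moment n c (2 * k) x)\<^sup>2"
    using sq[of k] by (intro power_mono) (auto simp: m_def)
  also have "\<dots> \<le> 8 * emp_moment n c (4 * k) x"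
    using sq[of "2 * k"] by (simp add: power_mult_distrib)
  finally show ?thesis using 1 unfolding m_def by simp
qed

lemma distr_pair_law:
  assumes X: "X \<in> M \<rightarrow>\<^sub>M N1" and Y: "Y \<in> M \<rightarrow>\<^sub>M N2"
    and law: "distr M (N1 \<Otimes>\<^sub>M N2) (\<lambda>\<omega>. (X \<omega>, Y \<omega>)) = A \<Otimes>\<^sub>M B"
    and A: "prob_space A" "sets A = sets N1" and B: "prob_space B" "sets B = sets N2"
  shows "distr M N1 X = A" "distr M N2 Y = B"
proof -
  have XY: "(\<lambda>\<omega>. (X \<omega>, Y \<omega>)) \<in> M \<rightarrow>\<^sub>M N1 \<Otimes>\<^sub>M N2" using X Y by simp
  have "distr M N1 X = distr (distr M (N1 \<Otimes>\<^sub>M N2) (\<lambda>\<omega>. (X \<omega>, Y \<omega>))) N1 fst"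
    by (subst distr_distr[OF measurable_fst XY]) (simp add: comp_def)
  also have "\<dots> = distr (A \<Otimes>\<^sub>M B) A fst" unfolding law by (intro distr_cong) (simp_all add: A)
  finally show "distr M N1 X = A" using prob_space.distr_pair_fst[OF B(1)] by simp
  have "distr M N2 Y = distr (distr M (N1 \<Otimes>\<^sub>M N2) (\<lambda>\<omega>. (X \<omega>, Y \<omega>))) N2 snd"
    by (subst distr_distr[OF measurable_snd XY]) (simp add: comp_def)
  also have "\<dots> = distr (A \<Otimes>\<^sub>M B) B snd" unfolding law by (intro distr_cong) (simp_all add: B)
  finally show "distr M N2 Y = B" using distr_pair_snd[OF A(1) B(1)] by simp
qed

theorem theorem2p2:
  fixes M :: "'s measure"
    and \<beta> \<tau> :: real
    and a b :: "nat \<Rightarrow> real"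
    and Lam W :: "nat \<Rightarrow> 's \<Rightarrow> (nat \<Rightarrow> real)"
  assumes "prob_space M"
    and "\<beta> > 0"
    and "\<forall>n\<ge>1. a n > \<beta> / 2 * (real n - 1) \<and> b n > \<beta> / 2 * (real n - 1)"
    and "\<forall>n. a n > 0 \<and> b n > 0"
    and "(\<lambda>n. \<beta> / 2 * real n / a n) \<longlonglongrightarrow> \<tau>"
    and "0 < \<tau>" and "\<tau> \<le> 1"
    and "filterlim (\<lambda>n. b n / real n) at_top sequentially"
    and "\<forall>n\<ge>1. Lam n \<in> M \<rightarrow>\<^sub>M PiM {..<n} (\<lambda>_. lborel)"
    and "\<forall>n\<ge>1. W n \<in> M \<rightarrow>\<^sub>M PiM {..<n} (\<lambda>_. lborel)"
    and "\<forall>n\<ge>1. distr M (PiM {..<n} (\<lambda>_. lborel) \<Otimes>\<^sub>M PiM {..<n} (\<lambda>_. lborel))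
                   (\<lambda>\<omega>. (Lam n \<omega>, W n \<omega>))
               = jacobi_ensemble n \<beta> (a n) (b n) \<Otimes>\<^sub>M dirichlet_sym n (\<beta> / 2)"
  shows "AE \<omega> in M.
           weak_conv_m (\<lambda>n. spectral_meas n (b n / a n) (Lam n \<omega>) (W n \<omega>)) (marchenko_pastur \<tau>)
         \<and> weak_conv_m (\<lambda>n. spectral_meas n (b n / a n) (Lam n \<omega>) (\<lambda>_. 1 / real n)) (marchenko_pastur \<tau>)"
proof -
  interpret prob_space M by fact
  note \<beta> = assms(2) and ab = assms(4) and lim_a = assms(5) and \<tau> = assms(6,7) and lim_b = assms(8)
  let ?J = "\<lambda>n. jacobi_ensemble n \<beta> (a n) (b n)"
  let ?D = "\<lambda>n. dirichlet_sym n (\<beta> / 2)"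
  let ?N = "\<lambda>n::nat. coords n"
  have Lam: "Lam n \<in> M \<rightarrow>\<^sub>M ?N n" and W: "W n \<in> M \<rightarrow>\<^sub>M ?N n"
    and law: "distr M (?N n \<Otimes>\<^sub>M ?N n) (\<lambda>\<omega>. (Lam n \<omega>, W n \<omega>)) = ?J n \<Otimes>\<^sub>M ?D n" if "1 \<le> n" for n
    using assms(9-11) that by auto
  have LW: "(\<lambda>\<omega>. (Lam n \<omega>, W n \<omega>)) \<in> M \<rightarrow>\<^sub>M ?N n \<Otimes>\<^sub>M ?N n" if "1 \<le> n" for n
    using Lam[OF that] W[OF that] by simp
  \<comment> \<open>The joint law is an image of the probability measure \<open>M\<close>; that the
    Jacobi and Dirichlet laws are probability laws is deduced from this.\<close>
  have pair: "prob_space (?J n \<Otimes>\<^sub>M ?D n)" if "1 \<le> n" for n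
    unfolding law[OF that, symmetric] by (rule prob_space_distr[OF LW[OF that]])
  note PJ = prob_space_pair_factors(1)[OF pair emeasure_jacobi_ensemble_cases]
  note PD = prob_space_pair_factors(2)[OF pair emeasure_jacobi_ensemble_cases]
  have lawL: "distr M (?N n) (Lam n) = ?J n" and lawW: "distr M (?N n) (W n) = ?D n" if n: "1 \<le> n" for n
    using distr_pair_law[OF Lam[OF n] W[OF n] law[OF n] PJ[OF n] _ PD[OF n]] by simp_all
  have pos: "0 < a n" "0 < b n" for n using ab by auto
  have c0: "0 \<le> b n / a n" for n using pos[of n] by simp
  have Jmeas: "borel_measurable (?J n) = borel_measurable (?N n)" for n
    by (rule measurable_cong_sets) simp_all

  have AE1: "AE \<omega> in M. \<forall>n\<ge>1. Lam n \<omega> \<in> open_cube n"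
  proof (intro AE_all_countable[THEN iffD2] allI)
    fix n show "AE \<omega> in M. 1 \<le> n \<longrightarrow> Lam n \<omega> \<in> open_cube n"
    proof (cases "1 \<le> n")
      case True
      have "AE x in distr M (?N n) (Lam n). x \<in> open_cube n"
        unfolding lawL[OF True] by (rule AE_jacobi_cube)
      from AE_distrD[OF Lam[OF True] this] show ?thesis by eventually_elim simp
    qed simp
  qed
  have AE2: "AE \<omega> in M. \<forall>n\<ge>1. (\<forall>i<n. 0 \<le> W n \<omega> i) \<and> (\<Sum>i<n. W n \<omega> i) = 1"
  proof (intro AE_all_countable[THEN iffD2] allI)
    fix n show "AE \<omega> in M. 1 \<le> n \<longrightarrow> (\<forall>i<n. 0 \<le> W n \<omega> i) \<and> (\<Sum>i<n. W n \<omega> i) = 1"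
    proof (cases "1 \<le> n")
      case True
      have "AE w in distr M (?N n) (W n). (\<forall>i<n. 0 \<le> w i) \<and> (\<Sum>i<n. w i) = 1"
        unfolding lawW[OF True] using \<beta> by (intro AE_dirichlet_simplex True) simp
      from AE_distrD[OF W[OF True] this] show ?thesis by eventually_elim simp
    qed simp
  qed

  let ?s = "\<lambda>n. scaled_D n \<beta> (a n) (b n)"
  let ?b = "\<lambda>n k x. 9 / (\<beta> / 2 * n)\<^sup>2 * (9 * emp_moment n (b n / a n) (4 * k) x)"
  let ?y = "\<lambda>n \<omega> i. b n / a n * Lam n \<omega> i"
  let ?e = "\<lambda>n k \<omega>. emp_moment n (b n / a n) k (Lam n \<omega>)"
  have AE3: "AE \<omega> in M. (\<lambda>n. ?s n k (Lam n \<omega>)) \<longlonglongrightarrow> 0" for k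
  proof -
    obtain C where "eventually (\<lambda>n. (\<integral>x. (?s n k x)\<^sup>2 \<partial>?J n) \<le> C / (real n)\<^sup>2) sequentially"
      using scaled_D_second_moment_bound[OF \<beta> ab lim_a \<tau>(1) lim_b PJ] by blast
    then obtain N where N: "\<And>n. n \<ge> N \<Longrightarrow> (\<integral>x. (?s n k x)\<^sup>2 \<partial>?J n) \<le> C / (real n)\<^sup>2"
      by (auto simp: eventually_sequentially)
    have bdd: "ess_bounded (?J n) (?s n k)" if "1 \<le> n" for n
      by (rule ess_bounded_scaled_D[OF that \<beta> pos PJ[OF that]])
    have meas: "?s n k \<in> borel_measurable (?N n)" if "1 \<le> n" for n
      using ess_bounded_measurable[OF bdd[OF that]] unfolding Jmeas .
    show ?thesis
    proof (rule AE_tendsto_0_of_summable_moments[where N = "max 1 N" and p = 2 and C = C])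
      fix n assume n: "max 1 N \<le> n"
      then have n1: "1 \<le> n" by simp
      show "(\<lambda>\<omega>. ?s n k (Lam n \<omega>)) \<in> borel_measurable M"
        by (rule measurable_compose[OF Lam[OF n1] meas[OF n1]])
      interpret J: prob_space "?J n" by (rule PJ[OF n1])
      have "(\<integral>\<^sup>+ \<omega>. ennreal (\<bar>?s n k (Lam n \<omega>)\<bar>\<^sup>2) \<partial>M) =
          (\<integral>\<^sup>+ x. ennreal ((?s n k x)\<^sup>2) \<partial>distr M (?N n) (Lam n))"
        using meas[OF n1] by (subst nn_integral_distr[OF Lam[OF n1]]) simp_all
      also have "\<dots> = ennreal (\<integral>x. (?s n k x)\<^sup>2 \<partial>?J n)"
        unfolding lawL[OF n1]
        by (intro nn_integral_eq_integral J.ess_bounded_integrable ess_bounded_power bdd[OF n1]) simp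
      also have "\<dots> \<le> ennreal (C / (real n)\<^sup>2)" using n by (intro ennreal_leI N) simp
      finally show "(\<integral>\<^sup>+ \<omega>. ennreal (\<bar>?s n k (Lam n \<omega>)\<bar>\<^sup>2) \<partial>M) \<le> ennreal (C / (real n)\<^sup>2)" .
    qed simp
  qed

  \<comment> \<open>Independence allows the weights to be integrated first, with the eigenvalues
    frozen. The fourth moment given x is O(1/n^2) times a moment of degree 4k, whose mean is bounded
    in n.\<close>
  have AE4: "AE \<omega> in M. (\<lambda>n. \<Sum>i<n. ((?y n \<omega> i) ^ k - ?e n k \<omega>) * W n \<omega> i) \<longlonglongrightarrow> 0" for k
  proof -
    obtain C where "eventually (\<lambda>n. mean_moment n \<beta> (a n) (b n) (4 * k) \<le> C) sequentially"
      using mean_moment_bounded[OF \<beta> ab lim_a \<tau>(1) lim_b PJ] by blast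
    then obtain N where N: "\<And>n. n \<ge> N \<Longrightarrow> mean_moment n \<beta> (a n) (b n) (4 * k) \<le> C"
      by (auto simp: eventually_sequentially)
    let ?c = "\<lambda>n x i. (b n / a n * x i) ^ k - emp_moment n (b n / a n) k x"
    let ?F = "\<lambda>n x w. \<Sum>i<n. ?c n x i * w i"
    have mm: "emp_moment n c s \<in> borel_measurable (?N n)" for n c s
      unfolding emp_moment_def[abs_def]
      by (intro borel_measurable_divide borel_measurable_sum borel_measurable_power borel_measurable_times
          borel_measurable_const PiM_component_measurable)
    have Fm: "(\<lambda>(x, w). ?F n x w) \<in> borel_measurable (?N n \<Otimes>\<^sub>M ?N n)" for n
      unfolding split_beta
      by (intro borel_measurable_sum borel_measurable_times borel_measurable_diff borel_measurable_power
          borel_measurable_const measurable_compose[OF measurable_fst mm]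
          measurable_compose[OF measurable_fst PiM_component_measurable]
          measurable_compose[OF measurable_snd PiM_component_measurable])
    show ?thesis
    proof (rule AE_tendsto_0_of_summable_moments[where N = "max 1 N" and p = 4 and C = "9 / (\<beta> / 2)\<^sup>2 * (9 * C)"])
      fix n assume n: "max 1 N \<le> n"
      then have n1: "1 \<le> n" by simp
      interpret J: prob_space "?J n" by (rule PJ[OF n1])
      interpret D: prob_space "?D n" by (rule PD[OF n1])
      show "(\<lambda>\<omega>. ?F n (Lam n \<omega>) (W n \<omega>)) \<in> borel_measurable M"
        using measurable_compose[OF LW[OF n1] Fm[of n]] by simp
      have F4: "(\<lambda>z. ennreal (\<bar>case z of (x, w) \<Rightarrow> ?F n x w\<bar> ^ 4)) \<in> borel_measurable (?N n \<Otimes>\<^sub>M ?N n)"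
        by (intro measurable_compose[OF _ measurable_ennreal] borel_measurable_power borel_measurable_abs Fm)
      have sets_eq: "sets (?J n \<Otimes>\<^sub>M ?D n) = sets (?N n \<Otimes>\<^sub>M ?N n)" by (intro sets_pair_measure_cong) simp_all
      have F4': "(\<lambda>z. ennreal (\<bar>case z of (x, w) \<Rightarrow> ?F n x w\<bar> ^ 4)) \<in> borel_measurable (?J n \<Otimes>\<^sub>M ?D n)"
        using F4 unfolding measurable_cong_sets[OF sets_eq refl] .
      have "(\<integral>\<^sup>+ \<omega>. ennreal (\<bar>?F n (Lam n \<omega>) (W n \<omega>)\<bar> ^ 4) \<partial>M) =
          (\<integral>\<^sup>+ z. ennreal (\<bar>case z of (x, w) \<Rightarrow> ?F n x w\<bar> ^ 4) \<partial>distr M (?N n \<Otimes>\<^sub>M ?N n) (\<lambda>\<omega>. (Lam n \<omega>, W n \<omega>)))"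
        using F4 by (subst nn_integral_distr[OF LW[OF n1]]) simp_all
      also have "\<dots> = (\<integral>\<^sup>+ x. \<integral>\<^sup>+ w. ennreal (\<bar>?F n x w\<bar> ^ 4) \<partial>?D n \<partial>?J n)"
        unfolding law[OF n1] using D.nn_integral_fst[OF F4'] by simp
      also have "\<dots> \<le> (\<integral>\<^sup>+ x. ennreal (?b n k x) \<partial>?J n)"
      proof (rule nn_integral_mono_AE)
        show "AE x in ?J n. (\<integral>\<^sup>+ w. ennreal (\<bar>?F n x w\<bar> ^ 4) \<partial>?D n)
            \<le> ennreal (?b n k x)"
          using AE_jacobi_cube
        proof eventually_elim
          fix x assume x: "x \<in> open_cube n"
          \<comment> \<open>Subtracting the empirical moment is exactly the centring that the
            Dirichlet estimate asks of its coefficients.\<close>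
          have "(\<Sum>i<n. ?c n x i) = 0" using n1 by (simp add: sum_subtractf emp_moment_def)
          then have "(\<integral>\<^sup>+ w. ennreal (?F n x w ^ 4) \<partial>?D n) \<le> ennreal (9 / (\<beta> / 2 * n)\<^sup>2 * ((\<Sum>i<n. ?c n x i ^ 4) / n))"
            using \<beta> by (intro dirichlet_sym_fourth_moment n1 PD) auto
          also have "\<dots> \<le> ennreal (?b n k x)"
            by (intro ennreal_leI mult_left_mono centred_fourth_power_mean[OF c0 x n1]) simp
          finally show "(\<integral>\<^sup>+ w. ennreal (\<bar>?F n x w\<bar> ^ 4) \<partial>?D n)
            \<le> ennreal (?b n k x)" by simp
        qed
      qed
      also have "\<dots> = ennreal (\<integral>x. ?b n k x \<partial>?J n)"
      proof (intro nn_integral_eq_integral J.ess_bounded_integrable ess_bounded_mult ess_bounded_const)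
        show "ess_bounded (?J n) (emp_moment n (b n / a n) (4 * k))"
          by (rule ess_bounded_emp_moment[OF n1 \<beta> pos PJ[OF n1]])
        show "AE x in ?J n. 0 \<le> ?b n k x"
          using AE_jacobi_cube by eventually_elim (simp add: emp_moment_nonneg[OF c0])
      qed
      also have "\<dots> = ennreal (9 / (\<beta> / 2 * n)\<^sup>2 * (9 * mean_moment n \<beta> (a n) (b n) (4 * k)))"
        by (simp add: mean_moment_def)
      also have "\<dots> \<le> ennreal (9 / (\<beta> / 2 * n)\<^sup>2 * (9 * C))"
        using N[of n] n by (intro ennreal_leI mult_left_mono) auto
      also have "9 / (\<beta> / 2 * n)\<^sup>2 * (9 * C) = 9 / (\<beta> / 2)\<^sup>2 * (9 * C) / (real n)\<^sup>2"
        by (simp only: power_mult_distrib) (simp only: divide_divide_eq_left times_divide_eq_left)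
      finally show "(\<integral>\<^sup>+ \<omega>. ennreal (\<bar>?F n (Lam n \<omega>) (W n \<omega>)\<bar> ^ 4) \<partial>M) \<le> ennreal (9 / (\<beta> / 2)\<^sup>2 * (9 * C) / (real n)\<^sup>2)" .
    qed simp
  qed

  \<comment> \<open>Countably many degrees k, so one null set serves all of them; this is what lets
    the method of moments be applied at a fixed \<omega>.\<close>
  have AE3': "AE \<omega> in M. \<forall>k. (\<lambda>n. ?s n k (Lam n \<omega>)) \<longlonglongrightarrow> 0"
    using AE3 by (simp add: AE_all_countable)
  have AE4': "AE \<omega> in M. \<forall>k. (\<lambda>n. \<Sum>i<n. ((?y n \<omega> i) ^ k - ?e n k \<omega>) * W n \<omega> i) \<longlonglongrightarrow> 0"
    using AE4 by (simp add: AE_all_countable)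
  show ?thesis
    using AE1 AE2 AE3' AE4'
  proof eventually_elim
    fix \<omega>
    assume cube: "\<forall>n\<ge>1. Lam n \<omega> \<in> open_cube n"
      and w: "\<forall>n\<ge>1. (\<forall>i<n. 0 \<le> W n \<omega> i) \<and> (\<Sum>i<n. W n \<omega> i) = 1"
      and D: "\<forall>k. (\<lambda>n. ?s n k (Lam n \<omega>)) \<longlonglongrightarrow> 0"
      and F: "\<forall>k. (\<lambda>n. \<Sum>i<n. ((?y n \<omega> i) ^ k - ?e n k \<omega>) * W n \<omega> i) \<longlonglongrightarrow> 0"
    define m where "m n k = ?e n k \<omega>" for n k
    have m: "(\<lambda>n. m n k) \<longlonglongrightarrow> mp_moment \<tau> k" for k
    proof (rule moment_recursion_limit[where D = "\<lambda>k n. ?s n k (Lam n \<omega>)",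
          OF _ _ coeff_A[OF \<beta> ab lim_a \<tau>(1) lim_b] coeff_B[OF \<beta> ab lim_a \<tau>(1) lim_b] lim_a a_over_b[OF \<beta> ab lim_a \<tau>(1) lim_b]])
      show "(\<lambda>n. m n 0) \<longlonglongrightarrow> 1"
        by (rule tendsto_eventually) (use eventually_ge_at_top[of 1] in eventually_elim, simp add: m_def emp_moment_0)
    qed (use D in \<open>auto simp: scaled_D_def m_def\<close>)
    note MP = real_distribution_marchenko_pastur[OF \<tau>] marchenko_pastur_power_integrable[OF \<tau>]
      mp_moment_le[OF \<tau>, folded marchenko_pastur_moment[OF \<tau>]]
    have "weak_conv_m (\<lambda>n. spectral_meas n (b n / a n) (Lam n \<omega>) (W n \<omega>)) (marchenko_pastur \<tau>)"
    proof (rule spectral_meas_weak_conv[OF _ MP])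
      fix k
      \<comment> \<open>For n \<ge> 1 the weights add up to 1, so a weighted moment is its centred
        part, which tends to 0, plus the empirical moment.\<close>
      have "(\<lambda>n. (\<Sum>i<n. ((?y n \<omega> i) ^ k - m n k) * W n \<omega> i) + m n k) \<longlonglongrightarrow> 0 + mp_moment \<tau> k"
        using F unfolding m_def[symmetric] by (intro tendsto_add m) simp
      moreover have "\<forall>\<^sub>F n in sequentially. (\<Sum>i<n. ((?y n \<omega> i) ^ k - m n k) * W n \<omega> i) + m n k
          = (\<Sum>i<n. W n \<omega> i * (?y n \<omega> i) ^ k)"
        using eventually_ge_at_top[of 1]
      proof eventually_elim
        fix n :: nat assume n: "1 \<le> n"
        have "(\<Sum>i<n. ((?y n \<omega> i) ^ k - m n k) * W n \<omega> i)
            = (\<Sum>i<n. W n \<omega> i * (?y n \<omega> i) ^ k - m n k * W n \<omega> i)"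
          by (intro sum.cong refl) (simp add: algebra_simps)
        also have "\<dots> = (\<Sum>i<n. W n \<omega> i * (?y n \<omega> i) ^ k) - m n k * (\<Sum>i<n. W n \<omega> i)"
          by (simp only: sum_subtractf sum_distrib_left)
        finally show "(\<Sum>i<n. ((?y n \<omega> i) ^ k - m n k) * W n \<omega> i) + m n k
          = (\<Sum>i<n. W n \<omega> i * (?y n \<omega> i) ^ k)" using w n by simp
      qed
      ultimately show "(\<lambda>n. \<Sum>i<n. W n \<omega> i * (?y n \<omega> i) ^ k) \<longlonglongrightarrow> (\<integral>x. x ^ k \<partial>marchenko_pastur \<tau>)"
        unfolding marchenko_pastur_moment[OF \<tau>] by (simp add: tendsto_cong)
    qed (use w in auto)
    moreover have "weak_conv_m (\<lambda>n. spectral_meas n (b n / a n) (Lam n \<omega>) (\<lambda>_. 1 / real n)) (marchenko_pastur \<tau>)"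
    proof (rule spectral_meas_weak_conv[OF _ MP])
      show "(\<lambda>n. \<Sum>i<n. 1 / real n * (?y n \<omega> i) ^ k) \<longlonglongrightarrow> (\<integral>x. x ^ k \<partial>marchenko_pastur \<tau>)" for k
        using m[of k] unfolding marchenko_pastur_moment[OF \<tau>] m_def emp_moment_def
        by (simp add: sum_divide_distrib)
    qed auto
    ultimately show "weak_conv_m (\<lambda>n. spectral_meas n (b n / a n) (Lam n \<omega>) (W n \<omega>)) (marchenko_pastur \<tau>)
         \<and> weak_conv_m (\<lambda>n. spectral_meas n (b n / a n) (Lam n \<omega>) (\<lambda>_. 1 / real n)) (marchenko_pastur \<tau>)" ..
  qed
qed

end
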